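(* Let $D$ be a nonnegative integer-valued random variable with $\mathbb{E}(e^{sD})<\infty$ for all $s\in\mathbb{R}$. Consider the annealed Ising model on the configuration model random graph $G_n$ with $n$ vertices whose degrees $D_1,\dots,D_n$ are i.i.d. with the law of $D$. For all $\beta\ge 0$ and $B\in\mathbb{R}$, the annealed pressure $\psi_n(\beta,B)=\frac1n\log\mathbb{E}(Z_n(\beta,B))$ converges as $n\to\infty$ to the limit $$\psi(\beta,B)=-B+\max_{0\le t\le 1}\left[t\log\left(\frac1t\right)+(1-t)\log\left(\frac1{1-t}\right)+2Bt+G(\beta,t)\right],$$ where $$G(\beta,t)=\sup_{a,b}\Big\{b\big(\beta/2+F(a/b)\big)-t\,\Lambda^*\Big(\frac at\Big)-(1-t)\,\Lambda^*\Big(\frac{b-a}{1-t}\Big)\Big\}.$$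
   Context: Configuration model: given the degrees $D_1,\dots,D_n$, attach $D_i$ half-edges to vertex $v_i$ and pair all half-edges by a uniformly random perfect matching, each pair forming an edge (self-loops and multiple edges allowed). The total number of half-edges is assumed even (if it is odd, one of the $D_i$'s is increased by $1$). Ising model: $k_{i,j}$ is the number of edges between $v_i$ and $v_j$ (for $i=j$, the number of self-loops at $v_i$), and $$Z_n(\beta,B)=\sum_{\sigma\in\{-1,1\}^n}\exp\Big(\beta\sum_{i\le j}k_{i,j}\sigma_i\sigma_j+B\sum_{i=1}^n\sigma_i\Big).$$ $\mathbb{E}$ denotes expectation over both the degrees and the random matching. $F(t)=\int_0^{\min\{t,1-t\}}\log f(s)\,ds$ for $t\in[0,1]$, with $f(s)=\frac{e^{-2\beta}(1-2s)+\sqrt{1+(e^{-4\beta}-1)(1-2s)^2}}{2(1-s)}$. $\Lambda(s)=\log\mathbb{E}(e^{sD})$ and $\Lambda^*(x)=\sup_{s\in\mathbb{R}}\{xs-\Lambda(s)\}$. The supremum defining $G(\beta,t)$ is over real $0\le a\le b$ (elsewhere the rate term is $+\infty$). Conventions: $bF(a/b)=0$ when $b=0$; $0\cdot\Lambda^*(x/0)$ is $0$ if $x=0$ and $+\infty$ if $x\neq0$; $0\log(1/0)=0$. *)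

theory Defs
  imports "HOL-Probability.Probability"
begin

section \<open>The configuration model\<close>

text \<open>
  The law of the degree variable is a probability mass function on the naturals. The vertices of
  the graph on \<open>n\<close> vertices are \<open>0, \<dots>, n - 1\<close>.

  When the total degree is odd, one degree is increased by one. Which one is left open: the rule
  \<open>r n d\<close> names the vertex to change, and may depend on the number of vertices and on the degrees.
\<close>

definition adjusted_degrees ::
    "(nat \<Rightarrow> (nat \<Rightarrow> nat) \<Rightarrow> nat) \<Rightarrow> nat \<Rightarrow> (nat \<Rightarrow> nat) \<Rightarrow> nat \<Rightarrow> nat" where
  "adjusted_degrees r n d =
     (if even (\<Sum>i<n. d i) then d else d(r n d := d (r n d) + 1))"

definition half_edges :: "nat \<Rightarrow> (nat \<Rightarrow> nat) \<Rightarrow> (nat \<times> nat) set" where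
  "half_edges n d = (SIGMA i:{..<n}. {..<d i})"

definition perfect_matchings :: "'a set \<Rightarrow> 'a set set set" where
  "perfect_matchings H = {M. partition_on H M \<and> (\<forall>e\<in>M. card e = 2)}"

definition configuration_model ::
    "(nat \<Rightarrow> (nat \<Rightarrow> nat) \<Rightarrow> nat) \<Rightarrow> nat pmf \<Rightarrow> nat \<Rightarrow> (nat \<times> nat) set set pmf" where
  "configuration_model r D n =
     bind_pmf (Pi_pmf {..<n} 0 (\<lambda>_. D))
       (\<lambda>d. pmf_of_set (perfect_matchings (half_edges n (adjusted_degrees r n d))))"

text \<open>
  A half-edge \<open>(i, l)\<close> is attached to the vertex \<open>i\<close>, so a pair \<open>e\<close> of half-edges joins the
  vertices in \<open>fst ` e\<close>; this is a singleton exactly for self-loops.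
\<close>

definition edge_count :: "(nat \<times> nat) set set \<Rightarrow> nat \<Rightarrow> nat \<Rightarrow> nat" where
  "edge_count M i j = card {e \<in> M. fst ` e = {i, j}}"

section \<open>The annealed Ising model\<close>

definition partition_function ::
    "real \<Rightarrow> real \<Rightarrow> nat \<Rightarrow> (nat \<times> nat) set set \<Rightarrow> real" where
  "partition_function \<beta> B n M =
     (\<Sum>\<sigma> \<in> {..<n} \<rightarrow>\<^sub>E {-1, 1}.
        exp (\<beta> * (\<Sum>j<n. \<Sum>i\<le>j. real (edge_count M i j) * \<sigma> i * \<sigma> j) + B * (\<Sum>i<n. \<sigma> i)))"

definition annealed_pressure ::
    "(nat \<Rightarrow> (nat \<Rightarrow> nat) \<Rightarrow> nat) \<Rightarrow> nat pmf \<Rightarrow> real \<Rightarrow> real \<Rightarrow> nat \<Rightarrow> real" where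
  "annealed_pressure r D \<beta> B n =
     1 / real n * ln (measure_pmf.expectation (configuration_model r D n) (partition_function \<beta> B n))"

section \<open>The limiting functional\<close>

definition f_edge :: "real \<Rightarrow> real \<Rightarrow> real" where
  "f_edge \<beta> s =
     (exp (-2 * \<beta>) * (1 - 2 * s) + sqrt (1 + (exp (-4 * \<beta>) - 1) * (1 - 2 * s)\<^sup>2)) / (2 * (1 - s))"

definition F_edge :: "real \<Rightarrow> real \<Rightarrow> real" where
  "F_edge \<beta> t = integral {0..min t (1 - t)} (\<lambda>s. ln (f_edge \<beta> s))"

definition cumulant :: "nat pmf \<Rightarrow> real \<Rightarrow> real" where
  "cumulant D s = ln (measure_pmf.expectation D (\<lambda>k. exp (s * real k)))"

definition cumulant_conjugate :: "nat pmf \<Rightarrow> real \<Rightarrow> ereal" where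
  "cumulant_conjugate D x = (SUP s. ereal (x * s - cumulant D s))"

text \<open>
  \<open>rate D t x\<close> is \<open>t \<Lambda>\<^sup>*(x / t)\<close>. Since \<open>x / 0 = 0\<close> in HOL, the convention at \<open>t = 0\<close>
  has to be written out. The other conventions (\<open>b F(a / b) = 0\<close> for \<open>b = 0\<close> and
  \<open>0 log (1 / 0) = 0\<close>) hold as they stand.
\<close>

definition rate :: "nat pmf \<Rightarrow> real \<Rightarrow> real \<Rightarrow> ereal" where
  "rate D t x =
     (if t = 0 then (if x = 0 then 0 else \<infinity>) else ereal t * cumulant_conjugate D (x / t))"

definition G_edge :: "nat pmf \<Rightarrow> real \<Rightarrow> real \<Rightarrow> ereal" where
  "G_edge D \<beta> t =
     (SUP (a, b) \<in> {(a, b). 0 \<le> a \<and> a \<le> b}.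
        ereal (b * (\<beta> / 2 + F_edge \<beta> (a / b))) - rate D t a - rate D (1 - t) (b - a))"

definition pressure_functional :: "nat pmf \<Rightarrow> real \<Rightarrow> real \<Rightarrow> real \<Rightarrow> ereal" where
  "pressure_functional D \<beta> B t =
     ereal (t * ln (1 / t) + (1 - t) * ln (1 / (1 - t)) + 2 * B * t) + G_edge D \<beta> t"

end

theory Submission imports Defs "HOL-Real_Asymp.Real_Asymp" begin

text \<open>
  Fix the set \<open>S\<close> of vertices of spin \<open>1\<close> and the degrees. The Ising energy of a pairing is half the
  number of half-edges minus twice the number of crossing pairs, those between \<open>S\<close> and its
  complement. Averaging over the pairing therefore gives \<open>exp (\<beta> m / 2) g(a, c)\<close>, where \<open>a\<close> and \<open>c\<close>
  count the half-edges at \<open>S\<close> and off \<open>S\<close>, \<open>m = a + c\<close>, and \<open>g(a, c)\<close> is the mean of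
  \<open>\<rho> ^ (number of crossing pairs)\<close> with \<open>\<rho> = exp (-2 \<beta>)\<close>.

  The unnormalised mean \<open>crossing_poly\<close> obeys two three-term recursions, obtained by pairing off one
  half-edge of either kind. They express each ratio \<open>g(a + 1, c - 1) / g(a, c)\<close> as the image of the
  previous one under a Moebius map, which contracts logarithms by the factor \<open>(1 - \<rho>) / (1 + \<rho>)\<close> and
  whose fixed point is a value of \<open>f_edge \<beta>\<close> at a point near \<open>a / m\<close>. Summing the logarithms of the
  ratios gives a Riemann sum for \<open>F_edge\<close>: \<open>ln g(a, c) = m F_edge \<beta> (a / m) + O(sqrt (m + 1))\<close>
  (\<open>crossing_poly_asymp\<close>).

  Up to this error, the expected partition function is a sum over \<open>S\<close> of expectations of
  exponentials of a Lipschitz function, homogeneous of degree one, of two independent sums of degrees,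
  and Laplace's method applies. From above, a Chernoff bound for every pair of values of the sums
  suffices, because only polynomially many values matter (\<open>plus_set_weight_le\<close>). From below, the degrees are tilted so
  that the two sums concentrate at the optimal values, by Chebyshev's inequality
  (\<open>prob_window_ge\<close>).

  The rate functions enter only in their dual form: \<open>rate D t x\<close> is the supremum over \<open>s\<close> of
  \<open>s x - t \<Lambda>(s)\<close>, also for \<open>t = 0\<close>. A number is then a lower bound for the variational expression at
  \<open>(t, a, c)\<close> if and only if it is a lower bound for \<open>dual_functional\<close> for all \<open>s\<close> and \<open>s'\<close>. As this
  functional is continuous in \<open>(t, a, c)\<close>, superlevel sets are closed; they are also bounded, and so
  the supremum is attained (\<open>variational_maximiser\<close>).
\<close>

section \<open>Perfect matchings and crossing pairs\<close>

lemma perfect_matchings_empty: "perfect_matchings {} = {{}}"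
  by (auto simp: perfect_matchings_def partition_on_def)

lemma finite_perfect_matchings: "finite H \<Longrightarrow> finite (perfect_matchings H)"
  by (rule finite_subset[of _ "Pow (Pow H)"]) (auto simp: perfect_matchings_def partition_on_def)

lemma finite_perfect_matching:
  "finite H \<Longrightarrow> M \<in> perfect_matchings H \<Longrightarrow> finite M"
  by (auto simp: perfect_matchings_def intro: finite_elements)

lemma insert_edge_perfect_matching:
  assumes "x \<in> H" "y \<in> H" "x \<noteq> y" "M \<in> perfect_matchings (H - {x, y})"
  shows "insert {x, y} M \<in> perfect_matchings H"
proof -
  have M: "partition_on (H - {x, y}) M" "\<forall>e\<in>M. card e = 2"
    using assms(4) by (auto simp: perfect_matchings_def)
  have "disjoint M" using M(1) by (auto simp: partition_on_def)
  moreover have "\<Union>M = H - {x, y}" using M(1) by (simp add: partition_on_def)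
  ultimately have "partition_on H (insert {x, y} M)"
    using M(1) assms by (auto simp: partition_on_def disjoint_def)
  then show "insert {x, y} M \<in> perfect_matchings H"
    using M(2) assms(3) by (auto simp: perfect_matchings_def)
qed

text \<open>
  Conditioning on the partner \<open>y\<close> of a fixed point \<open>x\<close> turns sums over matchings into recursions.
\<close>

lemma perfect_matchings_partner_bij:
  assumes "x \<in> H"
  shows "bij_betw (\<lambda>(y, M). insert {x, y} M)
    (SIGMA y:H - {x}. perfect_matchings (H - {x, y})) (perfect_matchings H)"
proof (rule bij_betw_imageI)
  have un: "\<Union>M = H - {x, y}" if "M \<in> perfect_matchings (H - {x, y})" for M y
    using that by (simp add: perfect_matchings_def partition_on_def)
  show "inj_on (\<lambda>(y, M). insert {x, y} M) (SIGMA y:H - {x}. perfect_matchings (H - {x, y}))"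
  proof (rule inj_onI)
    fix p q
    assume p: "p \<in> (SIGMA y:H - {x}. perfect_matchings (H - {x, y}))"
      and q: "q \<in> (SIGMA y:H - {x}. perfect_matchings (H - {x, y}))"
      and pq: "(case p of (y, M) \<Rightarrow> insert {x, y} M) = (case q of (y, M) \<Rightarrow> insert {x, y} M)"
    obtain y M z N where "p = (y, M)" "q = (z, N)" by (metis surj_pair)
    note pq' = this
    have yz: "y \<in> H" "y \<noteq> x" "z \<in> H" "z \<noteq> x"
      and M: "M \<in> perfect_matchings (H - {x, y})" and N: "N \<in> perfect_matchings (H - {x, z})"
      using p q unfolding pq' by simp_all
    have eq: "insert {x, y} M = insert {x, z} N" using pq unfolding pq' by simp
    have "x \<notin> \<Union>N" using un[OF N] by auto
    moreover have "{x, y} \<in> insert {x, z} N" using eq by blast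
    ultimately have "{x, y} = {x, z}" by blast
    then have "y = z" using yz by (auto simp: doubleton_eq_iff)
    moreover have "{x, y} \<notin> M" "{x, z} \<notin> N" using un[OF M] un[OF N] by blast+
    with eq have "M = N" unfolding \<open>y = z\<close> by (simp add: insert_ident)
    ultimately show "p = q" using pq' by simp
  qed
  show "(\<lambda>(y, M). insert {x, y} M) ` (SIGMA y:H - {x}. perfect_matchings (H - {x, y}))
      = perfect_matchings H"
  proof (intro equalityI subsetI)
    fix N assume "N \<in> (\<lambda>(y, M). insert {x, y} M) ` (SIGMA y:H - {x}. perfect_matchings (H - {x, y}))"
    then show "N \<in> perfect_matchings H"
      using insert_edge_perfect_matching[OF assms] by auto
  next
    fix N assume N: "N \<in> perfect_matchings H"
    then have part: "partition_on H N" and two: "\<forall>e\<in>N. card e = 2"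
      by (auto simp: perfect_matchings_def)
    obtain e where e: "e \<in> N" "x \<in> e"
      using part assms by (auto simp: partition_on_def)
    with two obtain y where y: "e = {x, y}" "y \<noteq> x"
      by (metis card_2_iff doubleton_eq_iff insert_iff singletonD)
    have yH: "y \<in> H" using e y part by (auto simp: partition_on_def)
    have dis: "disjoint N" and UN: "\<Union>N = H" using part by (auto simp: partition_on_def)
    have "\<Union>(N - {e}) = H - {x, y}"
    proof -
      have "e' \<inter> e = {}" if "e' \<in> N - {e}" for e'
        using dis that e(1) by (auto simp: disjoint_def)
      then show ?thesis using UN e(1) y by blast
    qed
    then have "partition_on (H - {x, y}) (N - {e})"
      using part by (auto simp: partition_on_def disjoint_def)
    then have "N - {e} \<in> perfect_matchings (H - {x, y})"
      using two by (auto simp: perfect_matchings_def)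
    moreover have "N = insert {x, y} (N - {e})" using e y by auto
    ultimately show "N \<in> (\<lambda>(y, M). insert {x, y} M) ` (SIGMA y:H - {x}. perfect_matchings (H - {x, y}))"
      using yH y by (intro image_eqI[where x = "(y, N - {e})"]) auto
  qed
qed

definition crossing_edges :: "'a set \<Rightarrow> 'a set set \<Rightarrow> 'a set set" where
  "crossing_edges P M = {e \<in> M. card (e \<inter> P) = 1}"

definition matching_weight :: "real \<Rightarrow> 'a set \<Rightarrow> 'a set \<Rightarrow> real" where
  "matching_weight \<rho> H P = (\<Sum>M\<in>perfect_matchings H. \<rho> ^ card (crossing_edges P M))"

lemma matching_weight_partner:
  assumes "finite H" "x \<in> H"
  shows "matching_weight \<rho> H P =
    (\<Sum>y\<in>H - {x}. (if x \<in> P \<longleftrightarrow> y \<in> P then 1 else \<rho>) *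
       matching_weight \<rho> (H - {x, y}) (P - {x, y}))"
proof -
  have step: "\<rho> ^ card (crossing_edges P (insert {x, y} M)) =
      (if x \<in> P \<longleftrightarrow> y \<in> P then 1 else \<rho>) * \<rho> ^ card (crossing_edges (P - {x, y}) M)"
    if y: "y \<in> H - {x}" and M: "M \<in> perfect_matchings (H - {x, y})" for y M
  proof -
    have un: "\<Union>M = H - {x, y}"
      using M by (simp add: perfect_matchings_def partition_on_def)
    have "e \<inter> P = e \<inter> (P - {x, y})" if "e \<in> M" for e
      using un that by blast
    then have same: "crossing_edges P M = crossing_edges (P - {x, y}) M"
      by (auto simp: crossing_edges_def)
    have new: "{x, y} \<notin> M" using un by blast
    have fin: "finite (crossing_edges (P - {x, y}) M)"
      using finite_perfect_matching[of "H - {x, y}" M] M assms(1)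
      by (auto simp: crossing_edges_def)
    have "card ({x, y} \<inter> P) = 1 \<longleftrightarrow> \<not> (x \<in> P \<longleftrightarrow> y \<in> P)"
      using y by (cases "x \<in> P"; cases "y \<in> P") (auto simp: Int_insert_left card_insert_if)
    then have "crossing_edges P (insert {x, y} M) =
        (if x \<in> P \<longleftrightarrow> y \<in> P then crossing_edges P M else insert {x, y} (crossing_edges P M))"
      unfolding crossing_edges_def by (simp split: if_splits) blast
    then show ?thesis
      using same new fin by (auto simp: crossing_edges_def)
  qed
  have "matching_weight \<rho> H P =
      (\<Sum>(y, M)\<in>(SIGMA y:H - {x}. perfect_matchings (H - {x, y})).
        \<rho> ^ card (crossing_edges P (insert {x, y} M)))"
    unfolding matching_weight_def
    by (subst sum.reindex_bij_betw[OF perfect_matchings_partner_bij[OF assms(2)], symmetric])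
       (simp add: case_prod_unfold)
  also have "\<dots> = (\<Sum>y\<in>H - {x}. \<Sum>M\<in>perfect_matchings (H - {x, y}).
        \<rho> ^ card (crossing_edges P (insert {x, y} M)))"
    by (rule sum.Sigma[symmetric]) (use assms finite_perfect_matchings in auto)
  also have "\<dots> = (\<Sum>y\<in>H - {x}. (if x \<in> P \<longleftrightarrow> y \<in> P then 1 else \<rho>) *
       matching_weight \<rho> (H - {x, y}) (P - {x, y}))"
    unfolding matching_weight_def sum_distrib_left
    by (intro sum.cong refl) (use step in auto)
  finally show ?thesis .
qed

text \<open>
  The generating polynomial of the number of crossing pairs, for \<open>a\<close> points on one side and \<open>c\<close> on the
  other; equivalently the moment \<open>E (X ^ a * Y ^ c)\<close> of centred jointly Gaussian variables of unit variance and
  covariance \<open>\<rho>\<close>. The recursion pairs off a point of the first side as long as there is one. Each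
  truncated subtraction comes with a factor that vanishes where it truncates.
\<close>

fun crossing_poly :: "real \<Rightarrow> nat \<Rightarrow> nat \<Rightarrow> real" where
  "crossing_poly \<rho> 0 0 = 1"
| "crossing_poly \<rho> 0 (Suc c) = real c * crossing_poly \<rho> 0 (c - 1)"
| "crossing_poly \<rho> (Suc a) c =
     real a * crossing_poly \<rho> (a - 1) c + \<rho> * real c * crossing_poly \<rho> a (c - 1)"

text \<open>
  A pair crosses from \<open>P\<close> to its complement if and only if it crosses back, so the two sides are
  exchangeable. This is what yields a second recursion for \<open>crossing_poly\<close>.
\<close>

lemma matching_weight_complement:
  assumes "finite H" "P \<subseteq> H"
  shows "matching_weight \<rho> H (H - P) = matching_weight \<rho> H P"
  unfolding matching_weight_def
proof (intro sum.cong refl arg_cong[where f = "\<lambda>A. \<rho> ^ card A"])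
  fix M assume M: "M \<in> perfect_matchings H"
  have "card (e \<inter> (H - P)) = 1 \<longleftrightarrow> card (e \<inter> P) = 1" if "e \<in> M" for e
  proof -
    have e: "card e = 2" "e \<subseteq> H"
      using M that by (auto simp: perfect_matchings_def partition_on_def)
    have "finite e" by (rule finite_subset[OF e(2) assms(1)])
    then have "card ((e \<inter> P) \<union> (e \<inter> (H - P))) = card (e \<inter> P) + card (e \<inter> (H - P))"
      by (intro card_Un_disjoint) auto
    moreover have "(e \<inter> P) \<union> (e \<inter> (H - P)) = e" using e(2) by auto
    ultimately have "card (e \<inter> P) + card (e \<inter> (H - P)) = 2" using e(1) by simp
    then show ?thesis by linarith
  qed
  then show "crossing_edges (H - P) M = crossing_edges P M" by (auto simp: crossing_edges_def)
qed

text \<open>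
  The weight of a partner of \<open>x\<close> depends only on its side, so the sum over partners has two terms.
  The values on smaller sets are an assumption, because this is the induction step that identifies
  \<open>matching_weight\<close> with \<open>crossing_poly\<close>.
\<close>

lemma matching_weight_split:
  assumes H: "finite H" "x \<in> P" and P: "P \<subseteq> H"
    and IH: "\<And>y. matching_weight \<rho> (H - {x, y}) (P - {x, y})
       = crossing_poly \<rho> (card (P - {x, y})) (card (H - P - {x, y}))"
  shows "matching_weight \<rho> H P =
      real (card P - 1) * crossing_poly \<rho> (card P - 1 - 1) (card (H - P))
      + \<rho> * real (card (H - P)) * crossing_poly \<rho> (card P - 1) (card (H - P) - 1)"
proof -
  let ?t = "\<lambda>y. (if y \<in> P then 1 else \<rho>) *
       crossing_poly \<rho> (card (P - {x, y})) (card (H - P - {x, y}))"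
  have fP: "finite P" by (rule finite_subset[OF P H(1)])
  have xH: "x \<in> H" using H(2) P by auto
  have "matching_weight \<rho> H P = (\<Sum>y\<in>H - {x}. ?t y)"
    unfolding matching_weight_partner[OF H(1) xH] using H(2) by (simp add: IH)
  also have "\<dots> = (\<Sum>y\<in>P - {x}. ?t y) + (\<Sum>y\<in>H - P. ?t y)"
    by (subst sum.union_disjoint[symmetric]) (use xH P fP H in \<open>auto intro!: sum.cong\<close>)
  also have "(\<Sum>y\<in>P - {x}. ?t y) =
      (\<Sum>y\<in>P - {x}. crossing_poly \<rho> (card P - 1 - 1) (card (H - P)))"
  proof (intro sum.cong refl)
    fix y assume y: "y \<in> P - {x}"
    have "H - P - {x, y} = H - P" "card (P - {x, y}) = card P - 1 - 1"
      using H(2) y fP by (auto simp: card_Diff_subset)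
    then show "?t y = crossing_poly \<rho> (card P - 1 - 1) (card (H - P))" using y by simp
  qed
  also have "(\<Sum>y\<in>H - P. ?t y) =
      (\<Sum>y\<in>H - P. \<rho> * crossing_poly \<rho> (card P - 1) (card (H - P) - 1))"
  proof (intro sum.cong refl)
    fix y assume y: "y \<in> H - P"
    have "H - P - {x, y} = H - P - {y}" "P - {x, y} = P - {x}" using H(2) y by auto
    then show "?t y = \<rho> * crossing_poly \<rho> (card P - 1) (card (H - P) - 1)"
      using H y fP by (simp add: card_Diff_subset)
  qed
  finally show ?thesis using H(2) fP by (simp add: card_Diff_subset mult_ac)
qed

lemma crossing_poly_0_right: "crossing_poly \<rho> a 0 = crossing_poly \<rho> 0 a"
proof (induction a rule: less_induct)
  case (less a)
  then show ?case by (cases a) auto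
qed

lemma matching_weight_eq_poly:
  assumes "finite H" "P \<subseteq> H"
  shows "matching_weight \<rho> H P = crossing_poly \<rho> (card P) (card (H - P))"
  using assms
proof (induction "card H" arbitrary: H P rule: less_induct)
  case less
  have split: "matching_weight \<rho> H Q = crossing_poly \<rho> (card Q) (card (H - Q))"
    if Q: "Q \<subseteq> H" "x \<in> Q" for Q x
  proof -
    have fQ: "finite Q" by (rule finite_subset[OF Q(1) less.prems(1)])
    obtain a where a: "card Q = Suc a" using Q(2) fQ by (metis card_Suc_Diff1)
    have "matching_weight \<rho> (H - {x, y}) (Q - {x, y})
       = crossing_poly \<rho> (card (Q - {x, y})) (card (H - Q - {x, y}))" for y
    proof -
      have eq: "H - {x, y} - (Q - {x, y}) = H - Q - {x, y}" by auto
      have "card (H - {x, y}) < card H"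
        using Q less.prems by (intro psubset_card_mono) auto
      from less.hyps[OF this, of "Q - {x, y}"] show ?thesis
        unfolding eq using Q(1) less.prems(1) by (simp add: Diff_mono)
    qed
    from matching_weight_split[OF less.prems(1) Q(2,1) this] show ?thesis by (simp add: a)
  qed
  show ?case
  proof (cases "P = {}")
    case True
    show ?thesis
    proof (cases "H = {}")
      case True
      then show ?thesis using \<open>P = {}\<close>
        by (simp add: matching_weight_def perfect_matchings_empty crossing_edges_def)
    next
      case False
      then show ?thesis
        using split[of H] matching_weight_complement[OF less.prems, of \<rho>] \<open>P = {}\<close>
        by (auto simp: crossing_poly_0_right)
    qed
  next
    case False
    then show ?thesis using split[OF less.prems(2)] by blast
  qed
qed

lemma crossing_poly_commute: "crossing_poly \<rho> a c = crossing_poly \<rho> c a"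
proof -
  have "{..<a + c} - ({..<a + c} - {..<a}) = {..<a}" "card ({..<a + c} - {..<a}) = c"
    by (auto simp: card_Diff_subset)
  then show ?thesis
    using matching_weight_complement[of "{..<a + c}" "{..<a}" \<rho>]
      matching_weight_eq_poly[of "{..<a + c}" "{..<a}" \<rho>]
      matching_weight_eq_poly[of "{..<a + c}" "{..<a + c} - {..<a}" \<rho>]
    by (metis Diff_subset card_lessThan finite_lessThan le_add1 lessThan_subset_iff)
qed

lemma crossing_poly_Suc_right:
  "crossing_poly \<rho> a (Suc c) =
     real c * crossing_poly \<rho> a (c - 1) + \<rho> * real a * crossing_poly \<rho> (a - 1) c"
  unfolding crossing_poly_commute[of \<rho> a] crossing_poly_commute[of \<rho> "a - 1"] by simp

lemma crossing_poly_nonneg: "\<rho> \<ge> 0 \<Longrightarrow> crossing_poly \<rho> a c \<ge> 0"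
  by (induction \<rho> a c rule: crossing_poly.induct) auto

lemma crossing_poly_pos:
  "\<rho> > 0 \<Longrightarrow> even (a + c) \<Longrightarrow> crossing_poly \<rho> a c > 0"
proof (induction \<rho> a c rule: crossing_poly.induct)
  case (2 \<rho> c)
  then show ?case by (cases c) auto
next
  case (3 \<rho> a c)
  show ?case
  proof (cases c)
    case 0
    with 3 show ?thesis by (cases a) auto
  next
    case (Suc c')
    have "crossing_poly \<rho> a (c - 1) > 0" using 3 Suc by auto
    then have "\<rho> * real c * crossing_poly \<rho> a (c - 1) > 0" using 3 Suc by simp
    moreover have "real a * crossing_poly \<rho> (a - 1) c \<ge> 0"
      using crossing_poly_nonneg[of \<rho>] 3 by simp
    ultimately show ?thesis by simp
  qed
qed simp

text \<open>
  For \<open>\<rho> = 1\<close> the matchings are merely counted, whatever the sides. This is the normalisation of the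
  uniform pairing.
\<close>

lemma crossing_poly_one: "crossing_poly 1 a c = crossing_poly 1 0 (a + c)"
proof (induction "1::real" a c rule: crossing_poly.induct)
  case (3 a c)
  have 1: "real a * crossing_poly 1 (a - 1) c = real a * crossing_poly 1 0 (a + c - 1)"
    using 3(1) by (cases a) auto
  have 2: "real c * crossing_poly 1 a (c - 1) = real c * crossing_poly 1 0 (a + c - 1)"
    using 3(2) by (cases c) auto
  have "crossing_poly 1 (Suc a) c = (real a + real c) * crossing_poly 1 0 (a + c - 1)"
    using 1 2 by (simp only: crossing_poly.simps mult_1_left distrib_right)
  then show ?case by simp
qed simp_all

lemma crossing_poly_le_one:
  assumes "0 \<le> \<rho>" "\<rho> \<le> 1" 
  shows "crossing_poly \<rho> a c \<le> crossing_poly 1 a c"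
  using assms
proof (induction \<rho> a c rule: crossing_poly.induct)
  case (3 \<rho> a c)
  have "\<rho> * real c * crossing_poly \<rho> a (c - 1) \<le> 1 * real c * crossing_poly 1 a (c - 1)"
    using 3 by (intro mult_mono) (auto simp: crossing_poly_nonneg)
  moreover have "real a * crossing_poly \<rho> (a - 1) c \<le> real a * crossing_poly 1 (a - 1) c"
    using 3 by (intro mult_left_mono) auto
  ultimately show ?case by simp
qed (simp_all add: mult_left_mono)

section \<open>The edge function\<close>

lemma exp_minus_four: "exp (- 4 * \<beta>) = (exp (- 2 * \<beta>))\<^sup>2" for \<beta> :: real
  by (simp add: power2_eq_square flip: exp_add)

lemma f_edge_radicand_ge:
  fixes \<beta> s :: real
  assumes "\<beta> \<ge> 0" "0 \<le> s" "s \<le> 1/2"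
  shows "1 + (exp (-4 * \<beta>) - 1) * (1 - 2 * s)\<^sup>2 \<ge> (exp (-2 * \<beta>))\<^sup>2"
proof -
  have "(1 - 2 * s)\<^sup>2 \<le> 1" using assms by (simp add: power_le_one)
  moreover have "exp (-4 * \<beta>) \<le> 1" using assms by simp
  ultimately have "(1 - exp (-4 * \<beta>)) * (1 - 2 * s)\<^sup>2 \<le> (1 - exp (-4 * \<beta>)) * 1"
    by (intro mult_left_mono) auto
  then have "1 + (exp (-4 * \<beta>) - 1) * (1 - 2 * s)\<^sup>2 \<ge> exp (-4 * \<beta>)"
    by (simp add: algebra_simps)
  then show ?thesis unfolding exp_minus_four[symmetric] .
qed

lemma f_edge_numerator_ge:
  fixes \<beta> s :: real
  assumes "\<beta> \<ge> 0" "0 \<le> s" "s \<le> 1/2"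
  shows "exp (-2 * \<beta>) * (1 - 2 * s) + sqrt (1 + (exp (-4 * \<beta>) - 1) * (1 - 2 * s)\<^sup>2)
     \<ge> exp (-2 * \<beta>)"
proof -
  have "sqrt (1 + (exp (-4 * \<beta>) - 1) * (1 - 2 * s)\<^sup>2) \<ge> exp (-2 * \<beta>)"
    using f_edge_radicand_ge[OF assms] by (intro real_le_rsqrt)
  moreover have "exp (-2 * \<beta>) * (1 - 2 * s) \<ge> 0" using assms by simp
  ultimately show ?thesis by linarith
qed

lemma f_edge_pos:
  assumes "\<beta> \<ge> 0" "0 \<le> s" "s \<le> 1/2"
  shows "f_edge \<beta> s > 0"
proof -
  have "exp (-2 * \<beta>) * (1 - 2 * s) + sqrt (1 + (exp (-4 * \<beta>) - 1) * (1 - 2 * s)\<^sup>2) > 0"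
    using f_edge_numerator_ge[OF assms] by (rule less_le_trans[rotated]) simp
  then show ?thesis using assms unfolding f_edge_def by (intro divide_pos_pos) auto
qed

text \<open>
  With \<open>\<rho> = exp (-2 \<beta>)\<close>, the value \<open>f_edge \<beta> s\<close> is the positive root of
  \<open>(1 - s) r\<^sup>2 - \<rho> (1 - 2 s) r - s = 0\<close>. In this form it is a fixed point of
  \<open>r \<mapsto> (s + \<rho> (1 - s) r) / (\<rho> s + (1 - s) r)\<close>, the map that governs successive ratios.
\<close>

lemma f_edge_fixed_point:
  assumes "\<beta> \<ge> 0" "0 \<le> s" "s \<le> 1/2"
  shows "f_edge \<beta> s * (exp (-2 * \<beta>) * s + (1 - s) * f_edge \<beta> s)
    = s + exp (-2 * \<beta>) * (1 - s) * f_edge \<beta> s"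
proof -
  define \<rho> where "\<rho> = exp (-2 * \<beta>)"
  define q where "q = sqrt (1 + (\<rho>\<^sup>2 - 1) * (1 - 2 * s)\<^sup>2)"
  define r where "r = f_edge \<beta> s"
  have "1 + (\<rho>\<^sup>2 - 1) * (1 - 2 * s)\<^sup>2 \<ge> 0"
    using f_edge_radicand_ge[OF assms] unfolding \<rho>_def exp_minus_four
    by (rule order_trans[rotated]) simp
  then have q2: "q\<^sup>2 = 1 + (\<rho>\<^sup>2 - 1) * (1 - 2 * s)\<^sup>2" by (simp add: q_def)
  have "r = (\<rho> * (1 - 2 * s) + q) / (2 * (1 - s))"
    by (simp only: r_def f_edge_def q_def \<rho>_def exp_minus_four)
  then have "2 * (1 - s) * r = \<rho> * (1 - 2 * s) + q" using assms by (simp add: field_simps)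
  then have "q = 2 * (1 - s) * r - \<rho> * (1 - 2 * s)" by simp
  with q2 have "(2 * (1 - s) * r - \<rho> * (1 - 2 * s))\<^sup>2 = 1 + (\<rho>\<^sup>2 - 1) * (1 - 2 * s)\<^sup>2" by simp
  then have "4 * (1 - s) * (r * (\<rho> * s + (1 - s) * r)) = 4 * (1 - s) * (s + \<rho> * (1 - s) * r)"
    by (simp add: algebra_simps power2_eq_square)
  then show ?thesis using assms unfolding r_def \<rho>_def by simp
qed

lemma f_edge_0: "f_edge \<beta> 0 = exp (- 2 * \<beta>)"
proof -
  have "sqrt (exp (- 4 * \<beta>)) = exp (- 2 * \<beta>)" unfolding exp_minus_four by simp
  then show ?thesis by (simp add: f_edge_def)
qed

lemma abs_ln_diff_le:
  fixes x y m :: real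
  assumes "m > 0" "x \<ge> m" "y \<ge> m"
  shows "\<bar>ln x - ln y\<bar> \<le> \<bar>x - y\<bar> / m"
proof -
  have "ln x - ln y \<le> \<bar>x - y\<bar> / m" if "x \<ge> m" "y \<ge> m" for x y
  proof -
    have "ln x - ln y \<le> (x - y) / y" using that assms(1) by (intro ln_diff_le) auto
    also have "\<dots> \<le> \<bar>x - y\<bar> / m" using that assms(1) by (intro frac_le) auto
    finally show ?thesis .
  qed
  from this[of x y] this[of y x] assms show ?thesis by (simp add: abs_if split: if_splits)
qed

lemma abs_sqrt_diff_le:
  fixes x y m :: real
  assumes "m > 0" "x \<ge> m\<^sup>2" "y \<ge> m\<^sup>2"
  shows "\<bar>sqrt x - sqrt y\<bar> \<le> \<bar>x - y\<bar> / m"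
proof -
  have s: "sqrt x \<ge> m" "sqrt y \<ge> m" using assms by (simp_all add: real_le_rsqrt)
  have nn: "x \<ge> 0" "y \<ge> 0" using assms(2,3) zero_le_power2[of m] by linarith+
  have "m * \<bar>sqrt x - sqrt y\<bar> \<le> (sqrt x + sqrt y) * \<bar>sqrt x - sqrt y\<bar>"
    using s assms(1) by (intro mult_right_mono) auto
  also have "\<dots> = \<bar>(sqrt x + sqrt y) * (sqrt x - sqrt y)\<bar>"
    using s assms(1) by (simp add: abs_mult)
  also have "(sqrt x + sqrt y) * (sqrt x - sqrt y) = x - y"
    using nn by (simp add: algebra_simps)
  finally show ?thesis using assms(1) by (simp add: field_simps)
qed

text \<open>
  On \<open>[0, 1/2]\<close> the radicand is at least \<open>exp (-4 \<beta>)\<close> and the numerator at least \<open>exp (-2 \<beta>)\<close>, so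
  neither the root nor the logarithm comes near its singularity. The lemma controls both the drift of
  the fixed points and the error of the Riemann sums.
\<close>

lemma ln_f_edge_Lipschitz:
  assumes "\<beta> \<ge> 0"
  obtains L where "L \<ge> 0" "\<And>s t. \<lbrakk>0 \<le> s; s \<le> 1/2; 0 \<le> t; t \<le> 1/2\<rbrakk> \<Longrightarrow>
    \<bar>ln (f_edge \<beta> s) - ln (f_edge \<beta> t)\<bar> \<le> L * \<bar>s - t\<bar>"
proof -
  define \<rho> where "\<rho> = exp (-2 * \<beta>)"
  have \<rho>: "\<rho> > 0" "\<rho> \<le> 1" using assms by (auto simp: \<rho>_def)
  define Q where "Q s = 1 + (\<rho>\<^sup>2 - 1) * (1 - 2 * s)\<^sup>2" for s :: real
  define N where "N s = \<rho> * (1 - 2 * s) + sqrt (Q s)" for s :: real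
  define L where "L = (2 * \<rho> + 4 / \<rho>) / \<rho> + 2"
  have f: "f_edge \<beta> s = N s / (2 * (1 - s))" for s
    by (simp only: f_edge_def N_def Q_def \<rho>_def exp_minus_four)
  have Q: "Q s \<ge> \<rho>\<^sup>2" and N: "N s \<ge> \<rho>" if "0 \<le> s" "s \<le> 1/2" for s
    using f_edge_radicand_ge[OF assms that] f_edge_numerator_ge[OF assms that]
    unfolding Q_def N_def \<rho>_def exp_minus_four by auto
  have "\<bar>ln (f_edge \<beta> s) - ln (f_edge \<beta> t)\<bar> \<le> L * \<bar>s - t\<bar>"
    if st: "0 \<le> s" "s \<le> 1/2" "0 \<le> t" "t \<le> 1/2" for s t
  proof -
    have "Q s - Q t = (\<rho>\<^sup>2 - 1) * ((2 - 2 * s - 2 * t) * (2 * (t - s)))"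
      by (simp add: Q_def algebra_simps power2_eq_square)
    then have "\<bar>Q s - Q t\<bar> = \<bar>\<rho>\<^sup>2 - 1\<bar> * (\<bar>2 - 2 * s - 2 * t\<bar> * \<bar>2 * (t - s)\<bar>)"
      by (simp only: abs_mult)
    also have "\<dots> \<le> 1 * (2 * \<bar>2 * (t - s)\<bar>)"
    proof (intro mult_mono)
      show "\<bar>\<rho>\<^sup>2 - 1\<bar> \<le> 1" using \<rho> by (simp add: abs_le_iff power_le_one)
    qed (use st in auto)
    finally have "\<bar>Q s - Q t\<bar> \<le> 4 * \<bar>s - t\<bar>" unfolding abs_mult by (simp add: abs_minus_commute)
    then have "\<bar>Q s - Q t\<bar> / \<rho> \<le> 4 * \<bar>s - t\<bar> / \<rho>" using \<rho> by (intro divide_right_mono) auto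
    with abs_sqrt_diff_le[OF \<rho>(1) Q[OF st(1,2)] Q[OF st(3,4)]]
    have sq: "\<bar>sqrt (Q s) - sqrt (Q t)\<bar> \<le> 4 / \<rho> * \<bar>s - t\<bar>" by simp
    have "N s - N t = 2 * \<rho> * (t - s) + (sqrt (Q s) - sqrt (Q t))"
      by (simp add: N_def algebra_simps)
    also have "\<bar>\<dots>\<bar> \<le> 2 * \<rho> * \<bar>s - t\<bar> + 4 / \<rho> * \<bar>s - t\<bar>"
      by (rule order_trans[OF abs_triangle_ineq])
        (use sq \<rho> in \<open>simp add: abs_mult abs_minus_commute\<close>)
    finally have "\<bar>N s - N t\<bar> \<le> (2 * \<rho> + 4 / \<rho>) * \<bar>s - t\<bar>" by (simp add: algebra_simps)
    then have "\<bar>N s - N t\<bar> / \<rho> \<le> (2 * \<rho> + 4 / \<rho>) * \<bar>s - t\<bar> / \<rho>"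
      using \<rho> by (intro divide_right_mono) auto
    with abs_ln_diff_le[OF \<rho>(1) N[OF st(1,2)] N[OF st(3,4)]]
    have lnN: "\<bar>ln (N s) - ln (N t)\<bar> \<le> (2 * \<rho> + 4 / \<rho>) / \<rho> * \<bar>s - t\<bar>" by simp
    have ln1: "\<bar>ln (2 * (1 - s)) - ln (2 * (1 - t))\<bar> \<le> 2 * \<bar>s - t\<bar>"
      using abs_ln_diff_le[of 1 "2 * (1 - s)" "2 * (1 - t)"] st by (simp add: abs_if split: if_splits)
    have lnf: "ln (f_edge \<beta> u) = ln (N u) - ln (2 * (1 - u))" if "0 \<le> u" "u \<le> 1/2" for u
      unfolding f using N[OF that] \<rho>(1) that by (subst ln_div) auto
    have "\<bar>ln (f_edge \<beta> s) - ln (f_edge \<beta> t)\<bar>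
        \<le> \<bar>ln (N s) - ln (N t)\<bar> + \<bar>ln (2 * (1 - s)) - ln (2 * (1 - t))\<bar>"
      unfolding lnf[OF st(1,2)] lnf[OF st(3,4)] by linarith
    then show ?thesis using lnN ln1 unfolding L_def by (simp add: distrib_right)
  qed
  moreover have "L \<ge> 0" using \<rho> by (simp add: L_def)
  ultimately show ?thesis using that by blast
qed

section \<open>Asymptotics of the crossing polynomial\<close>

text \<open>
  The derivative in the logarithmic variable is
  \<open>- (1 - \<rho>\<^sup>2) A B e\<^sup>x / ((A + \<rho> B e\<^sup>x) (\<rho> A + B e\<^sup>x))\<close>, and the denominator exceeds
  \<open>(1 + \<rho>)\<^sup>2 A B e\<^sup>x\<close> by \<open>\<rho> (A - B e\<^sup>x)\<^sup>2\<close>.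
\<close>

lemma ratio_map_contraction:
  fixes A B \<rho> y z :: real
  assumes "A > 0" "B > 0" "0 < \<rho>" "\<rho> \<le> 1"
  shows "\<bar>ln ((A + \<rho> * B * exp y) / (\<rho> * A + B * exp y))
      - ln ((A + \<rho> * B * exp z) / (\<rho> * A + B * exp z))\<bar> \<le> (1 - \<rho>) / (1 + \<rho>) * \<bar>y - z\<bar>"
proof -
  let ?g = "\<lambda>x. ln ((A + \<rho> * B * exp x) / (\<rho> * A + B * exp x))"
  define g' where "g' x = - ((1 - \<rho>\<^sup>2) * (A * (B * exp x)) / ((A + \<rho> * B * exp x) * (\<rho> * A + B * exp x)))"
    for x
  have pos: "A + \<rho> * B * exp x > 0" "\<rho> * A + B * exp x > 0" for x
    using assms by (auto intro!: add_pos_pos mult_pos_pos)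
  have der: "(?g has_field_derivative g' x) (at x within UNIV)" for x
  proof -
    have "((\<lambda>x. ln (A + \<rho> * B * exp x) - ln (\<rho> * A + B * exp x)) has_field_derivative
       (\<rho> * B * exp x) / (A + \<rho> * B * exp x) - B * exp x / (\<rho> * A + B * exp x)) (at x within UNIV)"
      using pos[of x] by (auto intro!: derivative_eq_intros simp: mult.commute)
    also have "(\<lambda>x. ln (A + \<rho> * B * exp x) - ln (\<rho> * A + B * exp x)) = ?g"
    proof
      fix x
      show "ln (A + \<rho> * B * exp x) - ln (\<rho> * A + B * exp x) = ?g x"
        using pos[of x] by (simp add: ln_div)
    qed
    also have "(\<rho> * B * exp x) / (A + \<rho> * B * exp x) - B * exp x / (\<rho> * A + B * exp x) = g' x"
    proof -
      have nz: "A + \<rho> * B * exp x \<noteq> 0" "\<rho> * A + B * exp x \<noteq> 0"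
        using pos[of x] by auto
      show ?thesis unfolding g'_def diff_frac_eq[OF nz] minus_divide_left
        by (rule arg_cong2[where f = "(/)"]) (simp_all add: algebra_simps power2_eq_square)
    qed
    finally show ?thesis .
  qed
  have bnd: "norm (g' x) \<le> (1 - \<rho>) / (1 + \<rho>)" for x
  proof -
    define E where "E = B * exp x"
    have E: "E > 0" using assms by (simp add: E_def)
    have "(1 + \<rho>)\<^sup>2 * (A * E) \<le> (A + \<rho> * E) * (\<rho> * A + E)"
    proof -
      have "(A + \<rho> * E) * (\<rho> * A + E) - (1 + \<rho>)\<^sup>2 * (A * E) = \<rho> * (A - E)\<^sup>2"
        by (simp add: algebra_simps power2_eq_square)
      also have "\<dots> \<ge> 0" using assms by simp
      finally show ?thesis by simp
    qed
    then have "(1 - \<rho>\<^sup>2) * (A * E) / ((A + \<rho> * E) * (\<rho> * A + E))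
       \<le> (1 - \<rho>\<^sup>2) * (A * E) / ((1 + \<rho>)\<^sup>2 * (A * E))"
      using assms E by (intro divide_left_mono) (auto simp: power_le_one intro!: mult_pos_pos add_pos_pos)
    also have "\<dots> = (1 - \<rho>) / (1 + \<rho>)"
    proof -
      have "1 - \<rho>\<^sup>2 = (1 - \<rho>) * (1 + \<rho>)" by (simp add: algebra_simps power2_eq_square)
      then show ?thesis using assms E by (simp add: power2_eq_square divide_simps)
    qed
    finally have "(1 - \<rho>\<^sup>2) * (A * E) / ((A + \<rho> * E) * (\<rho> * A + E)) \<le> (1 - \<rho>) / (1 + \<rho>)" .
    moreover have "(1 - \<rho>\<^sup>2) * (A * E) / ((A + \<rho> * E) * (\<rho> * A + E)) \<ge> 0"
      using assms E by (intro divide_nonneg_nonneg) (auto simp: power_le_one)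
    ultimately show ?thesis
      unfolding g'_def E_def real_norm_def abs_minus_cancel mult.assoc by (simp only: abs_of_nonneg)
  qed
  have "norm (?g y - ?g z) \<le> (1 - \<rho>) / (1 + \<rho>) * norm (y - z)"
    by (rule field_differentiable_bound[OF convex_UNIV der bnd]) auto
  then show ?thesis by simp
qed

text \<open>
  The second argument is the difference \<open>d\<close> of the two sides: the recursions connect the ratios with
  the same \<open>d\<close>.
\<close>

definition crossing_ratio :: "real \<Rightarrow> nat \<Rightarrow> nat \<Rightarrow> real" where
  "crossing_ratio \<rho> j d = crossing_poly \<rho> (Suc j) (j + d - 1) / crossing_poly \<rho> j (j + d)"

lemma crossing_ratio_pos:
  assumes "\<rho> > 0" "even d" "d \<ge> 2"
  shows "crossing_ratio \<rho> j d > 0"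
  unfolding crossing_ratio_def using assms
  by (intro divide_pos_pos crossing_poly_pos) auto

lemma crossing_ratio_0:
  assumes "\<rho> > 0" "even d" "d \<ge> 2"
  shows "crossing_ratio \<rho> 0 d = \<rho>"
proof -
  obtain c where c: "d = Suc (Suc c)" using assms by (metis One_nat_def Suc_1 Suc_le_D Suc_le_mono)
  have "crossing_poly \<rho> 0 c > 0" using assms c by (intro crossing_poly_pos) auto
  then show ?thesis by (simp add: crossing_ratio_def c)
qed

lemma crossing_ratio_Suc:
  assumes "\<rho> > 0" "even d" "d \<ge> 2"
  shows "crossing_ratio \<rho> (Suc j) d =
    (real (Suc j) + \<rho> * real (j + d) * crossing_ratio \<rho> j d)
      / (\<rho> * real (Suc j) + real (j + d) * crossing_ratio \<rho> j d)"
proof -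
  let ?u = "crossing_poly \<rho> j (j + d)" and ?v = "crossing_poly \<rho> (Suc j) (j + d - 1)"
  have u: "?u > 0" using assms by (intro crossing_poly_pos) auto
  then have v: "?v = crossing_ratio \<rho> j d * ?u" by (simp add: crossing_ratio_def)
  have "crossing_poly \<rho> (Suc j) (Suc (j + d)) = real (j + d) * ?v + \<rho> * real (Suc j) * ?u"
    unfolding crossing_poly_Suc_right by simp
  also have "\<dots> = (\<rho> * real (Suc j) + real (j + d) * crossing_ratio \<rho> j d) * ?u"
    unfolding v by (simp add: algebra_simps)
  finally have den: "crossing_poly \<rho> (Suc j) (Suc j + d)
    = (\<rho> * real (Suc j) + real (j + d) * crossing_ratio \<rho> j d) * ?u" by simp
  have "crossing_poly \<rho> (Suc (Suc j)) (j + d) = real (Suc j) * ?u + \<rho> * real (j + d) * ?v"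
    unfolding crossing_poly.simps(3)[of \<rho> "Suc j"] by simp
  also have "\<dots> = (real (Suc j) + \<rho> * real (j + d) * crossing_ratio \<rho> j d) * ?u"
    unfolding v by (simp add: algebra_simps)
  finally have num: "crossing_poly \<rho> (Suc (Suc j)) (Suc j + d - 1)
    = (real (Suc j) + \<rho> * real (j + d) * crossing_ratio \<rho> j d) * ?u" by simp
  show ?thesis unfolding crossing_ratio_def[of \<rho> "Suc j"] num den using u by simp
qed

text \<open>
  At \<open>j = 0\<close> the ratio equals its fixed point. Each further step contracts the distance to the fixed
  point by \<open>\<theta> < 1\<close> and moves the argument of \<open>f_edge\<close> by at most \<open>1 / (j + 1)\<close>. The bound that survives the
  induction is \<open>C / (j + K)\<close>: for large \<open>K\<close> the passage from \<open>j + K\<close> to \<open>j + 1 + K\<close> costs less than the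
  contraction gains.
\<close>

lemma crossing_ratio_asymp:
  assumes "\<beta> \<ge> 0"
  obtains C where "C \<ge> 0" "\<And>j d. even d \<Longrightarrow> d \<ge> 2 \<Longrightarrow>
    \<bar>ln (crossing_ratio (exp (-2 * \<beta>)) j d) - ln (f_edge \<beta> (real j / (real (2 * j + d) - 1)))\<bar>
      \<le> C / real (j + 1)"
proof -
  define \<rho> where "\<rho> = exp (-2 * \<beta>)"
  have \<rho>: "\<rho> > 0" "\<rho> \<le> 1" using assms by (auto simp: \<rho>_def)
  define \<theta> where "\<theta> = (1 - \<rho>) / (1 + \<rho>)"
  have \<theta>: "0 \<le> \<theta>" "\<theta> < 1" using \<rho> by (auto simp: \<theta>_def)
  obtain L where L: "L \<ge> 0" "\<And>s t. \<lbrakk>0 \<le> s; s \<le> 1/2; 0 \<le> t; t \<le> 1/2\<rbrakk> \<Longrightarrow>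
    \<bar>ln (f_edge \<beta> s) - ln (f_edge \<beta> t)\<bar> \<le> L * \<bar>s - t\<bar>"
    using ln_f_edge_Lipschitz[OF assms] by blast
  define \<eta> where "\<eta> = (1 + \<theta>) / 2"
  have \<eta>: "0 < \<eta>" "\<eta> < 1" using \<theta> by (auto simp: \<eta>_def)
  \<comment> \<open>This \<open>K\<close> satisfies \<open>\<theta> (K + 1) \<le> \<eta> K\<close>, as \<open>(\<eta> - \<theta>) K = 1 \<ge> \<theta>\<close>.\<close>
  define K where "K = 2 / (1 - \<theta>)"
  have K: "K \<ge> 1" using \<theta> by (simp add: K_def)
  have K\<theta>: "\<theta> * (K + 1) \<le> \<eta> * K"
  proof -
    have "(\<eta> - \<theta>) * K = 1" using \<theta> by (simp add: \<eta>_def K_def field_simps)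
    then show ?thesis using \<theta> by (simp add: algebra_simps)
  qed
  \<comment> \<open>The fixed point of \<open>C \<mapsto> \<eta> (C + L K)\<close>, the recursion of the error bound.\<close>
  define C where "C = \<eta> * (L * K) / (1 - \<eta>)"
  have C: "C \<ge> 0" using \<eta> L K by (simp add: C_def)
  have C': "\<eta> * (C + L * K) = C" using \<eta> by (simp add: C_def field_simps)
  define s where "s j d = real j / (real (2 * j + d) - 1)" for j d :: nat
  have s: "0 \<le> s j d" "s j d \<le> 1/2" if "d \<ge> 2" for j d
    using that by (auto simp: s_def field_simps)
  have main: "\<bar>ln (crossing_ratio \<rho> j d) - ln (f_edge \<beta> (s j d))\<bar> \<le> C / (real j + K)"
    if d: "even d" "d \<ge> 2" for j d
  proof (induction j)
    case 0
    have "s 0 d = 0" by (simp add: s_def)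
    then show ?case using crossing_ratio_0[OF \<rho>(1) d] f_edge_0[of \<beta>] C K by (simp add: \<rho>_def)
  next
    case (Suc j)
    let ?\<psi> = "\<lambda>y. ln ((real (Suc j) + \<rho> * real (j + d) * exp y)
      / (\<rho> * real (Suc j) + real (j + d) * exp y))"
    define r where "r = f_edge \<beta> (s (Suc j) d)"
    have r: "r > 0" unfolding r_def using f_edge_pos[OF assms s[OF d(2)]] .
    have ratio: "ln (crossing_ratio \<rho> (Suc j) d) = ?\<psi> (ln (crossing_ratio \<rho> j d))"
      using crossing_ratio_pos[OF \<rho>(1) d, of j] unfolding crossing_ratio_Suc[OF \<rho>(1) d] by simp
    \<comment> \<open>The fixed point equation at \<open>s\<close>, multiplied by \<open>T\<close>: \<open>s T = j + 1\<close> and \<open>(1 - s) T = j + d\<close>.\<close>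
    have fix_r: "ln r = ?\<psi> (ln r)"
    proof -
      define T where "T = real (2 * Suc j + d) - 1"
      have T: "T > 0" using d by (simp add: T_def)
      have sT: "s (Suc j) d * T = real (Suc j)" using T by (simp add: s_def T_def)
      have s1T: "(1 - s (Suc j) d) * T = real (j + d)"
        using sT by (simp add: T_def left_diff_distrib)
      have "r * (\<rho> * s (Suc j) d + (1 - s (Suc j) d) * r)
          = s (Suc j) d + \<rho> * (1 - s (Suc j) d) * r"
        unfolding r_def \<rho>_def by (rule f_edge_fixed_point[OF assms s[OF d(2)]])
      then have "r * (\<rho> * s (Suc j) d + (1 - s (Suc j) d) * r) * T
          = (s (Suc j) d + \<rho> * (1 - s (Suc j) d) * r) * T" by simp
      then have "r * (\<rho> * (s (Suc j) d * T) + ((1 - s (Suc j) d) * T) * r)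
          = s (Suc j) d * T + \<rho> * ((1 - s (Suc j) d) * T) * r"
        by (simp only: algebra_simps)
      then have "r * (\<rho> * real (Suc j) + real (j + d) * r) = real (Suc j) + \<rho> * real (j + d) * r"
        unfolding sT s1T .
      moreover have "\<rho> * real (Suc j) + real (j + d) * r > 0"
        using \<rho> r by (intro add_pos_nonneg mult_pos_pos) auto
      ultimately have "r = (real (Suc j) + \<rho> * real (j + d) * r) / (\<rho> * real (Suc j) + real (j + d) * r)"
        by (simp add: field_simps)
      then show ?thesis using r by simp
    qed
    have ds: "\<bar>s j d - s (Suc j) d\<bar> \<le> 1 / real (j + 1)"
    proof -
      have "s j d - s (Suc j) d = - ((real d - 1) / ((real (2 * j + d) - 1) * (real (2 * Suc j + d) - 1)))"
      proof -
        have nz: "real (2 * j + d) - 1 \<noteq> 0" "real (2 * Suc j + d) - 1 \<noteq> 0" using d by auto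
        show ?thesis unfolding s_def diff_frac_eq[OF nz] minus_divide_left
          by (rule arg_cong2[where f = "(/)"]) (simp_all add: algebra_simps)
      qed
      then have "\<bar>s j d - s (Suc j) d\<bar> = (real d - 1) / (real (2 * j + d) - 1) * (1 / (real (2 * Suc j + d) - 1))"
        using d by simp
      also have "\<dots> \<le> 1 * (1 / real (j + 1))"
        using d by (intro mult_mono divide_left_mono) auto
      finally show ?thesis by simp
    qed
    have "\<bar>ln (crossing_ratio \<rho> (Suc j) d) - ln r\<bar> = \<bar>?\<psi> (ln (crossing_ratio \<rho> j d)) - ?\<psi> (ln r)\<bar>"
      using ratio fix_r by simp
    also have "\<dots> \<le> \<theta> * \<bar>ln (crossing_ratio \<rho> j d) - ln r\<bar>"
      unfolding \<theta>_def by (rule ratio_map_contraction) (use \<rho> d in auto)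
    also have "\<dots> \<le> \<theta> * (C / (real j + K) + L * (1 / real (j + 1)))"
    proof (rule mult_left_mono[OF _ \<theta>(1)])
      have "\<bar>ln (f_edge \<beta> (s j d)) - ln r\<bar> \<le> L * \<bar>s j d - s (Suc j) d\<bar>"
        unfolding r_def using s[OF d(2)] by (intro L(2)) auto
      also have "\<dots> \<le> L * (1 / real (j + 1))" using ds L(1) by (rule mult_left_mono)
      finally show "\<bar>ln (crossing_ratio \<rho> j d) - ln r\<bar> \<le> C / (real j + K) + L * (1 / real (j + 1))"
        using Suc.IH by linarith
    qed
    also have "\<dots> \<le> \<theta> * ((C + L * K) / (real j + K))"
    proof (rule mult_left_mono[OF _ \<theta>(1)])
      have "real j + K \<le> K * real (j + 1)" using K mult_right_mono[OF K, of "real j"]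
        by (simp add: algebra_simps)
      then have "1 / real (j + 1) \<le> K / (real j + K)" using K by (simp add: field_simps)
      then have "L * (1 / real (j + 1)) \<le> L * (K / (real j + K))" using L(1) by (rule mult_left_mono)
      then show "C / (real j + K) + L * (1 / real (j + 1)) \<le> (C + L * K) / (real j + K)"
        by (simp add: add_divide_distrib)
    qed
    also have "\<dots> \<le> C / (real (Suc j) + K)"
    proof -
      have "\<theta> * (real j + 1 + K) \<le> \<eta> * (real j + K)"
      proof -
        have "\<theta> * real j \<le> \<eta> * real j" using \<theta> by (intro mult_right_mono) (auto simp: \<eta>_def)
        then show ?thesis using K\<theta> by (simp add: algebra_simps)
      qed
      then have "\<theta> * (real j + 1 + K) * (C + L * K) \<le> \<eta> * (real j + K) * (C + L * K)"
        using C L(1) K by (intro mult_right_mono) auto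
      also have "\<dots> = \<eta> * (C + L * K) * (real j + K)" by simp
      also have "\<dots> = C * (real j + K)" unfolding C' ..
      finally show ?thesis using K by (simp add: divide_simps) (simp add: algebra_simps)
    qed
    finally show ?case by (simp add: r_def)
  qed
  have "C / (real j + K) \<le> C / real (j + 1)" for j
    using C K by (intro divide_left_mono) auto
  then have "\<bar>ln (crossing_ratio \<rho> j d) - ln (f_edge \<beta> (s j d))\<bar> \<le> C / real (j + 1)"
    if "even d" "d \<ge> 2" for j d
    using main[OF that, of j] order_trans by blast
  then show ?thesis using that C unfolding s_def \<rho>_def by blast
qed

lemma crossing_poly_0_eq_one: "crossing_poly \<rho> 0 c = crossing_poly 1 0 c"
  by (induction c rule: less_induct) (case_tac x, auto)

lemma ln_matching_poly_eq_sum_ratio: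
  assumes "\<rho> > 0" "even m" "2 * a \<le> m"
  shows "ln (crossing_poly \<rho> a (m - a) / crossing_poly 1 a (m - a))
    = (\<Sum>j<a. ln (crossing_ratio \<rho> j (m - 2 * j)))"
proof -
  have "ln (crossing_poly \<rho> a (m - a)) = ln (crossing_poly \<rho> 0 m) + (\<Sum>j<a. ln (crossing_ratio \<rho> j (m - 2 * j)))"
    using assms(3)
  proof (induction a)
    case (Suc a)
    have e: "a + (m - 2 * a) = m - a" "m - a - 1 = m - Suc a" using Suc.prems by auto
    have pos: "crossing_poly \<rho> a (m - a) > 0" "crossing_poly \<rho> (Suc a) (m - Suc a) > 0"
      using assms Suc.prems by (auto intro!: crossing_poly_pos simp del: crossing_poly.simps)
    have "ln (crossing_ratio \<rho> a (m - 2 * a)) = ln (crossing_poly \<rho> (Suc a) (m - Suc a)) - ln (crossing_poly \<rho> a (m - a))"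
      unfolding crossing_ratio_def e using pos by (simp add: ln_div)
    then show ?case using Suc by simp
  qed simp
  moreover have "crossing_poly \<rho> 0 m = crossing_poly 1 a (m - a)"
    using crossing_poly_one[of a "m - a"] crossing_poly_0_eq_one[of \<rho> m] assms(3) by simp
  moreover have "crossing_poly \<rho> a (m - a) > 0" "crossing_poly 1 a (m - a) > 0"
    using assms by (auto intro!: crossing_poly_pos)
  ultimately show ?thesis by (simp add: ln_div)
qed

lemma integral_ln_f_edge_combine:
  assumes "\<beta> \<ge> 0" "0 \<le> x" "x \<le> y" "y \<le> 1/2"
  shows "integral {0..y} (\<lambda>s. ln (f_edge \<beta> s)) - integral {0..x} (\<lambda>s. ln (f_edge \<beta> s))
      = integral {x..y} (\<lambda>s. ln (f_edge \<beta> s))"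
    and "(\<lambda>s. ln (f_edge \<beta> s)) integrable_on {x..y}"
proof -
  obtain L where L: "L \<ge> 0" "\<And>s t. \<lbrakk>0 \<le> s; s \<le> 1/2; 0 \<le> t; t \<le> 1/2\<rbrakk> \<Longrightarrow>
    \<bar>ln (f_edge \<beta> s) - ln (f_edge \<beta> t)\<bar> \<le> L * \<bar>s - t\<bar>"
    using ln_f_edge_Lipschitz[OF assms(1)] by blast
  have "L-lipschitz_on {0..1/2} (\<lambda>s. ln (f_edge \<beta> s))"
    by (rule lipschitz_onI) (use L in \<open>auto simp: dist_real_def\<close>)
  then have cont: "continuous_on {0..1/2} (\<lambda>s. ln (f_edge \<beta> s))"
    by (rule lipschitz_on_continuous_on)
  have int: "(\<lambda>s. ln (f_edge \<beta> s)) integrable_on {u..v}" if "0 \<le> u" "v \<le> 1/2" for u v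
    using that by (intro integrable_continuous_real continuous_on_subset[OF cont]) auto
  show "(\<lambda>s. ln (f_edge \<beta> s)) integrable_on {x..y}" using int assms by auto
  show "integral {0..y} (\<lambda>s. ln (f_edge \<beta> s)) - integral {0..x} (\<lambda>s. ln (f_edge \<beta> s))
      = integral {x..y} (\<lambda>s. ln (f_edge \<beta> s))"
    using Henstock_Kurzweil_Integration.integral_combine[OF assms(2,3) int[of 0 y]] assms by simp
qed

lemma integral_near_const:
  fixes g :: "real \<Rightarrow> real"
  assumes "x \<le> y" "g integrable_on {x..y}" "\<And>s. s \<in> {x..y} \<Longrightarrow> \<bar>g s - v\<bar> \<le> e"
  shows "\<bar>integral {x..y} g - v * (y - x)\<bar> \<le> e * (y - x)"
proof -
  have "integral {x..y} (\<lambda>s. g s - v) = integral {x..y} g - v * (y - x)"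
    using assms(1) Henstock_Kurzweil_Integration.integral_diff[OF assms(2) integrable_const_ivl[of v x y]]
    by (simp add: mult.commute)
  moreover have "norm (integral {x..y} (\<lambda>s. g s - v)) \<le> integral {x..y} (\<lambda>s. e)"
    using assms by (intro integral_norm_bound_integral integrable_diff) auto
  ultimately show ?thesis using assms(1) by (simp add: mult.commute)
qed

lemma F_edge_Lipschitz:
  assumes "\<beta> \<ge> 0"
  obtains L where "L \<ge> 0" "\<And>s t. \<lbrakk>0 \<le> s; s \<le> 1; 0 \<le> t; t \<le> 1\<rbrakk> \<Longrightarrow>
    \<bar>F_edge \<beta> s - F_edge \<beta> t\<bar> \<le> L * \<bar>s - t\<bar>"
proof -
  obtain L where L: "L \<ge> 0" "\<And>s t. \<lbrakk>0 \<le> s; s \<le> 1/2; 0 \<le> t; t \<le> 1/2\<rbrakk> \<Longrightarrow>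
    \<bar>ln (f_edge \<beta> s) - ln (f_edge \<beta> t)\<bar> \<le> L * \<bar>s - t\<bar>"
    using ln_f_edge_Lipschitz[OF assms(1)] by blast
  define M where "M = 2 * \<beta> + L"
  have M: "M \<ge> 0" using L assms by (simp add: M_def)
  have bnd: "\<bar>ln (f_edge \<beta> s) - 0\<bar> \<le> M" if "0 \<le> s" "s \<le> 1/2" for s
  proof -
    have "\<bar>ln (f_edge \<beta> s) - ln (f_edge \<beta> 0)\<bar> \<le> L * \<bar>s - 0\<bar>" using that by (intro L(2)) auto
    also have "\<dots> \<le> L * 1" using that L(1) by (intro mult_left_mono) auto
    finally show ?thesis using assms unfolding f_edge_0 M_def by simp
  qed
  let ?I = "\<lambda>x. integral {0..x} (\<lambda>s. ln (f_edge \<beta> s))"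
  have I: "\<bar>?I y - ?I x\<bar> \<le> M * \<bar>y - x\<bar>" if "0 \<le> x" "x \<le> y" "y \<le> 1/2" for x y
    using integral_near_const[OF that(2) integral_ln_f_edge_combine(2)[OF assms that], of 0 M]
      bnd that unfolding integral_ln_f_edge_combine(1)[OF assms that] by simp
  have "\<bar>F_edge \<beta> s - F_edge \<beta> t\<bar> \<le> M * \<bar>s - t\<bar>"
    if st: "0 \<le> s" "s \<le> 1" "0 \<le> t" "t \<le> 1" for s t
  proof -
    define x where "x = min s (1 - s)"
    define y where "y = min t (1 - t)"
    have xy: "0 \<le> x" "x \<le> 1/2" "0 \<le> y" "y \<le> 1/2" "\<bar>x - y\<bar> \<le> \<bar>s - t\<bar>"
      using st by (auto simp: x_def y_def min_def)
    have "\<bar>?I x - ?I y\<bar> \<le> M * \<bar>x - y\<bar>"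
    proof (cases "x \<le> y")
      case True
      then show ?thesis using I[of x y] xy by (simp add: abs_minus_commute)
    next
      case False
      then show ?thesis using I[of y x] xy by simp
    qed
    also have "\<dots> \<le> M * \<bar>s - t\<bar>" using xy M by (intro mult_left_mono) auto
    finally show ?thesis by (simp add: F_edge_def x_def y_def)
  qed
  then show ?thesis using that M by blast
qed

definition pairing_exponent :: "real \<Rightarrow> real \<Rightarrow> real \<Rightarrow> real" where
  "pairing_exponent \<beta> a c = (a + c) * F_edge \<beta> (a / (a + c))"

lemma F_edge_0: "F_edge \<beta> 0 = 0"
  by (simp add: F_edge_def)

lemma F_edge_mirror: "F_edge \<beta> (1 - t) = F_edge \<beta> t"
  by (simp add: F_edge_def min.commute)

lemma pairing_exponent_commute:
  assumes "a \<ge> 0" "c \<ge> 0"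
  shows "pairing_exponent \<beta> a c = pairing_exponent \<beta> c a"
proof (cases "a + c = 0")
  case False
  then have "c / (c + a) = 1 - a / (a + c)" by (simp add: field_simps)
  then show ?thesis by (simp add: pairing_exponent_def F_edge_mirror add.commute)
qed (use assms in \<open>auto simp: pairing_exponent_def\<close>)

lemma pairing_exponent_scale:
  "n \<noteq> 0 \<Longrightarrow> pairing_exponent \<beta> (n * a) (n * c) = n * pairing_exponent \<beta> a c"
  by (simp add: pairing_exponent_def flip: distrib_left)

text \<open>
  The function is homogeneous of degree one, and \<open>F_edge \<beta>\<close> is bounded and Lipschitz. Moving \<open>a\<close> to
  \<open>a'\<close> moves \<open>a / (a + c)\<close> by at most \<open>\<bar>a' - a\<bar> / (a + c)\<close>, and the prefactor \<open>a + c\<close> cancels the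
  denominator.
\<close>

lemma pairing_exponent_Lipschitz:
  assumes "\<beta> \<ge> 0"
  obtains L where "L \<ge> 0" "\<And>a c a' c'. \<lbrakk>0 \<le> a; 0 \<le> c; 0 \<le> a'; 0 \<le> c'\<rbrakk> \<Longrightarrow>
    \<bar>pairing_exponent \<beta> a c - pairing_exponent \<beta> a' c'\<bar> \<le> L * (\<bar>a - a'\<bar> + \<bar>c - c'\<bar>)"
proof -
  obtain L where L: "L \<ge> 0" "\<And>s t. \<lbrakk>0 \<le> s; s \<le> 1; 0 \<le> t; t \<le> 1\<rbrakk> \<Longrightarrow>
    \<bar>F_edge \<beta> s - F_edge \<beta> t\<bar> \<le> L * \<bar>s - t\<bar>"
    using F_edge_Lipschitz[OF assms] by blast
  have F: "\<bar>F_edge \<beta> s\<bar> \<le> L" if "0 \<le> s" "s \<le> 1" for s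
  proof -
    have "L * \<bar>s\<bar> \<le> L * 1" using that L(1) by (intro mult_left_mono) auto
    then show ?thesis using L(2)[of s 0] that by (simp add: F_edge_0)
  qed
  have one: "\<bar>pairing_exponent \<beta> a' c - pairing_exponent \<beta> a c\<bar> \<le> 2 * L * \<bar>a' - a\<bar>"
    if a: "0 \<le> a" "0 \<le> c" "a \<le> a'" for a a' c
  proof (cases "a + c = 0")
    case True
    then have "a = 0" "c = 0" using a by auto
    have "\<bar>a' * F_edge \<beta> (a' / a')\<bar> \<le> a' * L"
      unfolding abs_mult using a F[of "a' / a'"] \<open>a = 0\<close>
      by (cases "a' = 0") (auto intro: mult_left_mono)
    also have "\<dots> \<le> 2 * L * a'" using L(1) a \<open>a = 0\<close> by simp
    finally show ?thesis using a \<open>a = 0\<close> \<open>c = 0\<close> by (simp add: pairing_exponent_def)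
  next
    case False
    then have p: "a + c > 0" "a' + c > 0" using a by auto
    let ?x = "a / (a + c)" and ?y = "a' / (a' + c)"
    have xy: "0 \<le> ?x" "?x \<le> 1" "0 \<le> ?y" "?y \<le> 1" using p a by auto
    have "(a + c) * \<bar>?y - ?x\<bar> = c / (a' + c) * \<bar>a' - a\<bar>"
    proof -
      have "?y - ?x = c * (a' - a) / ((a + c) * (a' + c))"
        using p by (simp add: diff_frac_eq) (simp add: algebra_simps)
      then show ?thesis using p a by (simp add: abs_mult)
    qed
    also have "\<dots> \<le> 1 * \<bar>a' - a\<bar>" using a p by (intro mult_right_mono) auto
    finally have "L * ((a + c) * \<bar>?y - ?x\<bar>) \<le> L * \<bar>a' - a\<bar>" using L(1) by (intro mult_left_mono) auto
    moreover have "(a + c) * \<bar>F_edge \<beta> ?y - F_edge \<beta> ?x\<bar> \<le> (a + c) * (L * \<bar>?y - ?x\<bar>)"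
      using p xy by (intro mult_left_mono L(2)) auto
    ultimately have "(a + c) * \<bar>F_edge \<beta> ?y - F_edge \<beta> ?x\<bar> \<le> L * \<bar>a' - a\<bar>"
      unfolding mult.left_commute[of "a + c" L] by linarith
    then have 1: "\<bar>(a + c) * (F_edge \<beta> ?y - F_edge \<beta> ?x)\<bar> \<le> L * \<bar>a' - a\<bar>"
      using p by (simp add: abs_mult)
    have 2: "\<bar>(a' - a) * F_edge \<beta> ?y\<bar> \<le> \<bar>a' - a\<bar> * L"
      unfolding abs_mult using F[OF xy(3,4)] by (intro mult_left_mono) auto
    have "pairing_exponent \<beta> a' c - pairing_exponent \<beta> a c
        = (a + c) * (F_edge \<beta> ?y - F_edge \<beta> ?x) + (a' - a) * F_edge \<beta> ?y"
      by (simp add: pairing_exponent_def algebra_simps)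
    also have "\<bar>\<dots>\<bar> \<le> L * \<bar>a' - a\<bar> + \<bar>a' - a\<bar> * L"
      by (rule order_trans[OF abs_triangle_ineq add_mono[OF 1 2]])
    also have "\<dots> = 2 * L * \<bar>a' - a\<bar>" by simp
    finally show ?thesis .
  qed
  have one': "\<bar>pairing_exponent \<beta> a' c - pairing_exponent \<beta> a c\<bar> \<le> 2 * L * \<bar>a' - a\<bar>"
    if "0 \<le> a" "0 \<le> c" "0 \<le> a'" for a a' c
    using one[of a c a'] one[of a' c a] that by (cases "a \<le> a'") (auto simp: abs_minus_commute)
  have "\<bar>pairing_exponent \<beta> a c - pairing_exponent \<beta> a' c'\<bar> \<le> 2 * L * (\<bar>a - a'\<bar> + \<bar>c - c'\<bar>)"
    if "0 \<le> a" "0 \<le> c" "0 \<le> a'" "0 \<le> c'" for a c a' c'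
  proof -
    have "\<bar>pairing_exponent \<beta> a c - pairing_exponent \<beta> a' c\<bar> \<le> 2 * L * \<bar>a - a'\<bar>"
      using one'[of a' c a] that by simp
    moreover have "\<bar>pairing_exponent \<beta> a' c - pairing_exponent \<beta> a' c'\<bar> \<le> 2 * L * \<bar>c - c'\<bar>"
      using one'[of c' a' c] that by (simp add: pairing_exponent_commute[of a'])
    ultimately show ?thesis by (simp add: distrib_left)
  qed
  then show ?thesis using that[of "2 * L"] L(1) by simp
qed

lemma sum_inverse_le_sqrt: "(\<Sum>j<a. 1 / real (j + 1)) \<le> 2 * sqrt (real a)"
proof (induction a)
  case (Suc a)
  have "1 / real (a + 1) \<le> 2 * (sqrt (real (a + 1)) - sqrt (real a))"
  proof -
    let ?p = "sqrt (real (a + 1))" and ?q = "sqrt (real a)"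
    have p: "?p \<ge> 1" "?q \<le> ?p" "?q \<ge> 0" by auto
    have "(?p - ?q) * (?p + ?q) = 1" by (simp add: algebra_simps)
    moreover have "(?p - ?q) * (?p + ?q) \<le> (?p - ?q) * (2 * ?p)" using p by (intro mult_left_mono) auto
    ultimately have "1 \<le> (?p - ?q) * (2 * ?p)" by linarith
    also have "\<dots> = 2 * (?p - ?q) * ?p" by simp
    also have "\<dots> \<le> 2 * (?p - ?q) * (?p * ?p)" using p mult_left_mono[of 1 ?p ?p] by (intro mult_left_mono) auto
    also have "?p * ?p = real (a + 1)" by simp
    finally show ?thesis by (simp add: divide_simps)
  qed
  then show ?case using Suc.IH by (simp add: add.commute)
qed simp

text \<open>
  For \<open>a \<le> c\<close> the logarithm telescopes into the logarithms of the ratios at \<open>(j, m - j)\<close> for \<open>j < a\<close>.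
  Each of them is \<open>ln (f_edge \<beta> (j / (m - 1)))\<close> up to \<open>C / (j + 1)\<close>, and this is \<open>m\<close> times the integral
  over \<open>[j / m, (j + 1) / m]\<close> up to \<open>L / m\<close>. The errors add up to \<open>O(log m)\<close>, of which only the
  cruder \<open>O(sqrt (m + 1))\<close> is kept. The other case follows from the symmetry of the two sides.
\<close>

lemma crossing_poly_asymp:
  assumes "\<beta> \<ge> 0"
  obtains C where "C \<ge> 0" "\<And>a c. even (a + c) \<Longrightarrow>
    \<bar>ln (crossing_poly (exp (-2 * \<beta>)) a c / crossing_poly 1 a c)
       - pairing_exponent \<beta> (real a) (real c)\<bar> \<le> C * sqrt (real (a + c) + 1)"
proof -
  define \<rho> where "\<rho> = exp (-2 * \<beta>)"
  have \<rho>: "\<rho> > 0" by (simp add: \<rho>_def)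
  obtain L where L: "L \<ge> 0" "\<And>s t. \<lbrakk>0 \<le> s; s \<le> 1/2; 0 \<le> t; t \<le> 1/2\<rbrakk> \<Longrightarrow>
    \<bar>ln (f_edge \<beta> s) - ln (f_edge \<beta> t)\<bar> \<le> L * \<bar>s - t\<bar>"
    using ln_f_edge_Lipschitz[OF assms(1)] by blast
  obtain C where C: "C \<ge> 0" "\<And>j d. even d \<Longrightarrow> d \<ge> 2 \<Longrightarrow>
    \<bar>ln (crossing_ratio \<rho> j d) - ln (f_edge \<beta> (real j / (real (2 * j + d) - 1)))\<bar> \<le> C / real (j + 1)"
    unfolding \<rho>_def using crossing_ratio_asymp[OF assms] by blast
  let ?I = "\<lambda>x. integral {0..x} (\<lambda>s. ln (f_edge \<beta> s))"
  have sums: "\<bar>(\<Sum>j<a. ln (crossing_ratio \<rho> j (m - 2 * j))) - real m * ?I (real a / real m)\<bar>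
      \<le> (\<Sum>j<a. C / real (j + 1) + L / real m)" if "even m" "2 * a \<le> m" for a m
    using that(2)
  proof (induction a)
    case (Suc a)
    have m: "2 \<le> m - 2 * a" "even (m - 2 * a)" "m > 1" using Suc.prems that(1) by auto
    let ?x = "real a / real m" and ?y = "real (Suc a) / real m" and ?s = "real a / (real m - 1)"
    have xy: "0 \<le> ?x" "?x \<le> ?y" "?y \<le> 1/2" using m Suc.prems by (auto simp: field_simps)
    have s: "0 \<le> ?s" "?s \<le> 1/2" using m Suc.prems by (auto simp: field_simps)
    have yx: "?y - ?x = 1 / real m" by (simp add: diff_divide_distrib[symmetric])
    have s_near: "\<bar>u - ?s\<bar> \<le> 1 / real m" if "u \<in> {?x..?y}" for u
    proof -
      have "?s - ?x = real a / (real m * (real m - 1))" using m by (simp add: field_simps)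
      also have "\<dots> \<le> 1 * (real m - 1) / (real m * (real m - 1))"
        using m Suc.prems by (intro divide_right_mono) auto
      also have "\<dots> = 1 / real m" using m by simp
      finally have "?s - ?x \<le> 1 / real m" .
      moreover have "?x \<le> ?s" using m by (intro divide_left_mono) auto
      ultimately show ?thesis using that yx by auto
    qed
    have "\<bar>integral {?x..?y} (\<lambda>s. ln (f_edge \<beta> s)) - ln (f_edge \<beta> ?s) * (?y - ?x)\<bar> \<le> L / real m * (?y - ?x)"
    proof (rule integral_near_const[OF xy(2) integral_ln_f_edge_combine(2)[OF assms xy]])
      fix u assume u: "u \<in> {?x..?y}"
      have "\<bar>ln (f_edge \<beta> u) - ln (f_edge \<beta> ?s)\<bar> \<le> L * \<bar>u - ?s\<bar>"
        using u order_trans[OF xy(1), of u] order_trans[of u ?y, OF _ xy(3)] s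
        by (intro L(2)) simp_all
      also have "\<dots> \<le> L * (1 / real m)" using s_near[OF u] L(1) by (rule mult_left_mono)
      finally show "\<bar>ln (f_edge \<beta> u) - ln (f_edge \<beta> ?s)\<bar> \<le> L / real m" by simp
    qed
    then have "\<bar>(?I ?y - ?I ?x) - ln (f_edge \<beta> ?s) / real m\<bar> \<le> L / real m / real m"
      unfolding integral_ln_f_edge_combine(1)[OF assms xy] yx by simp
    then have "real m * \<bar>(?I ?y - ?I ?x) - ln (f_edge \<beta> ?s) / real m\<bar> \<le> real m * (L / real m / real m)"
      by (intro mult_left_mono) auto
    also have "real m * \<bar>(?I ?y - ?I ?x) - ln (f_edge \<beta> ?s) / real m\<bar>
        = \<bar>real m * ((?I ?y - ?I ?x) - ln (f_edge \<beta> ?s) / real m)\<bar>" by (simp add: abs_mult)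
    also have "real m * ((?I ?y - ?I ?x) - ln (f_edge \<beta> ?s) / real m)
        = real m * ?I ?y - real m * ?I ?x - ln (f_edge \<beta> ?s)" using m by (simp add: algebra_simps)
    finally have "\<bar>real m * ?I ?y - real m * ?I ?x - ln (f_edge \<beta> ?s)\<bar> \<le> L / real m" using m by simp
    moreover have "\<bar>ln (crossing_ratio \<rho> a (m - 2 * a)) - ln (f_edge \<beta> ?s)\<bar> \<le> C / real (a + 1)"
      using C(2)[OF m(2,1), of a] Suc.prems by simp
    ultimately show ?case using Suc by simp
  qed simp
  define C' where "C' = 2 * C + L"
  have half: "\<bar>ln (crossing_poly \<rho> a c / crossing_poly 1 a c) - pairing_exponent \<beta> (real a) (real c)\<bar>
      \<le> C' * sqrt (real (a + c) + 1)" if "even (a + c)" "a \<le> c" for a c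
  proof -
    define m where "m = a + c"
    have m: "even m" "2 * a \<le> m" "c = m - a" using that by (auto simp: m_def)
    have x: "real a / real m \<le> 1 - real a / real m"
      using m by (cases "m = 0") (auto simp: field_simps)
    have "pairing_exponent \<beta> (real a) (real c) = real m * ?I (real a / real m)"
      using x by (simp add: pairing_exponent_def F_edge_def m_def min_def)
    then have "\<bar>ln (crossing_poly \<rho> a c / crossing_poly 1 a c) - pairing_exponent \<beta> (real a) (real c)\<bar>
        \<le> (\<Sum>j<a. C / real (j + 1) + L / real m)"
      using sums[OF m(1,2)] ln_matching_poly_eq_sum_ratio[OF \<rho> m(1,2)] m(3) by simp
    also have "\<dots> = C * (\<Sum>j<a. 1 / real (j + 1)) + real a * (L / real m)"
      by (simp add: sum.distrib sum_distrib_left)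
    also have "\<dots> \<le> C * (2 * sqrt (real a)) + L"
    proof (rule add_mono)
      show "C * (\<Sum>j<a. 1 / real (j + 1)) \<le> C * (2 * sqrt (real a))"
        using sum_inverse_le_sqrt C(1) by (rule mult_left_mono)
      have "real a / real m \<le> 1" using m by (cases "m = 0") auto
      then have "L * (real a / real m) \<le> L * 1" using L(1) by (intro mult_left_mono) auto
      then show "real a * (L / real m) \<le> L" by (simp add: mult.commute)
    qed
    also have "\<dots> \<le> C * (2 * sqrt (real (a + c) + 1)) + L * sqrt (real (a + c) + 1)"
      using C(1) L(1) mult_left_mono[of 1 "sqrt (real (a + c) + 1)" L]
      by (intro add_mono mult_left_mono) auto
    finally show ?thesis by (simp add: C'_def algebra_simps)
  qed
  have "\<bar>ln (crossing_poly \<rho> a c / crossing_poly 1 a c) - pairing_exponent \<beta> (real a) (real c)\<bar>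
      \<le> C' * sqrt (real (a + c) + 1)" if "even (a + c)" for a c
  proof (cases "a \<le> c")
    case False
    then show ?thesis using half[of c a] that
      by (simp add: crossing_poly_commute[of _ a c] pairing_exponent_commute[of "real a"] add.commute)
  qed (use half that in blast)
  moreover have "C' \<ge> 0" using C L by (simp add: C'_def)
  ultimately show ?thesis using that unfolding \<rho>_def by blast
qed

section \<open>The rate function and exponential tilting\<close>

definition mgf :: "nat pmf \<Rightarrow> real \<Rightarrow> real" where
  "mgf D s = measure_pmf.expectation D (\<lambda>k. exp (s * real k))"

lemma cumulant_eq: "cumulant D s = ln (mgf D s)"
  by (simp add: cumulant_def mgf_def)

locale exp_moments =
  fixes D :: "nat pmf"
  assumes integrable_exp: "integrable (measure_pmf D) (\<lambda>k. exp (s * real k))"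
begin

lemma integrable_tilted:
  fixes w :: "nat \<Rightarrow> real"
  assumes "\<And>k. \<bar>w k\<bar> \<le> c * exp (real k)"
  shows "integrable (measure_pmf D) (\<lambda>k. w k * exp (s * real k))"
proof (rule Bochner_Integration.integrable_bound)
  show "integrable (measure_pmf D) (\<lambda>k. c * exp ((s + 1) * real k))"
    using integrable_exp by simp
  show "AE k in measure_pmf D. norm (w k * exp (s * real k)) \<le> norm (c * exp ((s + 1) * real k))"
  proof (rule AE_I2)
    fix k
    have "\<bar>w k\<bar> * exp (s * real k) \<le> c * exp (real k) * exp (s * real k)"
      using assms by (intro mult_right_mono) auto
    also have "\<dots> = c * exp ((s + 1) * real k)" by (simp add: algebra_simps exp_add)
    also have "\<dots> \<le> norm (c * exp ((s + 1) * real k))" unfolding real_norm_def by (rule abs_ge_self)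
    finally show "norm (w k * exp (s * real k)) \<le> norm (c * exp ((s + 1) * real k))"
      by (simp add: abs_mult)
  qed
qed simp

text \<open>
  Dominated convergence. The weight \<open>w\<close> leaves room for the factors \<open>k - x\<close> that come from
  differentiating the moment generating function.
\<close>

lemma continuous_tilted:
  fixes w :: "nat \<Rightarrow> real"
  assumes "\<And>k. \<bar>w k\<bar> \<le> c * exp (real k)"
  shows "isCont (\<lambda>s. measure_pmf.expectation D (\<lambda>k. w k * exp (s * real k))) s"
  unfolding continuous_at_sequentially
proof (intro allI impI, unfold o_def)
  fix u :: "nat \<Rightarrow> real"
  assume u: "u \<longlonglongrightarrow> s"
  then obtain S where S: "\<And>n. \<bar>u n\<bar> \<le> S"
    using convergent_imp_Bseq[of u] by (auto simp: convergent_def Bseq_def)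
  show "(\<lambda>n. measure_pmf.expectation D (\<lambda>k. w k * exp (u n * real k)))
     \<longlonglongrightarrow> measure_pmf.expectation D (\<lambda>k. w k * exp (s * real k))"
  proof (rule integral_dominated_convergence[where w = "\<lambda>k. c * exp ((S + 1) * real k)"])
    show "integrable (measure_pmf D) (\<lambda>k. c * exp ((S + 1) * real k))"
      using integrable_exp by simp
    show "AE k in measure_pmf D. (\<lambda>n. w k * exp (u n * real k)) \<longlonglongrightarrow> w k * exp (s * real k)"
      by (intro AE_I2 tendsto_intros u)
    fix n
    show "AE k in measure_pmf D. norm (w k * exp (u n * real k)) \<le> c * exp ((S + 1) * real k)"
    proof (rule AE_I2)
      fix k
      have "u n * real k \<le> S * real k" using S[of n] by (intro mult_right_mono) auto
      then have "\<bar>w k\<bar> * exp (u n * real k) \<le> c * exp (real k) * exp (S * real k)"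
        using assms[of k] by (intro mult_mono) auto
      then show "norm (w k * exp (u n * real k)) \<le> c * exp ((S + 1) * real k)"
        by (simp add: abs_mult algebra_simps exp_add)
    qed
  qed simp_all
qed

lemma isCont_mgf: "isCont (mgf D) s"
  unfolding mgf_def using continuous_tilted[of "\<lambda>_. 1" 1] by simp

lemma mgf_ge_atom: "pmf D k * exp (s * real k) \<le> mgf D s"
proof -
  have "measure_pmf.expectation D (\<lambda>j. indicator {k} j * exp (s * real k)) \<le> mgf D s"
    unfolding mgf_def
  proof (rule integral_mono)
    show "integrable (measure_pmf D) (\<lambda>j. indicator {k} j * exp (s * real k))"
      by (rule measure_pmf.integrable_const_bound[where B = "exp (s * real k)"])
        (auto simp: indicator_def)
  qed (auto simp: integrable_exp indicator_def)
  then show ?thesis by (simp add: measure_pmf_single)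
qed

lemma mgf_pos: "mgf D s > 0"
proof -
  obtain k where "k \<in> set_pmf D" using set_pmf_not_empty by fast
  then have "pmf D k * exp (s * real k) > 0" by (simp add: pmf_positive)
  then show ?thesis using mgf_ge_atom[of k s] by linarith
qed

lemma exp_cumulant: "exp (cumulant D s) = mgf D s"
  using mgf_pos by (simp add: cumulant_eq)

lemma cumulant_0: "cumulant D 0 = 0"
  by (simp add: cumulant_def)

lemma isCont_cumulant: "isCont (cumulant D) s"
  unfolding cumulant_eq[abs_def] using isCont_mgf mgf_pos[of s]
  by (intro continuous_intros) auto

lemma cumulant_ge_atom:
  assumes "k \<in> set_pmf D"
  shows "ln (pmf D k) + s * real k \<le> cumulant D s"
proof -
  have "pmf D k > 0" using assms by (simp add: pmf_positive)
  then have "ln (pmf D k) + s * real k = ln (pmf D k * exp (s * real k))" by (simp add: ln_mult)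
  also have "\<dots> \<le> cumulant D s"
    unfolding cumulant_eq using \<open>pmf D k > 0\<close> mgf_pos mgf_ge_atom by (simp add: ln_le_cancel_iff)
  finally show ?thesis .
qed

text \<open>
  This lemma and the next say that \<open>rate D t x\<close> is the supremum of \<open>s x - t \<Lambda>(s)\<close>; at \<open>t = 0\<close> the
  supremum of \<open>s x\<close> is \<open>0\<close> or \<open>\<infinity>\<close>, in agreement with the convention.
\<close>

lemma rate_ge:
  assumes "t \<ge> 0"
  shows "ereal (s * x - t * cumulant D s) \<le> rate D t x"
proof (cases "t = 0")
  case False
  then have t: "t > 0" using assms by simp
  have "ereal (x / t * s - cumulant D s) \<le> cumulant_conjugate D (x / t)"
    unfolding cumulant_conjugate_def by (rule SUP_upper) simp
  then have "ereal t * ereal (x / t * s - cumulant D s) \<le> ereal t * cumulant_conjugate D (x / t)"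
    using assms by (intro ereal_mult_left_mono) auto
  then show ?thesis using t by (simp add: rate_def algebra_simps)
qed (simp add: rate_def)

lemma rate_le:
  assumes "t \<ge> 0" "\<And>s. s * x - t * cumulant D s \<le> v"
  shows "rate D t x \<le> ereal v"
proof (cases "t = 0")
  case True
  have v: "s * x \<le> v" for s using assms(2)[of s] True by simp
  have "x = 0"
  proof (rule ccontr)
    assume "x \<noteq> 0"
    then show False using v[of "(v + 1) / x"] by simp
  qed
  then show ?thesis using True v[of 0] by (simp add: rate_def)
next
  case False
  then have t: "t > 0" using assms by simp
  have "cumulant_conjugate D (x / t) \<le> ereal (v / t)"
    unfolding cumulant_conjugate_def
  proof (rule SUP_least)
    fix s
    have "(x / t * s - cumulant D s) * t \<le> v" using assms(2)[of s] t by (simp add: algebra_simps)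
    then show "ereal (x / t * s - cumulant D s) \<le> ereal (v / t)" using t by (simp add: pos_le_divide_eq)
  qed
  then have "ereal t * cumulant_conjugate D (x / t) \<le> ereal t * ereal (v / t)"
    using assms by (intro ereal_mult_left_mono) auto
  then show ?thesis using t by (simp add: rate_def)
qed

lemma rate_add_le:
  assumes "t \<ge> 0" "t' \<ge> 0"
    and le: "\<And>s s'. (s * x - t * cumulant D s) + (s' * y - t' * cumulant D s') \<le> v"
  shows "rate D t x + rate D t' y \<le> ereal v"
proof -
  have r: "rate D t x \<le> ereal (v - (s' * y - t' * cumulant D s'))" for s'
    by (rule rate_le) (use assms(1) le[of _ s'] in \<open>auto simp: algebra_simps\<close>)
  have "ereal (0 * x - t * cumulant D 0) \<le> rate D t x" using assms(1) by (rule rate_ge)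
  with r[of 0] obtain R where R: "rate D t x = ereal R" by (cases "rate D t x") auto
  have "rate D t' y \<le> ereal (v - R)"
    by (rule rate_le) (use assms(2) r in \<open>auto simp: R algebra_simps\<close>)
  then have "ereal R + rate D t' y \<le> ereal R + ereal (v - R)" by (rule add_left_mono)
  then show ?thesis by (simp add: R)
qed

text \<open>
  A law \<open>\<nu>\<close> of mean \<open>x\<close> whose density with respect to \<open>D\<close> is at most \<open>exp (s k - l)\<close>. An inequality,
  rather than an equality, is required in order to include the point mass at an end of the support of
  \<open>D\<close>: it is not an exponential tilt of \<open>D\<close> unless \<open>D\<close> is degenerate.
\<close>

definition tilts_to :: "real \<Rightarrow> nat pmf \<Rightarrow> real \<Rightarrow> real \<Rightarrow> bool" where
  "tilts_to x \<nu> s l \<longleftrightarrow> (\<forall>k. pmf \<nu> k \<le> pmf D k * exp (s * real k - l)) \<and>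
     integrable (measure_pmf \<nu>) (\<lambda>k. (real k)\<^sup>2) \<and> measure_pmf.expectation \<nu> real = x"

lemma square_le_exp: "\<bar>(real k)\<^sup>2\<bar> \<le> 2 * exp (real k)"
  using exp_lower_Taylor_quadratic[of "real k"] by simp

lemma tilted_pmf_exists:
  obtains \<nu> where "\<And>k. pmf \<nu> k = pmf D k * exp (s * real k - cumulant D s)"
    "\<And>f::nat \<Rightarrow> real. measure_pmf.expectation \<nu> f
       = measure_pmf.expectation D (\<lambda>k. f k * exp (s * real k)) * exp (- cumulant D s)"
    "\<And>f::nat \<Rightarrow> real. integrable (measure_pmf D) (\<lambda>k. f k * exp (s * real k)) \<Longrightarrow>
       integrable (measure_pmf \<nu>) f"
proof -
  define w where "w k = exp (s * real k - cumulant D s)" for k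
  define \<nu> where "\<nu> = embed_pmf (\<lambda>k. pmf D k * w k)"
  have w_alt: "w k = exp (s * real k) * exp (- cumulant D s)" for k
    by (simp add: w_def exp_diff exp_minus field_simps)
  have int_w: "integrable (measure_pmf D) w" unfolding w_alt using integrable_exp by simp
  have "(\<integral>\<^sup>+ k. ennreal (pmf D k * w k) \<partial>count_space UNIV) = (\<integral>\<^sup>+ k. ennreal (w k) \<partial>measure_pmf D)"
    by (subst measure_pmf_eq_density, subst nn_integral_density) (auto simp: ennreal_mult w_def)
  also have "\<dots> = ennreal (measure_pmf.expectation D w)"
    using int_w by (intro nn_integral_eq_integral) (simp_all add: w_alt integrable_exp)
  also have "measure_pmf.expectation D w = mgf D s * exp (- cumulant D s)"
    unfolding w_alt mgf_def by simp
  also have "\<dots> = 1" using mgf_pos[of s] by (simp add: exp_minus exp_cumulant)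
  finally have one: "(\<integral>\<^sup>+ k. ennreal (pmf D k * w k) \<partial>count_space UNIV) = 1" by simp
  have pmf_\<nu>: "pmf \<nu> k = pmf D k * w k" for k
    unfolding \<nu>_def by (rule pmf_embed_pmf) (use one in \<open>auto simp: w_def\<close>)
  have dens: "measure_pmf \<nu> = density (measure_pmf D) w"
    unfolding measure_pmf_eq_density pmf_\<nu>
    by (subst density_density_eq) (auto simp: ennreal_mult w_def)
  have ex: "measure_pmf.expectation \<nu> f
       = measure_pmf.expectation D (\<lambda>k. f k * exp (s * real k)) * exp (- cumulant D s)"
    for f :: "nat \<Rightarrow> real"
  proof -
    have "measure_pmf.expectation \<nu> f = measure_pmf.expectation D (\<lambda>k. w k * f k)"
      unfolding dens by (subst integral_density) (auto simp: w_def)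
    also have "(\<lambda>k. w k * f k) = (\<lambda>k. f k * exp (s * real k) * exp (- cumulant D s))"
      by (simp add: w_alt mult_ac)
    finally show ?thesis by simp
  qed
  have it: "integrable (measure_pmf \<nu>) f" if "integrable (measure_pmf D) (\<lambda>k. f k * exp (s * real k))"
    for f :: "nat \<Rightarrow> real"
  proof -
    have "integrable (measure_pmf D) (\<lambda>k. f k * exp (s * real k) * exp (- cumulant D s))"
      using that by simp
    also have "(\<lambda>k. f k * exp (s * real k) * exp (- cumulant D s)) = (\<lambda>k. w k * f k)"
      by (simp add: w_alt mult_ac)
    finally show ?thesis unfolding dens by (subst integrable_density) (auto simp: w_def)
  qed
  show ?thesis using that[OF pmf_\<nu>[unfolded w_def] ex it] .
qed

text \<open>
  If \<open>D\<close> charges both sides of \<open>x\<close>, then \<open>u \<mapsto> x u - \<Lambda>(u)\<close> tends to \<open>- \<infinity>\<close> at both ends and attains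
  its maximum at some \<open>s\<close>. Stationarity at \<open>s\<close> means that the tilted law has mean \<open>x\<close>. It is extracted
  from difference quotients by \<open>1 - exp (- z) \<le> z\<close>, so that only the continuity of
  \<open>u \<mapsto> E ((D - x) exp (u D))\<close> is used.
\<close>

lemma tilt_interior:
  assumes k: "k1 \<in> set_pmf D" "k2 \<in> set_pmf D" "real k1 < x" "x < real k2"
  obtains \<nu> s where "tilts_to x \<nu> s (cumulant D s)"
proof -
  define \<phi> where "\<phi> u = x * u - cumulant D u" for u
  have up1: "\<phi> u \<le> - ln (pmf D k1) + u * (x - real k1)" for u
    using cumulant_ge_atom[OF k(1), of u] by (simp add: \<phi>_def algebra_simps)
  have up2: "\<phi> u \<le> - ln (pmf D k2) - u * (real k2 - x)" for u
    using cumulant_ge_atom[OF k(2), of u] by (simp add: \<phi>_def algebra_simps)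
  have ln_le: "- ln (pmf D k1) \<ge> 0" "- ln (pmf D k2) \<ge> 0"
    using k pmf_le_1 by (auto simp: ln_le_zero_iff pmf_positive)
  \<comment> \<open>Outside \<open>[- R, R]\<close> one of the two linear upper bounds is at most \<open>0 = \<phi> 0\<close>.\<close>
  define R where "R = - ln (pmf D k1) / (x - real k1) + - ln (pmf D k2) / (real k2 - x)"
  have R: "R \<ge> 0" "R \<ge> - ln (pmf D k1) / (x - real k1)" "R \<ge> - ln (pmf D k2) / (real k2 - x)"
  proof -
    have "- ln (pmf D k1) / (x - real k1) \<ge> 0" "- ln (pmf D k2) / (real k2 - x) \<ge> 0"
      by (rule divide_nonneg_pos; use k ln_le in simp)+
    then show "R \<ge> 0" "R \<ge> - ln (pmf D k1) / (x - real k1)" "R \<ge> - ln (pmf D k2) / (real k2 - x)"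
      unfolding R_def by linarith+
  qed
  have cont: "continuous_on {-R..R} \<phi>"
    unfolding \<phi>_def by (intro continuous_intros continuous_at_imp_continuous_on ballI isCont_cumulant)
  have "\<exists>s\<in>{-R..R}. \<forall>u\<in>{-R..R}. \<phi> u \<le> \<phi> s"
    by (rule continuous_attains_sup[OF _ _ cont]) (use R(1) in auto)
  then obtain s where s: "\<And>u. u \<in> {-R..R} \<Longrightarrow> \<phi> u \<le> \<phi> s" "s \<in> {-R..R}" by blast
  have \<phi>0: "\<phi> 0 = 0" by (simp add: \<phi>_def cumulant_0)
  have max: "\<phi> u \<le> \<phi> s" for u
  proof (cases "u \<in> {-R..R}")
    case False
    have "\<phi> u \<le> 0"
    proof (cases "u > R")
      case True
      then have "- ln (pmf D k2) / (real k2 - x) \<le> u" using R by linarith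
      then have "- ln (pmf D k2) \<le> u * (real k2 - x)" by (subst (asm) pos_divide_le_eq) (use k in auto)
      then show ?thesis using up2[of u] by linarith
    next
      case F: False
      then have "u < - R" using False by auto
      then have "- ln (pmf D k1) / (x - real k1) \<le> - u" using R by linarith
      then have "- ln (pmf D k1) \<le> - u * (x - real k1)" by (subst (asm) pos_divide_le_eq) (use k in auto)
      then show ?thesis using up1[of u] by simp
    qed
    also have "\<dots> \<le> \<phi> s" using s(1)[of 0] R(1) \<phi>0 by simp
    finally show ?thesis .
  qed (use s in blast)
  define A where "A u = measure_pmf.expectation D (\<lambda>k. (real k - x) * exp (u * real k))" for u
  have bnd: "\<bar>real k - x\<bar> \<le> (1 + \<bar>x\<bar>) * exp (real k)" for k
  proof -
    have "\<bar>real k - x\<bar> \<le> real k + \<bar>x\<bar>" by simp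
    also have "\<dots> \<le> exp (real k) + \<bar>x\<bar> * exp (real k)"
    proof (rule add_mono)
      show "real k \<le> exp (real k)" using exp_ge_add_one_self[of "real k"] by linarith
      show "\<bar>x\<bar> \<le> \<bar>x\<bar> * exp (real k)" using mult_left_mono[of 1 "exp (real k)" "\<bar>x\<bar>"] by simp
    qed
    finally show ?thesis by (simp add: algebra_simps)
  qed
  have mono: "0 \<le> h * A (s + h)" for h
  proof -
    have "x * (s + h) - cumulant D (s + h) \<le> x * s - cumulant D s" using max[of "s + h"] by (simp add: \<phi>_def)
    then have "cumulant D s + x * h \<le> cumulant D (s + h)" by (simp add: algebra_simps)
    then have "exp (cumulant D s + x * h) \<le> exp (cumulant D (s + h))" by simp
    then have 1: "mgf D s * exp (x * h) \<le> mgf D (s + h)" by (simp add: exp_add exp_cumulant)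
    have "mgf D (s + h) - exp (x * h) * mgf D s \<le> h * A (s + h)"
    proof -
      have "mgf D (s + h) - exp (x * h) * mgf D s = measure_pmf.expectation D
          (\<lambda>k. exp ((s + h) * real k) - exp (x * h) * exp (s * real k))"
        unfolding mgf_def using integrable_exp by simp
      also have "\<dots> \<le> measure_pmf.expectation D (\<lambda>k. h * ((real k - x) * exp ((s + h) * real k)))"
      proof (rule integral_mono)
        show "integrable (measure_pmf D) (\<lambda>k. h * ((real k - x) * exp ((s + h) * real k)))"
          using integrable_tilted[OF bnd] by simp
        fix k
        have "1 - exp (- (h * (real k - x))) \<le> h * (real k - x)"
          using exp_ge_add_one_self[of "- (h * (real k - x))"] by simp
        then have "(1 - exp (- (h * (real k - x)))) * exp ((s + h) * real k)
          \<le> h * (real k - x) * exp ((s + h) * real k)" by (intro mult_right_mono) auto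
        moreover have "exp (- (h * (real k - x))) * exp ((s + h) * real k) = exp (x * h) * exp (s * real k)"
          by (simp add: algebra_simps flip: exp_add)
        ultimately show "exp ((s + h) * real k) - exp (x * h) * exp (s * real k)
          \<le> h * ((real k - x) * exp ((s + h) * real k))" by (simp add: left_diff_distrib mult.assoc)
      qed (use integrable_exp in simp)
      also have "\<dots> = h * A (s + h)" by (simp add: A_def)
      finally show ?thesis .
    qed
    then show ?thesis using 1 by (simp add: mult.commute)
  qed
  have contA: "isCont A s" unfolding A_def by (rule continuous_tilted[OF bnd])
  define h where "h n = 1 / real (Suc n)" for n
  have h: "h \<longlonglongrightarrow> 0" "h n > 0" for n
    using LIMSEQ_inverse_real_of_nat by (auto simp: h_def[abs_def] inverse_eq_divide)
  have limA: "(\<lambda>n. A (s + e * h n)) \<longlonglongrightarrow> A s" for e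
  proof (rule isCont_tendsto_compose[OF contA])
    have "(\<lambda>n. s + e * h n) \<longlonglongrightarrow> s + e * 0" by (intro tendsto_intros h(1))
    then show "(\<lambda>n. s + e * h n) \<longlonglongrightarrow> s" by simp
  qed
  have "A s \<ge> 0"
  proof (rule LIMSEQ_le_const[OF limA[of 1]], intro exI allI impI)
    fix n show "0 \<le> A (s + 1 * h n)"
      using mono[of "h n"] h(2)[of n] by (simp add: zero_le_mult_iff)
  qed
  moreover have "A s \<le> 0"
  proof (rule LIMSEQ_le_const2[OF limA[of "-1"]], intro exI allI impI)
    fix n show "A (s + - 1 * h n) \<le> 0"
      using mono[of "- h n"] h(2)[of n] by (simp add: mult_le_0_iff)
  qed
  ultimately have A: "A s = 0" by simp
  obtain \<nu> where \<nu>: "\<And>k. pmf \<nu> k = pmf D k * exp (s * real k - cumulant D s)"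
    "\<And>f::nat \<Rightarrow> real. measure_pmf.expectation \<nu> f
       = measure_pmf.expectation D (\<lambda>k. f k * exp (s * real k)) * exp (- cumulant D s)"
    "\<And>f::nat \<Rightarrow> real. integrable (measure_pmf D) (\<lambda>k. f k * exp (s * real k)) \<Longrightarrow>
       integrable (measure_pmf \<nu>) f"
    using tilted_pmf_exists by blast
  have sq: "integrable (measure_pmf \<nu>) (\<lambda>k. (real k)\<^sup>2)"
    by (rule \<nu>(3)[OF integrable_tilted[OF square_le_exp]])
  have "integrable (measure_pmf \<nu>) real"
    by (rule measure_pmf.square_integrable_imp_integrable) (use sq in auto)
  then have "measure_pmf.expectation \<nu> (\<lambda>k. real k - x) = measure_pmf.expectation \<nu> real - x"
    by simp
  moreover have "measure_pmf.expectation \<nu> (\<lambda>k. real k - x) = 0"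
    unfolding \<nu>(2) using A by (simp add: A_def)
  ultimately have "tilts_to x \<nu> s (cumulant D s)"
    unfolding tilts_to_def using \<nu>(1) sq by simp
  then show ?thesis using that by blast
qed

text \<open>
  If \<open>D\<close> does not charge one side of \<open>x\<close>, then \<open>E (exp (s (D - x)))\<close> decreases to the mass of \<open>x\<close> as
  \<open>s\<close> tends to infinity in the direction of that side. A finite conjugate at \<open>x\<close> thus forces an atom.
\<close>

lemma tilt_boundary:
  assumes side: "(\<forall>k\<in>set_pmf D. x \<le> real k) \<or> (\<forall>k\<in>set_pmf D. real k \<le> x)"
    and v: "\<And>s. x * s - cumulant D s \<le> v"
  obtains k where "x = real k" "exp (- v) \<le> pmf D k"
proof -
  \<comment> \<open>The sign \<open>e\<close> points to the side of \<open>x\<close> that \<open>D\<close> does not charge.\<close>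
  obtain e :: real where e: "e \<noteq> 0" "\<And>k. k \<in> set_pmf D \<Longrightarrow> e * (real k - x) \<le> 0"
  proof (cases "\<forall>k\<in>set_pmf D. x \<le> real k")
    case True
    then show ?thesis using that[of "-1"] by auto
  next
    case False
    then show ?thesis using that[of 1] side by auto
  qed
  have lower: "exp (- v) \<le> measure_pmf.expectation D (\<lambda>k. exp (real n * (e * (real k - x))))" for n
  proof -
    have "exp (- v) \<le> exp (cumulant D (real n * e) - x * (real n * e))"
      using v[of "real n * e"] by simp
    also have "\<dots> = mgf D (real n * e) * exp (- x * (real n * e))"
      by (simp add: exp_diff exp_cumulant exp_minus field_simps)
    also have "\<dots> = measure_pmf.expectation D (\<lambda>k. exp (real n * e * real k) * exp (- x * (real n * e)))"
      by (simp add: mgf_def)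
    also have "\<dots> = measure_pmf.expectation D (\<lambda>k. exp (real n * (e * (real k - x))))"
      by (simp add: algebra_simps flip: exp_add)
    finally show ?thesis .
  qed
  have "(\<lambda>n. measure_pmf.expectation D (\<lambda>k. exp (real n * (e * (real k - x)))))
      \<longlonglongrightarrow> measure_pmf.expectation D (indicator {k. real k = x})"
  proof (rule integral_dominated_convergence[where w = "\<lambda>_. 1"])
    show "AE k in measure_pmf D. (\<lambda>n. exp (real n * (e * (real k - x)))) \<longlonglongrightarrow> indicator {k. real k = x} k"
    proof (rule AE_pmfI)
      fix k assume k: "k \<in> set_pmf D"
      show "(\<lambda>n. exp (real n * (e * (real k - x)))) \<longlonglongrightarrow> indicator {k. real k = x} k"
      proof (cases "real k = x")
        case False
        then have neg: "e * (real k - x) < 0" using e(1) e(2)[OF k] by (simp add: less_le)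
        have "(\<lambda>n. exp (e * (real k - x)) ^ n) \<longlonglongrightarrow> 0"
          by (rule LIMSEQ_power_zero) (use neg in simp)
        then show ?thesis using False by (simp add: exp_of_nat_mult)
      qed simp
    qed
    fix n
    show "AE k in measure_pmf D. norm (exp (real n * (e * (real k - x)))) \<le> 1"
      by (rule AE_pmfI) (use e(2) in \<open>auto intro: mult_nonneg_nonpos\<close>)
  qed simp_all
  then have "exp (- v) \<le> measure_pmf.expectation D (indicator {k. real k = x} :: nat \<Rightarrow> real)"
    using lower by (intro LIMSEQ_le_const) auto
  then have le: "exp (- v) \<le> measure_pmf.prob D {k. real k = x}" by simp
  have "{k. real k = x} \<noteq> {}"
  proof
    assume "{k. real k = x} = {}"
    then show False using le by simp
  qed
  then obtain k where k: "real k = x" by blast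
  then have "{k. real k = x} = {k}" by auto
  then show ?thesis using that[of k] le k by (simp add: measure_pmf_single)
qed

lemma tilt_exists:
  assumes v: "\<And>s. x * s - cumulant D s \<le> v"
  obtains \<nu> s l where "tilts_to x \<nu> s l" "s * x - l \<le> v"
proof (cases "(\<forall>k\<in>set_pmf D. x \<le> real k) \<or> (\<forall>k\<in>set_pmf D. real k \<le> x)")
  case True
  then obtain k where k: "x = real k" "exp (- v) \<le> pmf D k" using tilt_boundary v by blast
  have pos: "pmf D k > 0" using k(2) exp_gt_zero[of "-v"] by linarith
  then have "- v \<le> ln (pmf D k)" using k(2) by (simp add: ln_ge_iff)
  moreover have "tilts_to x (return_pmf k) 0 (ln (pmf D k))"
    unfolding tilts_to_def using k pos
    by (auto simp: exp_minus indicator_def intro!: integrable_measure_pmf_finite)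
  ultimately show ?thesis using that by force
next
  case False
  then obtain k1 k2 where "k1 \<in> set_pmf D" "k2 \<in> set_pmf D" "real k1 < x" "x < real k2"
    by (auto simp: not_le)
  then obtain \<nu> s where "tilts_to x \<nu> s (cumulant D s)" using tilt_interior by blast
  then show ?thesis using that[of \<nu> s "cumulant D s"] v[of s] by (simp add: mult.commute)
qed

text \<open>
  For \<open>t = 0\<close> finiteness forces \<open>x = 0\<close>, and then \<open>D\<close> itself will do, with \<open>s = l = 0\<close>.
\<close>

lemma rate_tilt_exists:
  assumes "t \<ge> 0" and v: "\<And>s. s * x - t * cumulant D s \<le> v"
  obtains \<nu> s l y where "x = t * y" "tilts_to y \<nu> s l" "s * x - t * l \<le> v"
proof (cases "t = 0")
  case True
  have "rate D t x \<le> ereal v" using assms by (rule rate_le)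
  then have "x = 0" using True by (auto simp: rate_def split: if_splits)
  moreover have "tilts_to (measure_pmf.expectation D real) D 0 0"
    unfolding tilts_to_def using integrable_tilted[OF square_le_exp, of 0] by simp
  ultimately show ?thesis using that[of "measure_pmf.expectation D real" D 0 0] v[of 0] True by simp
next
  case False
  then have t: "t > 0" using assms by simp
  have "x / t * s - cumulant D s \<le> v / t" for s
  proof -
    have "(x / t * s - cumulant D s) * t \<le> v" using v[of s] t by (simp add: algebra_simps)
    then show ?thesis using t by (simp add: pos_le_divide_eq)
  qed
  then obtain \<nu> s l where "tilts_to (x / t) \<nu> s l" and sl: "s * (x / t) - l \<le> v / t"
    using tilt_exists by blast
  moreover have "s * x - t * l \<le> v"
    using mult_left_mono[OF sl, of t] t by (simp add: algebra_simps)
  ultimately show ?thesis using that[of "x / t"] t by simp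
qed

end

section \<open>Two independent sums of degrees\<close>

lemma second_moment_sum_Pi_pmf:
  fixes p :: "'a \<Rightarrow> nat pmf"
  assumes "finite I" "S \<subseteq> I"
    and sq: "\<And>i. i \<in> S \<Longrightarrow> integrable (measure_pmf (p i)) (\<lambda>k. (real k)\<^sup>2)"
    and mean: "\<And>i. i \<in> S \<Longrightarrow> measure_pmf.expectation (p i) real = y"
    and var: "\<And>i. i \<in> S \<Longrightarrow> measure_pmf.expectation (p i) (\<lambda>k. (real k - y)\<^sup>2) = v"
  shows "integrable (measure_pmf (Pi_pmf I dflt p)) (\<lambda>d. (\<Sum>i\<in>S. real (d i) - y)\<^sup>2)"
    and "measure_pmf.expectation (Pi_pmf I dflt p) (\<lambda>d. (\<Sum>i\<in>S. real (d i) - y)\<^sup>2) = real (card S) * v"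
proof -
  let ?P = "measure_pmf (Pi_pmf I dflt p)"
  have fS: "finite S" using assms finite_subset by blast
  have comp: "map_pmf (\<lambda>d. d i) (Pi_pmf I dflt p) = p i" if "i \<in> S" for i
    using Pi_pmf_component[OF assms(1), of i dflt p] that assms(2) by auto
  have E1: "integral\<^sup>L ?P (\<lambda>d. g (d i)) = measure_pmf.expectation (p i) g"
    if "i \<in> S" for i and g :: "nat \<Rightarrow> real"
    unfolding comp[OF that, symmetric] by simp
  have I1: "integrable ?P (\<lambda>d. g (d i))" if "i \<in> S" "integrable (measure_pmf (p i)) g"
    for i and g :: "nat \<Rightarrow> real"
    using that(2) unfolding comp[OF that(1), symmetric] by (simp add: integrable_map_pmf_eq)
  have int1: "integrable (measure_pmf (p i)) real" if "i \<in> S" for i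
    by (rule measure_pmf.square_integrable_imp_integrable) (use sq[OF that] in auto)
  have int2: "integrable (measure_pmf (p i)) (\<lambda>k. (real k - y)\<^sup>2)" if "i \<in> S" for i
    unfolding power2_diff using sq[OF that] int1[OF that] by simp
  have ind: "prob_space.indep_vars ?P (\<lambda>_. borel) (\<lambda>i d. real (d i) - y) I"
    using prob_space.indep_vars_compose2[OF measure_pmf.prob_space_axioms
      indep_vars_Pi_pmf[OF assms(1), of dflt p], of "\<lambda>_ k. real k - y" "\<lambda>_. borel"] by simp
  have cross: "integrable ?P (\<lambda>d. (real (d i) - y) * (real (d j) - y)) \<and>
      integral\<^sup>L ?P (\<lambda>d. (real (d i) - y) * (real (d j) - y)) = (if i = j then v else 0)"
    if ij: "i \<in> S" "j \<in> S" for i j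
  proof (cases "i = j")
    case True
    then show ?thesis
      using I1[OF ij(1) int2[OF ij(1)]] E1[OF ij(1), of "\<lambda>k. (real k - y)\<^sup>2"] var[OF ij(1)]
      by (simp add: power2_eq_square)
  next
    case False
    have ind': "prob_space.indep_vars ?P (\<lambda>_. borel) (\<lambda>i d. real (d i) - y) {i, j}"
      by (rule prob_space.indep_vars_subset[OF measure_pmf.prob_space_axioms ind]) (use ij assms in auto)
    have int: "integrable ?P (\<lambda>d. real (d l) - y)" if "l \<in> {i, j}" for l
      using I1[of l "\<lambda>k. real k - y"] int1 ij that by auto
    have E0: "integral\<^sup>L ?P (\<lambda>d. real (d i) - y) = 0"
      using E1[OF ij(1), of "\<lambda>k. real k - y"] int1[OF ij(1)] mean[OF ij(1)] by simp
    show ?thesis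
      using prob_space.indep_vars_lebesgue_integral[OF measure_pmf.prob_space_axioms _ ind' int]
        prob_space.indep_vars_integrable[OF measure_pmf.prob_space_axioms _ ind' int] False E0 by simp
  qed
  have sq_eq: "(\<Sum>i\<in>S. real (d i) - y)\<^sup>2 = (\<Sum>i\<in>S. \<Sum>j\<in>S. (real (d i) - y) * (real (d j) - y))" for d
    by (simp add: power2_eq_square sum_product)
  show "integrable ?P (\<lambda>d. (\<Sum>i\<in>S. real (d i) - y)\<^sup>2)"
    unfolding sq_eq using cross by (intro Bochner_Integration.integrable_sum) auto
  have "integral\<^sup>L ?P (\<lambda>d. (\<Sum>i\<in>S. real (d i) - y)\<^sup>2)
      = (\<Sum>i\<in>S. \<Sum>j\<in>S. integral\<^sup>L ?P (\<lambda>d. (real (d i) - y) * (real (d j) - y)))"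
    unfolding sq_eq using cross
    by (subst Bochner_Integration.integral_sum, force intro!: Bochner_Integration.integrable_sum)
       (intro sum.cong refl Bochner_Integration.integral_sum, blast)
  also have "\<dots> = (\<Sum>i\<in>S. \<Sum>j\<in>S. if i = j then v else 0)"
    using cross by (intro sum.cong refl) auto
  also have "\<dots> = real (card S) * v" using fS by simp
  finally show "integral\<^sup>L ?P (\<lambda>d. (\<Sum>i\<in>S. real (d i) - y)\<^sup>2) = real (card S) * v" .
qed

lemma prob_sum_Pi_pmf_deviation:
  fixes p :: "'a \<Rightarrow> nat pmf"
  assumes "finite I" "S \<subseteq> I"
    and sq: "\<And>i. i \<in> S \<Longrightarrow> integrable (measure_pmf (p i)) (\<lambda>k. (real k)\<^sup>2)"
    and mean: "\<And>i. i \<in> S \<Longrightarrow> measure_pmf.expectation (p i) real = y"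
    and var: "\<And>i. i \<in> S \<Longrightarrow> measure_pmf.expectation (p i) (\<lambda>k. (real k - y)\<^sup>2) = v"
    and e: "e > 0"
  shows "measure_pmf.prob (Pi_pmf I dflt p) {d. e \<le> \<bar>real (\<Sum>i\<in>S. d i) - real (card S) * y\<bar>}
     \<le> real (card S) * v / e\<^sup>2"
proof -
  let ?P = "Pi_pmf I dflt p"
  note sm = second_moment_sum_Pi_pmf[OF assms(1-5), where dflt = dflt]
  have "measure_pmf.prob ?P {d \<in> space (measure_pmf ?P). e\<^sup>2 \<le> (\<Sum>i\<in>S. real (d i) - y)\<^sup>2}
     \<le> measure_pmf.expectation ?P (\<lambda>d. (\<Sum>i\<in>S. real (d i) - y)\<^sup>2) / e\<^sup>2"
    by (rule integral_Markov_inequality_measure[where A = "{}"]) (use sm(1) e in auto)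
  also have "{d \<in> space (measure_pmf ?P). e\<^sup>2 \<le> (\<Sum>i\<in>S. real (d i) - y)\<^sup>2}
     = {d. e \<le> \<bar>real (\<Sum>i\<in>S. d i) - real (card S) * y\<bar>}"
    using e by (auto simp: sum_subtractf abs_le_square_iff[symmetric])
  finally show ?thesis using sm(2) by simp
qed

lemma measure_pmf_ge_scaled:
  assumes "\<kappa> \<ge> 0" "\<And>x. x \<in> W \<Longrightarrow> \<kappa> * pmf q x \<le> pmf p x"
  shows "\<kappa> * measure_pmf.prob q W \<le> measure_pmf.prob p W"
proof -
  have "ennreal (\<kappa> * measure_pmf.prob q W) = ennreal \<kappa> * emeasure (measure_pmf q) W"
    using assms(1) by (simp add: ennreal_mult measure_pmf.emeasure_eq_measure)
  also have "\<dots> = ennreal \<kappa> * (\<integral>\<^sup>+x. ennreal (pmf q x) \<partial>count_space W)"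
    by (simp add: nn_integral_pmf)
  also have "\<dots> = (\<integral>\<^sup>+x. ennreal (\<kappa> * pmf q x) \<partial>count_space W)"
    using assms(1) by (simp add: nn_integral_cmult[symmetric] ennreal_mult)
  also have "\<dots> \<le> (\<integral>\<^sup>+x. ennreal (pmf p x) \<partial>count_space W)"
    using assms(2) by (intro nn_integral_mono ennreal_leI) auto
  also have "\<dots> = ennreal (measure_pmf.prob p W)"
    by (simp add: nn_integral_pmf measure_pmf.emeasure_eq_measure)
  finally show ?thesis by (simp add: ennreal_le_iff)
qed

context exp_moments
begin

abbreviation iid :: "nat \<Rightarrow> (nat \<Rightarrow> nat) pmf" where
  "iid n \<equiv> Pi_pmf {..<n} 0 (\<lambda>_. D)"

lemma exp_two_sums_eq_prod:
  fixes s s' :: real and n :: nat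
  assumes "S \<subseteq> {..<n}"
  shows "exp (s * real (\<Sum>i\<in>S. d i) + s' * real (\<Sum>i\<in>{..<n} - S. d i))
    = (\<Prod>i<n. exp ((if i \<in> S then s else s') * real (d i)))"
proof -
  have fS: "finite S" by (rule finite_subset[OF assms finite_lessThan])
  have "(\<Sum>i<n. (if i \<in> S then s else s') * real (d i))
      = (\<Sum>i\<in>S. (if i \<in> S then s else s') * real (d i)) + (\<Sum>i\<in>{..<n} - S. (if i \<in> S then s else s') * real (d i))"
    using sum.subset_diff[OF assms, of "\<lambda>i. (if i \<in> S then s else s') * real (d i)"] by simp
  also have "\<dots> = s * real (\<Sum>i\<in>S. d i) + s' * real (\<Sum>i\<in>{..<n} - S. d i)"
    by (simp add: sum_distrib_left)
  finally show ?thesis by (simp add: exp_sum[symmetric])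
qed

lemma prod_split_powers:
  fixes u w :: real and n :: nat
  assumes "S \<subseteq> {..<n}"
  shows "(\<Prod>i<n. if i \<in> S then u else w) = u ^ card S * w ^ (n - card S)"
proof -
  have "(\<Prod>i<n. if i \<in> S then u else w) = (\<Prod>i\<in>S. u) * (\<Prod>i\<in>{..<n} - S. w)"
    using prod.subset_diff[OF assms, of "\<lambda>i. if i \<in> S then u else w"] by (simp add: mult.commute)
  then show ?thesis using assms finite_subset[OF assms] by (simp add: card_Diff_subset)
qed

lemma mgf_two_sums:
  assumes "S \<subseteq> {..<n}"
  shows "integrable (measure_pmf (iid n))
      (\<lambda>d. exp (s * real (\<Sum>i\<in>S. d i) + s' * real (\<Sum>i\<in>{..<n} - S. d i)))" (is "integrable _ ?f")
    and "measure_pmf.expectation (iid n)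
      (\<lambda>d. exp (s * real (\<Sum>i\<in>S. d i) + s' * real (\<Sum>i\<in>{..<n} - S. d i)))
      = exp (real (card S) * cumulant D s + real (n - card S) * cumulant D s')"
proof -
  show "integrable (measure_pmf (iid n)) ?f"
    unfolding exp_two_sums_eq_prod[OF assms]
    by (rule integrable_prod_Pi_pmf) (use integrable_exp in auto)
  have "measure_pmf.expectation (iid n) ?f
    = (\<Prod>i<n. mgf D (if i \<in> S then s else s'))"
    unfolding exp_two_sums_eq_prod[OF assms] mgf_def
    by (rule expectation_prod_Pi_pmf) (use integrable_exp in auto)
  also have "\<dots> = (\<Prod>i<n. if i \<in> S then mgf D s else mgf D s')"
    by (intro prod.cong) auto
  also have "\<dots> = mgf D s ^ card S * mgf D s' ^ (n - card S)"
    by (rule prod_split_powers[OF assms])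
  also have "\<dots> = exp (real (card S) * cumulant D s + real (n - card S) * cumulant D s')"
    by (simp only: exp_add exp_of_nat_mult exp_cumulant)
  finally show "measure_pmf.expectation (iid n) ?f
      = exp (real (card S) * cumulant D s + real (n - card S) * cumulant D s')" .
qed

definition degree_window :: "nat \<Rightarrow> nat set \<Rightarrow> real \<Rightarrow> real \<Rightarrow> real \<Rightarrow> (nat \<Rightarrow> nat) set" where
  "degree_window n S e a c =
     {d. \<bar>real (\<Sum>i\<in>S. d i) - a\<bar> \<le> e \<and> \<bar>real (\<Sum>i\<in>{..<n} - S. d i) - c\<bar> \<le> e}"

lemma prob_two_sums_le:
  assumes "S \<subseteq> {..<n}"
  shows "measure_pmf.prob (iid n) {d. (\<Sum>i\<in>S. d i) = a \<and> (\<Sum>i\<in>{..<n} - S. d i) = c}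
    \<le> exp (real (card S) * cumulant D s + real (n - card S) * cumulant D s' - s * real a - s' * real c)"
proof -
  let ?W = "{d. (\<Sum>i\<in>S. d i) = a \<and> (\<Sum>i\<in>{..<n} - S. d i) = c}"
  have "measure_pmf.expectation (iid n) (\<lambda>d. indicator ?W d * exp (s * real a + s' * real c))
     \<le> measure_pmf.expectation (iid n) (\<lambda>d. exp (s * real (\<Sum>i\<in>S. d i) + s' * real (\<Sum>i\<in>{..<n} - S. d i)))"
  proof (rule integral_mono[OF _ mgf_two_sums(1)[OF assms]])
    show "integrable (measure_pmf (iid n)) (\<lambda>d. indicator ?W d * exp (s * real a + s' * real c))"
      by (rule measure_pmf.integrable_const_bound[where B = "exp (s * real a + s' * real c)"])
        (auto simp: indicator_def)
    fix d
    show "indicator ?W d * exp (s * real a + s' * real c)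
      \<le> exp (s * real (\<Sum>i\<in>S. d i) + s' * real (\<Sum>i\<in>{..<n} - S. d i))"
      by (cases "d \<in> ?W") (auto simp del: of_nat_sum)
  qed
  then have "measure_pmf.prob (iid n) ?W * exp (s * real a + s' * real c)
     \<le> exp (real (card S) * cumulant D s + real (n - card S) * cumulant D s')"
    unfolding mgf_two_sums(2)[OF assms] by simp
  then have "measure_pmf.prob (iid n) ?W
     \<le> exp (real (card S) * cumulant D s + real (n - card S) * cumulant D s') / exp (s * real a + s' * real c)"
    by (simp add: pos_le_divide_eq)
  then show ?thesis by (simp add: exp_diff[symmetric] algebra_simps)
qed

text \<open>
  Change of measure: on the window both sums are known up to \<open>e\<close>, so the density of the tilted product
  law with respect to the original one is nearly constant there.
\<close>

lemma prob_window_ge_tilted: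
  fixes a c e :: real
  assumes S: "S \<subseteq> {..<n}" and t: "tilts_to y \<nu> s l" "tilts_to y' \<nu>' s' l'"
  defines "W \<equiv> degree_window n S e a c"
  shows "exp (real (card S) * l + real (n - card S) * l' - s * a - s' * c - e * (\<bar>s\<bar> + \<bar>s'\<bar>)) *
      measure_pmf.prob (Pi_pmf {..<n} 0 (\<lambda>i. if i \<in> S then \<nu> else \<nu>')) W
    \<le> measure_pmf.prob (iid n) W"
proof (rule measure_pmf_ge_scaled)
  let ?\<kappa> = "exp (real (card S) * l + real (n - card S) * l' - s * a - s' * c - e * (\<bar>s\<bar> + \<bar>s'\<bar>))"
  fix d assume d: "d \<in> W"
  let ?A = "real (\<Sum>i\<in>S. d i)" and ?C = "real (\<Sum>i\<in>{..<n} - S. d i)"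
  show "?\<kappa> * pmf (Pi_pmf {..<n} 0 (\<lambda>i. if i \<in> S then \<nu> else \<nu>')) d \<le> pmf (iid n) d"
  proof (cases "\<forall>x. x \<notin> {..<n} \<longrightarrow> d x = 0")
    case True
    have "pmf (Pi_pmf {..<n} 0 (\<lambda>i. if i \<in> S then \<nu> else \<nu>')) d
        = (\<Prod>i<n. pmf (if i \<in> S then \<nu> else \<nu>') (d i))"
      using True by (subst pmf_Pi') auto
    also have "\<dots> \<le> (\<Prod>i<n. pmf D (d i) * (exp ((if i \<in> S then s else s') * real (d i))
        * (if i \<in> S then exp (- l) else exp (- l'))))"
      using t unfolding tilts_to_def
      by (intro prod_mono) (auto simp: exp_diff exp_minus divide_inverse)
    also have "\<dots> = (\<Prod>i<n. pmf D (d i)) * ((\<Prod>i<n. exp ((if i \<in> S then s else s') * real (d i)))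
        * (\<Prod>i<n. if i \<in> S then exp (- l) else exp (- l')))"
      by (simp only: prod.distrib)
    also have "(\<Prod>i<n. pmf D (d i)) = pmf (iid n) d"
      using True by (subst pmf_Pi') auto
    also have "(\<Prod>i<n. exp ((if i \<in> S then s else s') * real (d i))) = exp (s * ?A + s' * ?C)"
      by (rule exp_two_sums_eq_prod[OF S, symmetric])
    also have "(\<Prod>i<n. if i \<in> S then exp (- l) else exp (- l'))
        = exp (- (real (card S) * l) - real (n - card S) * l')"
      unfolding prod_split_powers[OF S] exp_of_nat_mult[symmetric] mult_exp_exp by simp
    finally have le: "pmf (Pi_pmf {..<n} 0 (\<lambda>i. if i \<in> S then \<nu> else \<nu>')) d
       \<le> pmf (iid n) d * exp (s * ?A + s' * ?C - real (card S) * l - real (n - card S) * l')"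
      by (simp add: mult_exp_exp algebra_simps)
    have "s * (?A - a) \<le> \<bar>s\<bar> * e" "s' * (?C - c) \<le> \<bar>s'\<bar> * e"
    proof -
      have "s * (?A - a) \<le> \<bar>s\<bar> * \<bar>?A - a\<bar>" by (metis abs_ge_self abs_mult)
      also have "\<dots> \<le> \<bar>s\<bar> * e" using d by (intro mult_left_mono) (auto simp: W_def degree_window_def)
      finally show "s * (?A - a) \<le> \<bar>s\<bar> * e" .
      have "s' * (?C - c) \<le> \<bar>s'\<bar> * \<bar>?C - c\<bar>" by (metis abs_ge_self abs_mult)
      also have "\<dots> \<le> \<bar>s'\<bar> * e" using d by (intro mult_left_mono) (auto simp: W_def degree_window_def)
      finally show "s' * (?C - c) \<le> \<bar>s'\<bar> * e" .
    qed
    then have ex: "?\<kappa> * exp (s * ?A + s' * ?C - real (card S) * l - real (n - card S) * l') \<le> 1"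
      unfolding mult_exp_exp exp_le_one_iff by (simp add: algebra_simps)
    have "?\<kappa> * pmf (Pi_pmf {..<n} 0 (\<lambda>i. if i \<in> S then \<nu> else \<nu>')) d
       \<le> ?\<kappa> * (pmf (iid n) d * exp (s * ?A + s' * ?C - real (card S) * l - real (n - card S) * l'))"
      by (intro mult_left_mono le) simp
    also have "\<dots> = pmf (iid n) d * (?\<kappa> * exp (s * ?A + s' * ?C - real (card S) * l - real (n - card S) * l'))"
      by (simp only: mult_ac)
    also have "\<dots> \<le> pmf (iid n) d * 1" by (intro mult_left_mono ex) simp
    finally show ?thesis by simp
  next
    case False
    then have "pmf (Pi_pmf {..<n} 0 (\<lambda>i. if i \<in> S then \<nu> else \<nu>')) d = 0"
      by (intro pmf_Pi_outside) auto
    then show ?thesis by simp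
  qed
qed simp

text \<open>
  With \<open>\<lfloor>\<tau> n\<rfloor>\<close> degrees tilted to mean \<open>y\<close> and the others to mean \<open>y'\<close>, the window is centred, up to
  bounded rounding errors, at the means of the two sums. By Chebyshev's inequality it has probability
  at least \<open>1 / 2\<close> under the tilted law, for large \<open>n\<close>.
\<close>

lemma prob_window_ge:
  assumes t: "tilts_to y \<nu> s l" "tilts_to y' \<nu>' s' l'" and \<tau>: "0 \<le> \<tau>" "\<tau> \<le> 1" and \<delta>: "\<delta> > 0"
  shows "\<forall>\<^sub>F n in sequentially. \<forall>S. S \<subseteq> {..<n} \<longrightarrow> card S = nat \<lfloor>\<tau> * real n\<rfloor> \<longrightarrow>
    exp (- real n * (s * (\<tau> * y) - \<tau> * l + (s' * ((1 - \<tau>) * y') - (1 - \<tau>) * l') + \<delta> * (\<bar>s\<bar> + \<bar>s'\<bar>))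
       - \<bar>l\<bar> - \<bar>l'\<bar>) / 2
    \<le> measure_pmf.prob (iid n)
       (degree_window n S (\<delta> * real n) (real n * (\<tau> * y)) (real n * ((1 - \<tau>) * y')))"
proof -
  define v where "v = measure_pmf.expectation \<nu> (\<lambda>k. (real k - y)\<^sup>2)"
  define v' where "v' = measure_pmf.expectation \<nu>' (\<lambda>k. (real k - y')\<^sup>2)"
  have v: "v \<ge> 0" "v' \<ge> 0" by (simp_all add: v_def v'_def)
  \<comment> \<open>Large enough for the rounding errors to be at most \<open>\<delta> n / 2\<close> and the Chebyshev bounds at most \<open>1 / 4\<close>.\<close>
  define N where "N = 1 + 2 * (\<bar>y\<bar> + \<bar>y'\<bar>) / \<delta> + 16 * (v + v') / \<delta>\<^sup>2"
  have N1: "N \<ge> 1" "N \<ge> 2 * \<bar>y\<bar> / \<delta>" "N \<ge> 2 * \<bar>y'\<bar> / \<delta>" "N \<ge> 16 * v / \<delta>\<^sup>2" "N \<ge> 16 * v' / \<delta>\<^sup>2"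
  proof -
    have "2 * \<bar>y\<bar> / \<delta> \<ge> 0" "2 * \<bar>y'\<bar> / \<delta> \<ge> 0" "16 * v / \<delta>\<^sup>2 \<ge> 0" "16 * v' / \<delta>\<^sup>2 \<ge> 0" using v \<delta> by auto
    then show "N \<ge> 1" "N \<ge> 2 * \<bar>y\<bar> / \<delta>" "N \<ge> 2 * \<bar>y'\<bar> / \<delta>" "N \<ge> 16 * v / \<delta>\<^sup>2" "N \<ge> 16 * v' / \<delta>\<^sup>2"
      unfolding N_def distrib_left add_divide_distrib by linarith+
  qed
  show ?thesis
  proof (rule eventually_sequentiallyI[of "nat \<lceil>N\<rceil>"], intro allI impI)
    fix n S assume "nat \<lceil>N\<rceil> \<le> n" and S: "S \<subseteq> {..<n}" and cS: "card S = nat \<lfloor>\<tau> * real n\<rfloor>"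
    then have nN: "real n \<ge> N" by linarith
    have n: "real n \<ge> 1" using nN N1 by linarith
    have big: "\<bar>y\<bar> \<le> \<delta> * real n / 2" "\<bar>y'\<bar> \<le> \<delta> * real n / 2" "16 * v \<le> \<delta>\<^sup>2 * real n" "16 * v' \<le> \<delta>\<^sup>2 * real n"
      using order_trans[OF N1(2) nN] order_trans[OF N1(3) nN] order_trans[OF N1(4) nN] order_trans[OF N1(5) nN] \<delta>
      by (simp_all add: pos_divide_le_eq mult_ac)
    define k where "k = card S"
    have kn: "k \<le> n" using card_mono[OF _ S] by (simp add: k_def)
    have k: "real k \<le> \<tau> * real n" "\<tau> * real n \<le> real k + 1"
      using \<tau>(1) unfolding k_def cS by (simp_all add: zero_le_mult_iff)
    have cC: "card ({..<n} - S) = n - k" using S finite_subset[OF S] by (simp add: card_Diff_subset k_def)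
    have near: "\<bar>real k * z - real n * (\<tau> * z)\<bar> \<le> \<bar>z\<bar>" "\<bar>real (n - k) * z - real n * ((1 - \<tau>) * z)\<bar> \<le> \<bar>z\<bar>" for z
    proof -
      have 1: "real k * z - real n * (\<tau> * z) = (real k - \<tau> * real n) * z"
        by (simp add: algebra_simps)
      have 2: "real (n - k) * z - real n * ((1 - \<tau>) * z) = - ((real k - \<tau> * real n) * z)"
        using kn by (simp add: of_nat_diff algebra_simps)
      have "\<bar>(real k - \<tau> * real n) * z\<bar> \<le> 1 * \<bar>z\<bar>"
        unfolding abs_mult using k by (intro mult_right_mono) auto
      then show "\<bar>real k * z - real n * (\<tau> * z)\<bar> \<le> \<bar>z\<bar>" "\<bar>real (n - k) * z - real n * ((1 - \<tau>) * z)\<bar> \<le> \<bar>z\<bar>"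
        unfolding 1 2 by simp_all
    qed
    define e where "e = \<delta> * real n / 2"
    have e: "e > 0" using \<delta> n by (simp add: e_def)
    let ?lb = "exp (- real n * (s * (\<tau> * y) - \<tau> * l + (s' * ((1 - \<tau>) * y') - (1 - \<tau>) * l') + \<delta> * (\<bar>s\<bar> + \<bar>s'\<bar>))
       - \<bar>l\<bar> - \<bar>l'\<bar>)"
    let ?p = "\<lambda>i. if i \<in> S then \<nu> else \<nu>'"
    let ?q = "Pi_pmf {..<n} 0 ?p"
    let ?W = "degree_window n S (\<delta> * real n) (real n * (\<tau> * y)) (real n * ((1 - \<tau>) * y'))"
    let ?X = "{d. e \<le> \<bar>real (\<Sum>i\<in>S. d i) - real (card S) * y\<bar>}"
    let ?Y = "{d. e \<le> \<bar>real (\<Sum>i\<in>{..<n} - S. d i) - real (card ({..<n} - S)) * y'\<bar>}"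
    have quarter: "m * u / e\<^sup>2 \<le> 1 / 4" if "0 \<le> m" "m \<le> real n" "16 * u \<le> \<delta>\<^sup>2 * real n" "u \<ge> 0" for m u
    proof -
      have "m * u \<le> real n * (\<delta>\<^sup>2 * real n / 16)" using that by (intro mult_mono) auto
      also have "\<dots> = e\<^sup>2 / 4" by (simp add: e_def power2_eq_square)
      finally show ?thesis using e by (simp add: pos_divide_le_eq)
    qed
    have X: "measure_pmf.prob ?q ?X \<le> 1 / 4"
    proof -
      have "measure_pmf.prob ?q ?X \<le> real (card S) * v / e\<^sup>2"
        by (rule prob_sum_Pi_pmf_deviation) (use S t e in \<open>auto simp: tilts_to_def v_def\<close>)
      also have "\<dots> \<le> 1 / 4" using kn big v by (intro quarter) (auto simp: k_def)
      finally show ?thesis .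
    qed
    have Y: "measure_pmf.prob ?q ?Y \<le> 1 / 4"
    proof -
      have "measure_pmf.prob ?q ?Y \<le> real (card ({..<n} - S)) * v' / e\<^sup>2"
        by (rule prob_sum_Pi_pmf_deviation) (use S t e in \<open>auto simp: tilts_to_def v'_def\<close>)
      also have "\<dots> \<le> 1 / 4" using big v by (intro quarter) (auto simp: cC)
      finally show ?thesis .
    qed
    have "- ?W \<subseteq> ?X \<union> ?Y"
    proof
      fix d assume d: "d \<in> - ?W"
      show "d \<in> ?X \<union> ?Y"
      proof (rule ccontr)
        assume no: "d \<notin> ?X \<union> ?Y"
        have "\<bar>real (\<Sum>i\<in>S. d i) - real n * (\<tau> * y)\<bar> \<le> \<delta> * real n"
          using no near(1)[of y] big(1) unfolding e_def k_def Un_iff mem_Collect_eq by linarith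
        moreover have "\<bar>real (\<Sum>i\<in>{..<n} - S. d i) - real n * ((1 - \<tau>) * y')\<bar> \<le> \<delta> * real n"
          using no near(2)[of y'] big(2) unfolding e_def cC Un_iff mem_Collect_eq by linarith
        ultimately show False using d by (simp add: degree_window_def)
      qed
    qed
    then have "measure_pmf.prob ?q (- ?W) \<le> measure_pmf.prob ?q (?X \<union> ?Y)"
      by (intro measure_pmf.finite_measure_mono) auto
    also have "\<dots> \<le> measure_pmf.prob ?q ?X + measure_pmf.prob ?q ?Y"
      by (intro measure_Un_le) auto
    finally have "measure_pmf.prob ?q (- ?W) \<le> 1 / 2" using X Y by linarith
    moreover have "measure_pmf.prob ?q (- ?W) = 1 - measure_pmf.prob ?q ?W"
      using measure_pmf.prob_compl[of ?W ?q] by (simp add: Compl_eq_Diff_UNIV)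
    ultimately have half: "measure_pmf.prob ?q ?W \<ge> 1 / 2" by linarith
    have "?lb * (1 / 2)
      \<le> exp (real (card S) * l + real (n - card S) * l' - s * (real n * (\<tau> * y)) - s' * (real n * ((1 - \<tau>) * y'))
          - (\<delta> * real n) * (\<bar>s\<bar> + \<bar>s'\<bar>)) * measure_pmf.prob ?q ?W"
    proof (intro mult_mono half)
      have "real (card S) * l \<ge> real n * (\<tau> * l) - \<bar>l\<bar>" "real (n - card S) * l' \<ge> real n * ((1 - \<tau>) * l') - \<bar>l'\<bar>"
        using near(1)[of l] near(2)[of l'] unfolding k_def by linarith+
      then show "?lb \<le> exp (real (card S) * l + real (n - card S) * l' - s * (real n * (\<tau> * y)) - s' * (real n * ((1 - \<tau>) * y'))
          - (\<delta> * real n) * (\<bar>s\<bar> + \<bar>s'\<bar>))"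
        unfolding exp_le_cancel_iff by (simp add: algebra_simps)
    qed auto
    also have "\<dots> \<le> measure_pmf.prob (iid n) ?W"
      by (rule prob_window_ge_tilted[OF S t])
    finally show "?lb / 2 \<le> measure_pmf.prob (iid n) ?W" by simp
  qed
qed

end

section \<open>The expected partition function\<close>

definition half_edges_in :: "nat set \<Rightarrow> nat \<Rightarrow> (nat \<Rightarrow> nat) \<Rightarrow> (nat \<times> nat) set" where
  "half_edges_in S n d = {h \<in> half_edges n d. fst h \<in> S}"

lemma finite_half_edges: "finite (half_edges n d)"
  by (auto simp: half_edges_def)

lemma card_half_edges_in:
  assumes "S \<subseteq> {..<n}"
  shows "card (half_edges_in S n d) = (\<Sum>i\<in>S. d i)"
proof -
  have "half_edges_in S n d = (SIGMA i:S. {..<d i})"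
    using assms by (auto simp: half_edges_in_def half_edges_def)
  then show ?thesis using finite_subset[OF assms finite_lessThan] by simp
qed

lemma card_half_edges_outside:
  assumes "S \<subseteq> {..<n}"
  shows "card (half_edges n d - half_edges_in S n d) = (\<Sum>i\<in>{..<n} - S. d i)"
proof -
  have "half_edges n d - half_edges_in S n d = half_edges_in ({..<n} - S) n d"
    by (auto simp: half_edges_in_def half_edges_def)
  then show ?thesis using card_half_edges_in[of "{..<n} - S" n d] by simp
qed

lemma card_perfect_matching:
  assumes "finite H" "M \<in> perfect_matchings H"
  shows "2 * card M = card H"
proof -
  have M: "partition_on H M" "\<forall>e\<in>M. card e = 2" using assms(2) by (auto simp: perfect_matchings_def)
  have "card (\<Union>M) = (\<Sum>e\<in>M. card e)"
    by (rule card_Union_disjoint)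
      (use M in \<open>auto simp: partition_on_def disjoint_def pairwise_def disjnt_def intro!: card_ge_0_finite\<close>)
  then show ?thesis using M by (simp add: partition_on_def)
qed

text \<open>
  A pair of half-edges contributes the product of the spins of its ends, which is \<open>1\<close>, or \<open>- 1\<close> if the
  pair crosses. The left-hand side groups the pairs by their end vertices.
\<close>

lemma ising_energy_eq:
  fixes \<sigma> :: "nat \<Rightarrow> real"
  assumes M: "M \<in> perfect_matchings (half_edges n d)" and S: "S \<subseteq> {..<n}"
    and \<sigma>: "\<And>i. i < n \<Longrightarrow> \<sigma> i = (if i \<in> S then 1 else - 1)"
  shows "(\<Sum>j<n. \<Sum>i\<le>j. real (edge_count M i j) * \<sigma> i * \<sigma> j)
    = real (\<Sum>i<n. d i) / 2 - 2 * real (card (crossing_edges (half_edges_in S n d) M))"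
proof -
  have fM: "finite M" using finite_perfect_matching[OF finite_half_edges M] .
  define T where "T = (SIGMA j:{..<n}. {..j})"
  have fT: "finite T" by (simp add: T_def)
  have edge: "(\<Sum>(j, i)\<in>T. if fst ` e = {i, j} then \<sigma> i * \<sigma> j else 0)
      = 1 - 2 * (if card (e \<inter> half_edges_in S n d) = 1 then 1 else 0)" if e: "e \<in> M" for e
  proof -
    have "card e = 2" "e \<subseteq> half_edges n d"
      using M e by (auto simp: perfect_matchings_def partition_on_def)
    then obtain x y where xy: "e = {x, y}" "x \<noteq> y" "x \<in> half_edges n d" "y \<in> half_edges n d"
      by (metis card_2_iff insert_subset)
    define u v where "u = fst x" and "v = fst y"
    have uv: "u < n" "v < n" using xy by (auto simp: u_def v_def half_edges_def)
    have img: "fst ` e = {u, v}" using xy by (simp add: u_def v_def)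
    have "(\<Sum>(j, i)\<in>T. if fst ` e = {i, j} then \<sigma> i * \<sigma> j else 0)
        = (\<Sum>p\<in>{(max u v, min u v)}. case p of (j, i) \<Rightarrow> if fst ` e = {i, j} then \<sigma> i * \<sigma> j else 0)"
    proof (rule sum.mono_neutral_right[OF fT])
      show "{(max u v, min u v)} \<subseteq> T" using uv by (auto simp: T_def)
      show "\<forall>p\<in>T - {(max u v, min u v)}. (case p of (j, i) \<Rightarrow> if fst ` e = {i, j} then \<sigma> i * \<sigma> j else 0) = 0"
        unfolding img by (auto simp: T_def doubleton_eq_iff max_def min_def split: if_splits)
    qed
    also have "\<dots> = \<sigma> u * \<sigma> v"
      unfolding img by (auto simp: max_def min_def insert_commute mult.commute)
    also have "\<dots> = 1 - 2 * (if card (e \<inter> half_edges_in S n d) = 1 then 1 else 0)"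
    proof -
      have xin: "x \<in> half_edges_in S n d \<longleftrightarrow> u \<in> S" and yin: "y \<in> half_edges_in S n d \<longleftrightarrow> v \<in> S"
        using xy by (auto simp: half_edges_in_def u_def v_def)
      show ?thesis unfolding xy(1) \<sigma>[OF uv(1)] \<sigma>[OF uv(2)]
        using xin yin xy(2) by (cases "u \<in> S"; cases "v \<in> S") (simp_all add: Int_insert_left)
    qed
    finally show ?thesis .
  qed
  have "(\<Sum>j<n. \<Sum>i\<le>j. real (edge_count M i j) * \<sigma> i * \<sigma> j)
      = (\<Sum>(j, i)\<in>T. real (edge_count M i j) * \<sigma> i * \<sigma> j)"
    unfolding T_def by (rule sum.Sigma) auto
  also have "\<dots> = (\<Sum>(j, i)\<in>T. \<Sum>e\<in>M. if fst ` e = {i, j} then \<sigma> i * \<sigma> j else 0)"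
  proof (intro sum.cong refl, clarify)
    fix j i
    have "(\<Sum>e\<in>M. if fst ` e = {i, j} then \<sigma> i * \<sigma> j else 0)
       = (\<Sum>e\<in>{e \<in> M. fst ` e = {i, j}}. \<sigma> i * \<sigma> j)"
      by (rule sum.inter_filter[symmetric, OF fM])
    then show "real (edge_count M i j) * \<sigma> i * \<sigma> j = (\<Sum>e\<in>M. if fst ` e = {i, j} then \<sigma> i * \<sigma> j else 0)"
      by (simp add: edge_count_def)
  qed
  also have "\<dots> = (\<Sum>e\<in>M. \<Sum>(j, i)\<in>T. if fst ` e = {i, j} then \<sigma> i * \<sigma> j else 0)"
    unfolding case_prod_unfold by (rule sum.swap)
  also have "\<dots> = (\<Sum>e\<in>M. 1 - 2 * (if card (e \<inter> half_edges_in S n d) = 1 then 1 else 0))"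
    by (intro sum.cong refl edge)
  also have "\<dots> = real (card M) - 2 * real (card (crossing_edges (half_edges_in S n d) M))"
    using fM by (simp add: sum_subtractf sum_distrib_left[symmetric] crossing_edges_def sum.inter_filter[symmetric])
  also have "real (card M) = real (\<Sum>i<n. d i) / 2"
    using card_perfect_matching[OF finite_half_edges M] by (simp add: half_edges_def field_simps flip: of_nat_sum)
  finally show ?thesis .
qed

lemma sum_spins_eq_sum_subsets:
  fixes g :: "(nat \<Rightarrow> real) \<Rightarrow> real"
  shows "(\<Sum>\<sigma>\<in>{..<n} \<rightarrow>\<^sub>E {-1, 1}. g \<sigma>)
    = (\<Sum>S\<in>Pow {..<n}. g (\<lambda>i\<in>{..<n}. if i \<in> S then 1 else - 1))"
proof (rule sum.reindex_bij_witness[where i = "\<lambda>S. \<lambda>i\<in>{..<n}. if i \<in> S then 1 else - 1"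
      and j = "\<lambda>\<sigma>. {i \<in> {..<n}. \<sigma> i = 1}"])
  fix \<sigma> :: "nat \<Rightarrow> real" assume \<sigma>: "\<sigma> \<in> {..<n} \<rightarrow>\<^sub>E {-1, 1}"
  show eq: "(\<lambda>i\<in>{..<n}. if i \<in> {i \<in> {..<n}. \<sigma> i = 1} then 1 else - 1) = \<sigma>"
  proof
    fix i show "(\<lambda>i\<in>{..<n}. if i \<in> {i \<in> {..<n}. \<sigma> i = 1} then 1 else - 1) i = \<sigma> i"
      using \<sigma> by (cases "i < n") (auto simp: PiE_def extensional_def Pi_def)
  qed
  show "g (\<lambda>i\<in>{..<n}. if i \<in> {i \<in> {..<n}. \<sigma> i = 1} then 1 else - 1) = g \<sigma>" unfolding eq ..
qed auto

text \<open>
  The mean of the interaction part of the Boltzmann factor over a uniform pairing.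
\<close>

definition pairing_weight :: "real \<Rightarrow> nat \<Rightarrow> nat \<Rightarrow> real" where
  "pairing_weight \<beta> a c = exp (\<beta> * (real (a + c) / 2)) *
     (crossing_poly (exp (- 2 * \<beta>)) a c / crossing_poly 1 a c)"

lemma partition_function_eq:
  assumes M: "M \<in> perfect_matchings (half_edges n d)"
  shows "partition_function \<beta> B n M = (\<Sum>S\<in>Pow {..<n}. exp (B * (2 * real (card S) - real n)) *
     (exp (\<beta> * (real (\<Sum>i<n. d i) / 2)) *
       exp (- 2 * \<beta>) ^ card (crossing_edges (half_edges_in S n d) M)))"
  unfolding partition_function_def sum_spins_eq_sum_subsets
proof (intro sum.cong refl)
  fix S assume "S \<in> Pow {..<n}"
  then have S: "S \<subseteq> {..<n}" by simp
  let ?\<sigma> = "\<lambda>i\<in>{..<n}. if i \<in> S then 1 else - 1 :: real"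
  let ?k = "card (crossing_edges (half_edges_in S n d) M)"
  have 1: "(\<Sum>j<n. \<Sum>i\<le>j. real (edge_count M i j) * ?\<sigma> i * ?\<sigma> j) = real (\<Sum>i<n. d i) / 2 - 2 * real ?k"
    by (rule ising_energy_eq[OF M S]) simp
  have "(\<Sum>i<n. ?\<sigma> i) = (\<Sum>i\<in>{..<n} - S. - 1) + (\<Sum>i\<in>S. 1)"
    by (subst sum.subset_diff[OF S]) (use S in \<open>auto intro!: arg_cong2[where f = "(+)"] sum.cong simp: subset_iff\<close>)
  also have "\<dots> = 2 * real (card S) - real n"
    using S card_mono[OF _ S] finite_subset[OF S finite_lessThan] by (simp add: card_Diff_subset of_nat_diff)
  finally have 2: "(\<Sum>i<n. ?\<sigma> i) = 2 * real (card S) - real n" .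
  show "exp (\<beta> * (\<Sum>j<n. \<Sum>i\<le>j. real (edge_count M i j) * ?\<sigma> i * ?\<sigma> j) + B * (\<Sum>i<n. ?\<sigma> i))
     = exp (B * (2 * real (card S) - real n)) * (exp (\<beta> * (real (\<Sum>i<n. d i) / 2)) * exp (- 2 * \<beta>) ^ ?k)"
    unfolding 1 2 exp_of_nat_mult[symmetric] mult_exp_exp by (simp add: algebra_simps)
qed

lemma sum_partition_function_matchings:
  assumes even: "even (\<Sum>i<n. d i)"
  defines "H \<equiv> half_edges n d"
  shows "perfect_matchings H \<noteq> {}"
    and "(\<Sum>M\<in>perfect_matchings H. partition_function \<beta> B n M) / real (card (perfect_matchings H))
      = (\<Sum>S\<in>Pow {..<n}. exp (B * (2 * real (card S) - real n)) *
          pairing_weight \<beta> (\<Sum>i\<in>S. d i) (\<Sum>i\<in>{..<n} - S. d i))"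
proof -
  have split: "(\<Sum>i\<in>S. d i) + (\<Sum>i\<in>{..<n} - S. d i) = (\<Sum>i<n. d i)" if "S \<subseteq> {..<n}" for S
    using sum.subset_diff[OF that, of d] by simp
  have weight: "matching_weight \<rho> H (half_edges_in S n d)
      = crossing_poly \<rho> (\<Sum>i\<in>S. d i) (\<Sum>i\<in>{..<n} - S. d i)" if "S \<subseteq> {..<n}" for S \<rho>
    using matching_weight_eq_poly[of H "half_edges_in S n d" \<rho>] card_half_edges_in[OF that]
      card_half_edges_outside[OF that] finite_half_edges
    by (auto simp: H_def half_edges_in_def)
  have one: "real (card (perfect_matchings H)) = crossing_poly 1 (\<Sum>i\<in>S. d i) (\<Sum>i\<in>{..<n} - S. d i)"
    if "S \<subseteq> {..<n}" for S
    using weight[OF that, of 1] by (simp add: matching_weight_def)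
  have "crossing_poly 1 (\<Sum>i\<in>{}. d i) (\<Sum>i\<in>{..<n} - {}. d i) > 0"
    using even by (intro crossing_poly_pos) auto
  then have "real (card (perfect_matchings H)) > 0" unfolding one[OF empty_subsetI, symmetric] .
  then show "perfect_matchings H \<noteq> {}" by auto
  have "(\<Sum>M\<in>perfect_matchings H. partition_function \<beta> B n M)
     = (\<Sum>M\<in>perfect_matchings H. \<Sum>S\<in>Pow {..<n}. exp (B * (2 * real (card S) - real n)) *
         (exp (\<beta> * (real (\<Sum>i<n. d i) / 2)) * exp (- 2 * \<beta>) ^ card (crossing_edges (half_edges_in S n d) M)))"
    by (intro sum.cong refl partition_function_eq) (simp add: H_def)
  also have "\<dots> = (\<Sum>S\<in>Pow {..<n}. exp (B * (2 * real (card S) - real n)) *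
         (exp (\<beta> * (real (\<Sum>i<n. d i) / 2)) * matching_weight (exp (- 2 * \<beta>)) H (half_edges_in S n d)))"
    by (subst sum.swap) (simp add: matching_weight_def sum_distrib_left)
  finally have "(\<Sum>M\<in>perfect_matchings H. partition_function \<beta> B n M) / real (card (perfect_matchings H))
     = (\<Sum>S\<in>Pow {..<n}. exp (B * (2 * real (card S) - real n)) *
         (exp (\<beta> * (real (\<Sum>i<n. d i) / 2)) * matching_weight (exp (- 2 * \<beta>)) H (half_edges_in S n d))
         / real (card (perfect_matchings H)))"
    by (simp only: sum_divide_distrib)
  also have "\<dots> = (\<Sum>S\<in>Pow {..<n}. exp (B * (2 * real (card S) - real n)) *
          pairing_weight \<beta> (\<Sum>i\<in>S. d i) (\<Sum>i\<in>{..<n} - S. d i))"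
  proof (intro sum.cong refl)
    fix S assume "S \<in> Pow {..<n}"
    then have S: "S \<subseteq> {..<n}" by simp
    show "exp (B * (2 * real (card S) - real n)) *
         (exp (\<beta> * (real (\<Sum>i<n. d i) / 2)) * matching_weight (exp (- 2 * \<beta>)) H (half_edges_in S n d))
         / real (card (perfect_matchings H))
      = exp (B * (2 * real (card S) - real n)) * pairing_weight \<beta> (\<Sum>i\<in>S. d i) (\<Sum>i\<in>{..<n} - S. d i)"
      unfolding pairing_weight_def weight[OF S] one[OF S] split[OF S] by simp
  qed
  finally show "(\<Sum>M\<in>perfect_matchings H. partition_function \<beta> B n M) / real (card (perfect_matchings H))
      = (\<Sum>S\<in>Pow {..<n}. exp (B * (2 * real (card S) - real n)) *
          pairing_weight \<beta> (\<Sum>i\<in>S. d i) (\<Sum>i\<in>{..<n} - S. d i))" .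
qed

lemma pairing_weight_nonneg: "pairing_weight \<beta> a c \<ge> 0"
  unfolding pairing_weight_def by (intro mult_nonneg_nonneg divide_nonneg_nonneg crossing_poly_nonneg) auto

lemma pairing_weight_le:
  assumes "\<beta> \<ge> 0"
  shows "pairing_weight \<beta> a c \<le> exp (\<beta> * (real (a + c) / 2))"
proof -
  have "crossing_poly (exp (- 2 * \<beta>)) a c / crossing_poly 1 a c \<le> 1"
    using crossing_poly_le_one[of "exp (- 2 * \<beta>)" a c] crossing_poly_nonneg[of 1 a c] assms
    by (cases "crossing_poly 1 a c = 0") auto
  then have "exp (\<beta> * (real (a + c) / 2)) * (crossing_poly (exp (- 2 * \<beta>)) a c / crossing_poly 1 a c)
    \<le> exp (\<beta> * (real (a + c) / 2)) * 1" by (intro mult_left_mono) auto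
  then show ?thesis by (simp add: pairing_weight_def)
qed

lemma sum_adjusted_degrees:
  assumes "finite S"
  shows "(\<Sum>i\<in>S. adjusted_degrees r n d i)
    = (\<Sum>i\<in>S. d i) + (if odd (\<Sum>i<n. d i) \<and> r n d \<in> S then 1 else 0)"
proof (cases "odd (\<Sum>i<n. d i) \<and> r n d \<in> S")
  case True
  then have "(\<Sum>i\<in>S. adjusted_degrees r n d i)
      = adjusted_degrees r n d (r n d) + (\<Sum>i\<in>S - {r n d}. adjusted_degrees r n d i)"
    using assms by (subst sum.remove) auto
  also have "\<dots> = d (r n d) + 1 + (\<Sum>i\<in>S - {r n d}. d i)"
    using True by (auto simp: adjusted_degrees_def intro!: sum.cong)
  also have "\<dots> = (\<Sum>i\<in>S. d i) + 1" using True assms by (subst (2) sum.remove) auto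
  finally show ?thesis using True by simp
next
  case False
  have "adjusted_degrees r n d i = d i" if "i \<in> S" for i
    using False that by (auto simp: adjusted_degrees_def)
  then show ?thesis using False by simp
qed

lemma even_sum_adjusted_degrees:
  assumes "r n d < n"
  shows "even (\<Sum>i<n. adjusted_degrees r n d i)"
  using sum_adjusted_degrees[of "{..<n}" r n d] assms by simp

text \<open>
  The first term of \<open>G_edge\<close>, with \<open>c = b - a\<close>.
\<close>

definition edge_energy :: "real \<Rightarrow> real \<Rightarrow> real \<Rightarrow> real" where
  "edge_energy \<beta> a c = (a + c) * (\<beta> / 2 + F_edge \<beta> (a / (a + c)))"

lemma edge_energy_eq: "edge_energy \<beta> a c = \<beta> * ((a + c) / 2) + pairing_exponent \<beta> a c"
  by (simp add: edge_energy_def pairing_exponent_def algebra_simps)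

lemma edge_energy_scale:
  "n \<noteq> 0 \<Longrightarrow> edge_energy \<beta> (n * a) (n * c) = n * edge_energy \<beta> a c"
  using pairing_exponent_scale[of n \<beta> a c] by (simp add: edge_energy_eq field_simps)

lemma edge_energy_Lipschitz:
  assumes "\<beta> \<ge> 0"
  obtains L where "L \<ge> 0" "\<And>a c a' c'. \<lbrakk>0 \<le> a; 0 \<le> c; 0 \<le> a'; 0 \<le> c'\<rbrakk> \<Longrightarrow>
    \<bar>edge_energy \<beta> a c - edge_energy \<beta> a' c'\<bar> \<le> L * (\<bar>a - a'\<bar> + \<bar>c - c'\<bar>)"
proof -
  obtain L where L: "L \<ge> 0" "\<And>a c a' c'. \<lbrakk>0 \<le> a; 0 \<le> c; 0 \<le> a'; 0 \<le> c'\<rbrakk> \<Longrightarrow>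
    \<bar>pairing_exponent \<beta> a c - pairing_exponent \<beta> a' c'\<bar> \<le> L * (\<bar>a - a'\<bar> + \<bar>c - c'\<bar>)"
    using pairing_exponent_Lipschitz[OF assms] by blast
  have "\<bar>edge_energy \<beta> a c - edge_energy \<beta> a' c'\<bar> \<le> (\<beta> / 2 + L) * (\<bar>a - a'\<bar> + \<bar>c - c'\<bar>)"
    if "0 \<le> a" "0 \<le> c" "0 \<le> a'" "0 \<le> c'" for a c a' c'
  proof -
    have "edge_energy \<beta> a c - edge_energy \<beta> a' c'
        = \<beta> / 2 * ((a - a') + (c - c')) + (pairing_exponent \<beta> a c - pairing_exponent \<beta> a' c')"
      by (simp add: edge_energy_eq algebra_simps)
    also have "\<bar>\<dots>\<bar> \<le> \<beta> / 2 * (\<bar>a - a'\<bar> + \<bar>c - c'\<bar>) + L * (\<bar>a - a'\<bar> + \<bar>c - c'\<bar>)"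
    proof (rule order_trans[OF abs_triangle_ineq add_mono])
      have "\<beta> / 2 * \<bar>(a - a') + (c - c')\<bar> \<le> \<beta> / 2 * (\<bar>a - a'\<bar> + \<bar>c - c'\<bar>)"
        using assms by (intro mult_left_mono abs_triangle_ineq) auto
      then show "\<bar>\<beta> / 2 * ((a - a') + (c - c'))\<bar> \<le> \<beta> / 2 * (\<bar>a - a'\<bar> + \<bar>c - c'\<bar>)"
        using assms by (simp add: abs_mult)
    qed (use L(2) that in blast)
    finally show ?thesis by (simp add: distrib_right)
  qed
  then show ?thesis using that[of "\<beta> / 2 + L"] L(1) assms by simp
qed

abbreviation adjusted_weight :: "real \<Rightarrow> (nat \<Rightarrow> (nat \<Rightarrow> nat) \<Rightarrow> nat) \<Rightarrow> nat \<Rightarrow> nat set \<Rightarrow> (nat \<Rightarrow> nat) \<Rightarrow> real" where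
  "adjusted_weight \<beta> r n S d \<equiv>
     pairing_weight \<beta> (\<Sum>i\<in>S. adjusted_degrees r n d i) (\<Sum>i\<in>{..<n} - S. adjusted_degrees r n d i)"

definition adjusted_error :: "real \<Rightarrow> real \<Rightarrow> bool" where
  "adjusted_error \<beta> C \<longleftrightarrow> 0 \<le> C \<and> (\<forall>r n d S. r n d < n \<longrightarrow> S \<subseteq> {..<n} \<longrightarrow>
     (\<exists>\<Delta>. adjusted_weight \<beta> r n S d
        = exp (edge_energy \<beta> (real (\<Sum>i\<in>S. d i)) (real (\<Sum>i\<in>{..<n} - S. d i)) + \<Delta>) \<and>
      \<bar>\<Delta>\<bar> \<le> C * sqrt (real (\<Sum>i<n. d i) + 1)))"

text \<open>
  Adding one half-edge moves the two counts by at most one in total, which the Lipschitz bound absorbs.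
  So the estimate is uniform in the rule \<open>r\<close>.
\<close>

lemma adjusted_weight_asymp:
  assumes "\<beta> \<ge> 0"
  obtains C where "adjusted_error \<beta> C"
proof -
  obtain C where C: "C \<ge> 0" "\<And>a c. even (a + c) \<Longrightarrow>
    \<bar>ln (crossing_poly (exp (-2 * \<beta>)) a c / crossing_poly 1 a c)
       - pairing_exponent \<beta> (real a) (real c)\<bar> \<le> C * sqrt (real (a + c) + 1)"
    using crossing_poly_asymp[OF assms] by blast
  obtain L where L: "L \<ge> 0" "\<And>a c a' c'. \<lbrakk>0 \<le> a; 0 \<le> c; 0 \<le> a'; 0 \<le> c'\<rbrakk> \<Longrightarrow>
    \<bar>edge_energy \<beta> a c - edge_energy \<beta> a' c'\<bar> \<le> L * (\<bar>a - a'\<bar> + \<bar>c - c'\<bar>)"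
    using edge_energy_Lipschitz[OF assms] by blast
  have "\<exists>\<Delta>. adjusted_weight \<beta> r n S d
       = exp (edge_energy \<beta> (real (\<Sum>i\<in>S. d i)) (real (\<Sum>i\<in>{..<n} - S. d i)) + \<Delta>) \<and>
      \<bar>\<Delta>\<bar> \<le> (2 * C + L) * sqrt (real (\<Sum>i<n. d i) + 1)" if r: "r n d < n" and S: "S \<subseteq> {..<n}" for r n d S
  proof -
    define a where "a = (\<Sum>i\<in>S. d i)"
    define c where "c = (\<Sum>i\<in>{..<n} - S. d i)"
    define a' where "a' = (\<Sum>i\<in>S. adjusted_degrees r n d i)"
    define c' where "c' = (\<Sum>i\<in>{..<n} - S. adjusted_degrees r n d i)"
    have fin: "finite S" "finite ({..<n} - S)" using finite_subset[OF S] by auto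
    have m: "a + c = (\<Sum>i<n. d i)" "a' + c' = (\<Sum>i<n. adjusted_degrees r n d i)"
      using sum.subset_diff[OF S, of d] sum.subset_diff[OF S, of "adjusted_degrees r n d"]
      by (simp_all add: a_def c_def a'_def c'_def)
    have ev: "even (a' + c')" unfolding m(2) by (rule even_sum_adjusted_degrees[of r n d, OF r])
    have ac: "\<bar>real a' - real a\<bar> + \<bar>real c' - real c\<bar> \<le> 1" "a' + c' \<le> a + c + 1"
    proof -
      define x where "x = (if odd (\<Sum>i<n. d i) \<and> r n d \<in> S then 1 else 0 :: nat)"
      define z where "z = (if odd (\<Sum>i<n. d i) \<and> r n d \<in> {..<n} - S then 1 else 0 :: nat)"
      have "a' = a + x" "c' = c + z"
        using sum_adjusted_degrees[OF fin(1), of r n d] sum_adjusted_degrees[OF fin(2), of r n d]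
        by (simp_all only: a'_def c'_def a_def c_def x_def z_def)
      moreover have "x + z \<le> 1" by (simp add: x_def z_def)
      ultimately show "\<bar>real a' - real a\<bar> + \<bar>real c' - real c\<bar> \<le> 1" "a' + c' \<le> a + c + 1"
        by auto
    qed
    define g where "g = crossing_poly (exp (-2 * \<beta>)) a' c' / crossing_poly 1 a' c'"
    have g: "g > 0" unfolding g_def using ev by (intro divide_pos_pos crossing_poly_pos) auto
    define \<Delta> where "\<Delta> = ln g + \<beta> * (real (a' + c') / 2) - edge_energy \<beta> (real a) (real c)"
    have "pairing_weight \<beta> a' c' = exp (\<beta> * (real (a' + c') / 2)) * exp (ln g)"
      using g by (simp add: pairing_weight_def g_def)
    then have eq: "pairing_weight \<beta> a' c' = exp (edge_energy \<beta> (real a) (real c) + \<Delta>)"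
      by (simp add: \<Delta>_def mult_exp_exp add.commute)
    have "\<bar>ln g - pairing_exponent \<beta> (real a') (real c')\<bar> \<le> C * sqrt (real (a' + c') + 1)"
      unfolding g_def by (rule C(2)[OF ev])
    also have "\<dots> \<le> C * (2 * sqrt (real (a + c) + 1))"
    proof (rule mult_left_mono[OF _ C(1)])
      have "sqrt (real (a' + c') + 1) \<le> sqrt (2\<^sup>2 * (real (a + c) + 1))"
      proof (rule real_sqrt_le_mono)
        have "real (a' + c') \<le> real (a + c) + 1" using ac(2) by linarith
        then show "real (a' + c') + 1 \<le> 2\<^sup>2 * (real (a + c) + 1)" by simp
      qed
      then show "sqrt (real (a' + c') + 1) \<le> 2 * sqrt (real (a + c) + 1)"
        by (simp only: real_sqrt_mult real_sqrt_abs abs_numeral)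
    qed
    finally have 1: "\<bar>ln g - pairing_exponent \<beta> (real a') (real c')\<bar> \<le> C * (2 * sqrt (real (a + c) + 1))" .
    have "\<bar>edge_energy \<beta> (real a') (real c') - edge_energy \<beta> (real a) (real c)\<bar>
      \<le> L * (\<bar>real a' - real a\<bar> + \<bar>real c' - real c\<bar>)" by (rule L(2)) auto
    also have "\<dots> \<le> L * sqrt (real (a + c) + 1)"
      using ac(1) L(1) by (intro mult_left_mono order_trans[OF ac(1)]) auto
    finally have 2: "\<bar>edge_energy \<beta> (real a') (real c') - edge_energy \<beta> (real a) (real c)\<bar> \<le> L * sqrt (real (a + c) + 1)" .
    have "\<Delta> = (ln g - pairing_exponent \<beta> (real a') (real c'))
        + (edge_energy \<beta> (real a') (real c') - edge_energy \<beta> (real a) (real c))"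
      by (simp add: \<Delta>_def edge_energy_eq)
    then have "\<bar>\<Delta>\<bar> \<le> (2 * C + L) * sqrt (real (a + c) + 1)"
      using 1 2 by (simp add: distrib_right)
    then have \<Delta>: "\<bar>\<Delta>\<bar> \<le> (2 * C + L) * sqrt (real (\<Sum>i<n. d i) + 1)" unfolding m(1) .
    show ?thesis using eq \<Delta> unfolding a'_def c'_def a_def c_def by (intro exI[of _ \<Delta>] conjI)
  qed
  then show ?thesis using that[of "2 * C + L"] C(1) L(1) unfolding adjusted_error_def by simp
qed

context exp_moments
begin

text \<open>
  The contribution of the configurations whose set of spins \<open>1\<close> is \<open>S\<close>, without the external field.
\<close>

definition plus_set_weight :: "(nat \<Rightarrow> (nat \<Rightarrow> nat) \<Rightarrow> nat) \<Rightarrow> real \<Rightarrow> nat \<Rightarrow> nat set \<Rightarrow> real" where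
  "plus_set_weight r \<beta> n S = measure_pmf.expectation (iid n) (\<lambda>d.
     adjusted_weight \<beta> r n S d)"

lemma adjusted_weight_le:
  assumes "\<beta> \<ge> 0" "S \<subseteq> {..<n}"
  shows "adjusted_weight \<beta> r n S d
    \<le> exp (\<beta> / 2) * exp (\<beta> / 2 * real (\<Sum>i\<in>S. d i) + \<beta> / 2 * real (\<Sum>i\<in>{..<n} - S. d i))"
proof -
  let ?a = "\<Sum>i\<in>S. adjusted_degrees r n d i" and ?c = "\<Sum>i\<in>{..<n} - S. adjusted_degrees r n d i"
  have fin: "finite S" "finite ({..<n} - S)" using finite_subset[OF assms(2)] by auto
  have "?a + ?c \<le> (\<Sum>i\<in>S. d i) + (\<Sum>i\<in>{..<n} - S. d i) + 1"
    unfolding sum_adjusted_degrees[OF fin(1)] sum_adjusted_degrees[OF fin(2)] by auto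
  then have "real (?a + ?c) \<le> real (\<Sum>i\<in>S. d i) + real (\<Sum>i\<in>{..<n} - S. d i) + 1" by linarith
  then have "\<beta> / 2 * real (?a + ?c) \<le> \<beta> / 2 * (real (\<Sum>i\<in>S. d i) + real (\<Sum>i\<in>{..<n} - S. d i) + 1)"
    using assms(1) by (intro mult_left_mono) auto
  then have "exp (\<beta> * (real (?a + ?c) / 2))
     \<le> exp (\<beta> / 2 + (\<beta> / 2 * real (\<Sum>i\<in>S. d i) + \<beta> / 2 * real (\<Sum>i\<in>{..<n} - S. d i)))"
    unfolding exp_le_cancel_iff by argo
  then show ?thesis using pairing_weight_le[OF assms(1), of ?a ?c] unfolding mult_exp_exp by linarith
qed

lemma integrable_adjusted_weight:
  assumes "\<beta> \<ge> 0" "S \<subseteq> {..<n}"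
  shows "integrable (measure_pmf (iid n)) (\<lambda>d.
     adjusted_weight \<beta> r n S d)"
proof (rule Bochner_Integration.integrable_bound)
  show "integrable (measure_pmf (iid n)) (\<lambda>d. exp (\<beta> / 2) * exp (\<beta> / 2 * real (\<Sum>i\<in>S. d i) + \<beta> / 2 * real (\<Sum>i\<in>{..<n} - S. d i)))"
    by (intro integrable_mult_right mgf_two_sums(1)[OF assms(2)])
  show "AE d in measure_pmf (iid n). norm (adjusted_weight \<beta> r n S d)
     \<le> norm (exp (\<beta> / 2) * exp (\<beta> / 2 * real (\<Sum>i\<in>S. d i) + \<beta> / 2 * real (\<Sum>i\<in>{..<n} - S. d i)))"
    by (rule AE_I2) (use adjusted_weight_le[OF assms] pairing_weight_nonneg in \<open>simp del: of_nat_sum\<close>)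
qed simp

lemma expected_partition_function:
  assumes "\<beta> \<ge> 0" and r: "\<And>d. r n d < n"
  shows "measure_pmf.expectation (configuration_model r D n) (partition_function \<beta> B n)
    = (\<Sum>S\<in>Pow {..<n}. exp (B * (2 * real (card S) - real n)) * plus_set_weight r \<beta> n S)"
proof -
  define Z where "Z d = (\<Sum>S\<in>Pow {..<n}. exp (B * (2 * real (card S) - real n)) *
     adjusted_weight \<beta> r n S d)" for d
  have Z_nonneg: "Z d \<ge> 0" for d
    unfolding Z_def by (intro sum_nonneg mult_nonneg_nonneg pairing_weight_nonneg) auto
  have pf_nonneg: "partition_function \<beta> B n M \<ge> 0" for M
    unfolding partition_function_def by (intro sum_nonneg) auto
  have inner: "(\<integral>\<^sup>+M. ennreal (partition_function \<beta> B n M)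
      \<partial>measure_pmf (pmf_of_set (perfect_matchings (half_edges n (adjusted_degrees r n d))))) = ennreal (Z d)" for d
  proof -
    let ?PM = "perfect_matchings (half_edges n (adjusted_degrees r n d))"
    have ne: "?PM \<noteq> {}" and fin: "finite ?PM"
      using sum_partition_function_matchings(1)[OF even_sum_adjusted_degrees[of r n d, OF r]]
        finite_perfect_matchings[OF finite_half_edges] by auto
    have "(\<integral>\<^sup>+M. ennreal (partition_function \<beta> B n M) \<partial>measure_pmf (pmf_of_set ?PM))
       = (\<Sum>M\<in>?PM. ennreal (partition_function \<beta> B n M)) / ennreal (real (card ?PM))"
      using nn_integral_pmf_of_set[OF ne fin] by (simp add: ennreal_of_nat_eq_real_of_nat)
    also have "\<dots> = ennreal ((\<Sum>M\<in>?PM. partition_function \<beta> B n M) / real (card ?PM))"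
      using pf_nonneg ne fin by (simp add: divide_ennreal sum_nonneg card_gt_0_iff)
    also have "\<dots> = ennreal (Z d)"
      unfolding Z_def by (subst sum_partition_function_matchings(2)[OF even_sum_adjusted_degrees[of r n d, OF r]]) simp
    finally show ?thesis .
  qed
  have "measure_pmf.expectation (configuration_model r D n) (partition_function \<beta> B n)
     = enn2real (\<integral>\<^sup>+M. ennreal (partition_function \<beta> B n M) \<partial>measure_pmf (configuration_model r D n))"
    by (rule integral_eq_nn_integral) (use pf_nonneg in auto)
  also have "(\<integral>\<^sup>+M. ennreal (partition_function \<beta> B n M) \<partial>measure_pmf (configuration_model r D n))
     = (\<integral>\<^sup>+d. ennreal (Z d) \<partial>measure_pmf (iid n))"
    unfolding configuration_model_def nn_integral_bind_pmf inner ..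
  also have "enn2real \<dots> = measure_pmf.expectation (iid n) Z"
    by (rule integral_eq_nn_integral[symmetric]) (use Z_nonneg in auto)
  also have "\<dots> = (\<Sum>S\<in>Pow {..<n}. exp (B * (2 * real (card S) - real n)) * plus_set_weight r \<beta> n S)"
    unfolding Z_def plus_set_weight_def
    using integrable_adjusted_weight[OF assms(1)]
    by (subst Bochner_Integration.integral_sum) auto
  finally show ?thesis .
qed

end

section \<open>Entropy of the spins\<close>

definition spin_entropy :: "real \<Rightarrow> real \<Rightarrow> real" where
  "spin_entropy B t = t * ln (1 / t) + (1 - t) * ln (1 / (1 - t)) + 2 * B * t"

lemma spin_entropy_split: "spin_entropy B t = spin_entropy 0 t + 2 * B * t"
  by (simp add: spin_entropy_def)

lemma continuous_on_spin_entropy: "continuous_on {0..1} (spin_entropy B)"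
proof -
  let ?\<eta> = "\<lambda>x::real. x * ln (1 / x)"
  have \<eta>: "continuous_on {0..1} ?\<eta>"
    unfolding continuous_on_eq_continuous_within
  proof
    fix x :: real assume x: "x \<in> {0..1}"
    show "continuous (at x within {0..1}) ?\<eta>"
    proof (cases "x = 0")
      case True
      have "(?\<eta> \<longlongrightarrow> 0) (at_right 0)" by real_asymp
      then show ?thesis using True by (simp add: continuous_within at_within_Icc_at_right)
    next
      case False
      then show ?thesis using x by (intro continuous_intros) auto
    qed
  qed
  have "continuous_on {0..1} (?\<eta> \<circ> (\<lambda>t. 1 - t))"
    by (rule continuous_on_compose) (auto intro!: continuous_intros continuous_on_subset[OF \<eta>])
  then have \<eta>': "continuous_on {0..1} (\<lambda>t::real. (1 - t) * ln (1 / (1 - t)))" by (simp add: o_def)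
  show ?thesis unfolding spin_entropy_def[abs_def]
    by (intro continuous_on_add \<eta> \<eta>') (intro continuous_intros)
qed

lemma power_eq_exp_entropy:
  assumes "n > 0"
  shows "(real k / real n) ^ k = exp (- (real n * (real k / real n * ln (1 / (real k / real n)))))"
proof (cases "k = 0")
  case False
  have "exp (- (real n * (real k / real n * ln (1 / (real k / real n))))) = exp (real k * ln (real k / real n))"
    using assms False by (simp add: ln_div right_diff_distrib)
  also have "\<dots> = (real k / real n) ^ k" using assms False by (simp add: exp_of_nat_mult)
  finally show ?thesis ..
qed simp

lemma power_prod_eq_exp_entropy:
  assumes "n > 0" "k \<le> n"
  shows "(real k / real n) ^ k * (1 - real k / real n) ^ (n - k) = exp (- (real n * spin_entropy 0 (real k / real n)))"
proof -
  have *: "1 - real k / real n = real (n - k) / real n" using assms by (simp add: of_nat_diff field_simps)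
  show ?thesis
    unfolding spin_entropy_def * power_eq_exp_entropy[OF assms(1)] mult_exp_exp by (simp add: algebra_simps)
qed

lemma binomial_le_exp_entropy:
  assumes "n > 0" "k \<le> n"
  shows "real (n choose k) \<le> exp (real n * spin_entropy 0 (real k / real n))"
proof -
  let ?p = "real k / real n"
  have p: "0 \<le> ?p" "?p \<le> 1" using assms by auto
  have "real (n choose k) * ?p ^ k * (1 - ?p) ^ (n - k) \<le> (\<Sum>j\<le>n. real (n choose j) * ?p ^ j * (1 - ?p) ^ (n - j))"
    by (rule member_le_sum) (use p assms in auto)
  also have "\<dots> = (?p + (1 - ?p)) ^ n" by (rule binomial_ring[symmetric])
  finally have "real (n choose k) * (?p ^ k * (1 - ?p) ^ (n - k)) \<le> 1" by (simp add: mult.assoc)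
  then show ?thesis unfolding power_prod_eq_exp_entropy[OF assms] by (simp add: exp_minus field_simps)
qed

text \<open>
  These are the terms of the expansion of \<open>(k + (n - k)) ^ n\<close>. Consecutive terms have the ratio
  \<open>(n - j) k / ((j + 1) (n - k))\<close>, which is at least \<open>1\<close> for \<open>j < k\<close> and at most \<open>1\<close> for \<open>j \<ge> k\<close>.
\<close>

lemma binomial_term_max:
  assumes "k \<le> n" "j \<le> n"
  shows "(n choose j) * k ^ j * (n - k) ^ (n - j) \<le> (n choose k) * k ^ k * (n - k) ^ (n - k)"
proof (cases "k = n")
  case True
  then show ?thesis using assms by (cases "j = n") (auto simp: power_0_left)
next
  case False
  then have kn: "k < n" using assms by simp
  define T where "T j = (n choose j) * k ^ j * (n - k) ^ (n - j)" for j
  have rel: "T (Suc j) * (Suc j * (n - k)) = T j * ((n - j) * k)" if "j < n" for j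
  proof -
    have e: "n - j = Suc (n - Suc j)" using that by simp
    have "T (Suc j) * (Suc j * (n - k)) = (Suc j * (n choose Suc j)) * (k * k ^ j) * ((n - k) * (n - k) ^ (n - Suc j))"
      by (simp only: T_def power_Suc mult_ac)
    also have "Suc j * (n choose Suc j) = (n - j) * (n choose j)"
      by (metis binomial_absorb_comp binomial_absorption mult.commute)
    also have "(n - k) * (n - k) ^ (n - Suc j) = (n - k) ^ (n - j)" unfolding e by simp
    finally show ?thesis by (simp only: T_def mult_ac)
  qed
  have up: "T j \<le> T (Suc j)" if "j < k" for j
  proof -
    have "Suc j * (n - k) \<le> (n - j) * k"
    proof -
      have "Suc j * n \<le> k * n" using that by (intro mult_right_mono) auto
      then have "int (Suc j) * (int n - int k) \<le> (int n - int j) * int k"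
        by (simp add: algebra_simps flip: of_nat_mult of_nat_add)
      then have "int (Suc j * (n - k)) \<le> int ((n - j) * k)"
        using of_nat_diff[of k n, where 'a = int] of_nat_diff[of j n, where 'a = int] that kn
        by (simp only: of_nat_mult less_imp_le order.strict_trans)
      then show ?thesis by (simp only: of_nat_le_iff)
    qed
    then have "T j * (Suc j * (n - k)) \<le> T (Suc j) * (Suc j * (n - k))"
      using rel[of j] that kn by (simp add: mult_left_mono)
    moreover have "Suc j * (n - k) > 0" using kn by simp
    ultimately show ?thesis by (metis mult_le_cancel2)
  qed
  have down: "T (Suc j) \<le> T j" if "k \<le> j" "j < n" for j
  proof -
    have "(n - j) * k \<le> Suc j * (n - k)"
    proof -
      have "k + k * n \<le> n + j * n" using that kn by (intro add_mono mult_right_mono) auto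
      then have "(int n - int j) * int k \<le> int (Suc j) * (int n - int k)"
        using kn by (simp add: algebra_simps flip: of_nat_mult of_nat_add)
      then have "int ((n - j) * k) \<le> int (Suc j * (n - k))"
        using of_nat_diff[of k n, where 'a = int] of_nat_diff[of j n, where 'a = int] that kn
        by (simp only: of_nat_mult less_imp_le)
      then show ?thesis by (simp only: of_nat_le_iff)
    qed
    then have "T (Suc j) * (Suc j * (n - k)) \<le> T j * (Suc j * (n - k))"
      using rel[of j] that kn by (simp add: mult_left_mono)
    moreover have "Suc j * (n - k) > 0" using kn by simp
    ultimately show ?thesis by (metis mult_le_cancel2)
  qed
  have "T j \<le> T k"
  proof (cases "j \<le> k")
    case True
    then show ?thesis
    proof (induction rule: inc_induct)
      case (step i)
      then show ?case using up[of i] by simp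
    qed simp
  next
    case False
    then have "k \<le> j" by simp
    then show ?thesis using assms(2)
    proof (induction rule: dec_induct)
      case (step i)
      then show ?case using down[of i] by simp
    qed simp
  qed
  then show ?thesis by (simp add: T_def)
qed

text \<open>
  The largest of \<open>n + 1\<close> terms is at least their mean.
\<close>

lemma binomial_ge_exp_entropy:
  assumes "n > 0" "k \<le> n"
  shows "exp (real n * spin_entropy 0 (real k / real n)) / real (n + 1) \<le> real (n choose k)"
proof -
  let ?p = "real k / real n"
  have "n ^ n = (k + (n - k)) ^ n" using assms by simp
  also have "\<dots> = (\<Sum>j\<le>n. (n choose j) * k ^ j * (n - k) ^ (n - j))" by (subst binomial_ring) simp
  also have "\<dots> \<le> (\<Sum>j\<le>n. (n choose k) * k ^ k * (n - k) ^ (n - k))"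
    by (intro sum_mono binomial_term_max) (use assms in auto)
  finally have "n ^ n \<le> (n + 1) * ((n choose k) * k ^ k * (n - k) ^ (n - k))" by simp
  then have "real (n ^ n) \<le> real ((n + 1) * ((n choose k) * k ^ k * (n - k) ^ (n - k)))"
    by (simp only: of_nat_le_iff)
  then have 1: "real n ^ n \<le> real (n + 1) * real (n choose k) * (real k ^ k * real (n - k) ^ (n - k))"
    by (simp only: of_nat_mult of_nat_power mult.assoc)
  have "real k ^ k * real (n - k) ^ (n - k) = real n ^ n * (?p ^ k * (1 - ?p) ^ (n - k))"
  proof -
    have *: "1 - ?p = real (n - k) / real n" using assms by (simp add: of_nat_diff field_simps)
    have "real n ^ n = real n ^ k * real n ^ (n - k)" using assms by (simp flip: power_add)
    then show ?thesis unfolding * using assms(1) by (simp add: power_divide)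
  qed
  with 1 have "real n ^ n * 1 \<le> real n ^ n * (real (n + 1) * real (n choose k) * (?p ^ k * (1 - ?p) ^ (n - k)))"
    by (simp only: mult_ac mult_1_right)
  then have "1 \<le> real (n + 1) * real (n choose k) * (?p ^ k * (1 - ?p) ^ (n - k))"
    using assms(1) by (subst (asm) mult_le_cancel_left_pos) auto
  then have "1 \<le> real (n + 1) * real (n choose k) * exp (- (real n * spin_entropy 0 ?p))"
    unfolding power_prod_eq_exp_entropy[OF assms] .
  then have "exp (real n * spin_entropy 0 ?p) \<le> real (n choose k) * real (n + 1)"
    by (simp add: exp_minus field_simps)
  then show ?thesis by (simp add: pos_divide_le_eq)
qed

lemma sum_Pow_card:
  fixes g :: "nat \<Rightarrow> real"
  assumes "finite A"
  shows "(\<Sum>S\<in>Pow A. g (card S)) = (\<Sum>k\<le>card A. real (card A choose k) * g k)"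
proof -
  have "(\<Sum>S\<in>Pow A. g (card S)) = (\<Sum>k\<le>card A. \<Sum>S\<in>{S \<in> Pow A. card S = k}. g (card S))"
    by (rule sum.group[symmetric]) (use assms card_mono in auto)
  also have "\<dots> = (\<Sum>k\<le>card A. real (card {S. S \<subseteq> A \<and> card S = k}) * g k)"
    by (intro sum.cong refl) (simp add: Pow_def)
  also have "\<dots> = (\<Sum>k\<le>card A. real (card A choose k) * g k)"
    using n_subsets[OF assms] by simp
  finally show ?thesis .
qed

section \<open>The variational problem\<close>

lemma continuous_on_edge_energy:
  assumes "\<beta> \<ge> 0"
  shows "continuous_on ({0..} \<times> {0..}) (\<lambda>(a, c). edge_energy \<beta> a c)"
proof -
  obtain L where L: "L \<ge> 0" "\<And>a c a' c'. \<lbrakk>0 \<le> a; 0 \<le> c; 0 \<le> a'; 0 \<le> c'\<rbrakk> \<Longrightarrow>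
    \<bar>edge_energy \<beta> a c - edge_energy \<beta> a' c'\<bar> \<le> L * (\<bar>a - a'\<bar> + \<bar>c - c'\<bar>)"
    using edge_energy_Lipschitz[OF assms] by blast
  have "(2 * L)-lipschitz_on ({0..} \<times> {0..}) (\<lambda>(a, c). edge_energy \<beta> a c)"
  proof (rule lipschitz_onI)
    fix p q :: "real \<times> real" assume pq: "p \<in> {0..} \<times> {0..}" "q \<in> {0..} \<times> {0..}"
    have "\<bar>fst p - fst q\<bar> \<le> dist p q" "\<bar>snd p - snd q\<bar> \<le> dist p q"
      using dist_fst_le[of p q] dist_snd_le[of p q] by (auto simp: dist_real_def)
    then have "L * (\<bar>fst p - fst q\<bar> + \<bar>snd p - snd q\<bar>) \<le> L * (2 * dist p q)"
      using L(1) by (intro mult_left_mono) auto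
    then show "dist (case p of (a, c) \<Rightarrow> edge_energy \<beta> a c) (case q of (a, c) \<Rightarrow> edge_energy \<beta> a c) \<le> 2 * L * dist p q"
      using L(2)[of "fst p" "snd p" "fst q" "snd q"] pq by (auto simp: dist_real_def case_prod_unfold)
  qed (use L in auto)
  then show ?thesis by (rule lipschitz_on_continuous_on)
qed

context exp_moments
begin

text \<open>
  The quantity to be maximised over \<open>t\<close>, \<open>a\<close> and \<open>b\<close>, with \<open>c = b - a\<close> and with the suprema in the two
  rate functions replaced by their terms at \<open>s\<close> and \<open>s'\<close>. Its infimum over \<open>s\<close> and \<open>s'\<close> is that
  quantity.
\<close>

definition dual_functional :: "real \<Rightarrow> real \<Rightarrow> real \<Rightarrow> real \<Rightarrow> real \<Rightarrow> real \<Rightarrow> real \<Rightarrow> real" where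
  "dual_functional \<beta> B s s' t a c = spin_entropy B t + edge_energy \<beta> a c
     - (s * a - t * cumulant D s) - (s' * c - (1 - t) * cumulant D s')"

text \<open>
  With \<open>s = s' = L + 1\<close>, where \<open>L\<close> is the Lipschitz constant of \<open>edge_energy\<close>, the functional is at most
  a constant minus \<open>a + c\<close>. Hence near-optimal points lie in a compact box, where the conditions
  \<open>M - 1 / (n + 1) \<le> dual_functional\<close>, for all \<open>s\<close> and \<open>s'\<close>, define a decreasing sequence of nonempty
  compact sets. Any point of their intersection is a maximiser.
\<close>

lemma variational_maximiser:
  assumes "\<beta> \<ge> 0"
  obtains M t a c where "t \<in> {0..1}" "a \<ge> 0" "c \<ge> 0" "\<And>s s'. M \<le> dual_functional \<beta> B s s' t a c"
    "\<And>t a c v. \<lbrakk>t \<in> {0..1}; a \<ge> 0; c \<ge> 0; \<And>s s'. v \<le> dual_functional \<beta> B s s' t a c\<rbrakk> \<Longrightarrow> v \<le> M"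
proof -
  define V where "V = {v. \<exists>t a c. t \<in> {0..1} \<and> a \<ge> 0 \<and> c \<ge> 0 \<and> (\<forall>s s'. v \<le> dual_functional \<beta> B s s' t a c)}"
  obtain L where L: "L \<ge> 0" "\<And>a c a' c'. \<lbrakk>0 \<le> a; 0 \<le> c; 0 \<le> a'; 0 \<le> c'\<rbrakk> \<Longrightarrow>
    \<bar>edge_energy \<beta> a c - edge_energy \<beta> a' c'\<bar> \<le> L * (\<bar>a - a'\<bar> + \<bar>c - c'\<bar>)"
    using edge_energy_Lipschitz[OF assms] by blast
  have "\<exists>x\<in>{0..1}. \<forall>t\<in>{0..1}. spin_entropy B t \<le> spin_entropy B x"
    by (rule continuous_attains_sup[OF _ _ continuous_on_spin_entropy]) auto
  then obtain E where E: "\<And>t. t \<in> {0..1} \<Longrightarrow> spin_entropy B t \<le> E" by blast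
  define E' where "E' = E + cumulant D (L + 1)"
  have upper: "v \<le> E' - (a + c)"
    if "t \<in> {0..1}" "a \<ge> 0" "c \<ge> 0" "\<And>s s'. v \<le> dual_functional \<beta> B s s' t a c" for t a c v
  proof -
    have "edge_energy \<beta> a c \<le> L * (a + c)"
      using L(2)[of a c 0 0] that by (simp add: edge_energy_def)
    moreover have "v \<le> dual_functional \<beta> B (L + 1) (L + 1) t a c" by (rule that(4))
    ultimately show ?thesis using E[OF that(1)] unfolding dual_functional_def E'_def
      by (simp add: algebra_simps)
  qed
  have ne: "V \<noteq> {}"
  proof -
    obtain k where k: "k \<in> set_pmf D" using set_pmf_not_empty by fast
    have "spin_entropy B 0 + edge_energy \<beta> 0 (real k) + ln (pmf D k) \<le> dual_functional \<beta> B s s' 0 0 (real k)" for s s'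
      using cumulant_ge_atom[OF k, of s'] by (simp add: dual_functional_def)
    then have "spin_entropy B 0 + edge_energy \<beta> 0 (real k) + ln (pmf D k) \<in> V"
      unfolding V_def by (intro CollectI exI[of _ 0] exI[of _ "real k"]) auto
    then show ?thesis by blast
  qed
  have "v \<le> E'" if v: "v \<in> V" for v
  proof -
    obtain t a c where "t \<in> {0..1}" "a \<ge> 0" "c \<ge> 0" "\<forall>s s'. v \<le> dual_functional \<beta> B s s' t a c"
      using v unfolding V_def by blast
    then show ?thesis using upper[of t a c v] by force
  qed
  then have bdd: "bdd_above V" by (rule bdd_aboveI)
  define M where "M = Sup V"
  define R where "R = E' - M + 1"
  define K where "K = {0..1::real} \<times> ({0..R} \<times> {0..R})"
  define J where "J s s' = (\<lambda>(t, a, c). dual_functional \<beta> B s s' t a c)" for s s'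
  have K: "compact K" unfolding K_def by (intro compact_Times compact_Icc)
  have contJ: "continuous_on K (J s s')" for s s'
  proof -
    have 1: "continuous_on K (\<lambda>p. spin_entropy B (fst p))"
      by (rule continuous_on_compose2[OF continuous_on_spin_entropy]) (auto simp: K_def intro!: continuous_intros)
    have 2: "continuous_on K (\<lambda>p. case snd p of (a, c) \<Rightarrow> edge_energy \<beta> a c)"
      by (rule continuous_on_compose2[OF continuous_on_edge_energy[OF assms]]) (auto simp: K_def intro!: continuous_intros)
    have "J s s' = (\<lambda>p. spin_entropy B (fst p) + (case snd p of (a, c) \<Rightarrow> edge_energy \<beta> a c)
     - (s * fst (snd p) - fst p * cumulant D s) - (s' * snd (snd p) - (1 - fst p) * cumulant D s'))"
      by (auto simp: J_def dual_functional_def fun_eq_iff)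
    then show ?thesis by (simp only:) (intro continuous_intros 1 2)
  qed
  define C where "C n = (\<Inter>s. \<Inter>s'. {p \<in> K. M - 1 / real (Suc n) \<le> J s s' p})" for n
  have "\<Inter> (range C) \<noteq> {}"
  proof (rule compact_nest)
    show "compact (C n)" for n
    proof -
      have "closed (C n)" unfolding C_def
        by (intro closed_INT ballI continuous_on_closed_Collect_le contJ continuous_intros compact_imp_closed[OF K])
      then have "compact (K \<inter> C n)" using K by (rule compact_Int_closed[rotated])
      moreover have "K \<inter> C n = C n" by (auto simp: C_def)
      ultimately show ?thesis by simp
    qed
    show "C n \<noteq> {}" for n
    proof -
      have "M - 1 / real (Suc n) < Sup V" by (simp add: M_def)
      then obtain v where v: "v \<in> V" "M - 1 / real (Suc n) < v"
        using less_cSup_iff[OF ne bdd] by blast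
      obtain t a c where tac: "t \<in> {0..1}" "a \<ge> 0" "c \<ge> 0" "\<forall>s s'. v \<le> dual_functional \<beta> B s s' t a c"
        using v(1) unfolding V_def by blast
      have "1 / real (Suc n) \<le> 1" by simp
      then have "M - 1 \<le> v" using v(2) by linarith
      then have "a + c \<le> R" using upper[OF tac(1-3)] tac(4) unfolding R_def by force
      then have "(t, a, c) \<in> C n" using tac v(2) by (auto simp: C_def K_def J_def intro: order_trans[OF less_imp_le])
      then show ?thesis by blast
    qed
    show "C n \<subseteq> C m" if "m \<le> n" for m n
    proof -
      have "1 / real (Suc n) \<le> 1 / real (Suc m)" using that by (intro divide_left_mono) auto
      then have "M - 1 / real (Suc m) \<le> x" if "M - 1 / real (Suc n) \<le> x" for x using that by linarith
      then show ?thesis unfolding C_def by blast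
    qed
  qed
  then obtain p where p: "\<And>n. p \<in> C n" by blast
  obtain t a c where "p = (t, a, c)" by (cases p)
  with p have tac: "\<And>n. (t, a, c) \<in> C n" by simp
  have inK: "t \<in> {0..1}" "a \<ge> 0" "c \<ge> 0" using tac[of 0] by (auto simp: C_def K_def)
  have "M \<le> dual_functional \<beta> B s s' t a c" for s s'
  proof (rule LIMSEQ_le_const2)
    show "(\<lambda>n. M - 1 / real (Suc n)) \<longlonglongrightarrow> M" by real_asymp
    show "\<exists>N. \<forall>n\<ge>N. M - 1 / real (Suc n) \<le> dual_functional \<beta> B s s' t a c"
      using tac by (auto simp: C_def J_def)
  qed
  moreover have "v \<le> M" if "t \<in> {0..1}" "a \<ge> 0" "c \<ge> 0" "\<And>s s'. v \<le> dual_functional \<beta> B s s' t a c" for t a c v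
    unfolding M_def by (rule cSup_upper[OF _ bdd]) (use that in \<open>auto simp: V_def\<close>)
  ultimately show ?thesis using that inK by blast
qed

section \<open>Convergence of the annealed pressure\<close>

text \<open>
  The Chernoff bounds for all \<open>s\<close> and \<open>s'\<close> say that \<open>spin_entropy + edge_energy + ln P / n\<close>, taken at the
  rescaled point, is a lower bound for the dual functional.
\<close>

lemma prob_two_sums_exp_le:
  assumes M: "\<And>t a c v. \<lbrakk>t \<in> {0..1}; a \<ge> 0; c \<ge> 0; \<And>s s'. v \<le> dual_functional \<beta> B s s' t a c\<rbrakk> \<Longrightarrow> v \<le> M"
    and n: "n > 0" and S: "S \<subseteq> {..<n}"
  shows "exp (real n * spin_entropy B (real (card S) / real n) + edge_energy \<beta> (real a) (real c)) *
     measure_pmf.prob (iid n) {d. (\<Sum>i\<in>S. d i) = a \<and> (\<Sum>i\<in>{..<n} - S. d i) = c} \<le> exp (real n * M)"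
proof -
  let ?P = "measure_pmf.prob (iid n) {d. (\<Sum>i\<in>S. d i) = a \<and> (\<Sum>i\<in>{..<n} - S. d i) = c}"
  let ?t = "real (card S) / real n"
  show ?thesis
  proof (cases "?P = 0")
    case False
    then have P: "?P > 0" by (simp add: zero_less_measure_iff)
    have kn: "card S \<le> n" using card_mono[OF _ S] by simp
    define v where "v = spin_entropy B ?t + edge_energy \<beta> (real a / real n) (real c / real n) + ln ?P / real n"
    have v: "v \<le> dual_functional \<beta> B s s' ?t (real a / real n) (real c / real n)" for s s'
    proof -
      have "ln ?P \<le> ln (exp (real (card S) * cumulant D s + real (n - card S) * cumulant D s' - s * real a - s' * real c))"
        using P prob_two_sums_le[OF S] by (subst ln_le_cancel_iff) auto
      then have "ln ?P / real n \<le> (real (card S) * cumulant D s + real (n - card S) * cumulant D s' - s * real a - s' * real c) / real n"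
        unfolding ln_exp by (rule divide_right_mono) simp
      also have "\<dots> = ?t * cumulant D s + (1 - ?t) * cumulant D s' - s * (real a / real n) - s' * (real c / real n)"
        using n kn by (simp add: of_nat_diff field_simps)
      finally show ?thesis by (simp add: v_def dual_functional_def)
    qed
    have "v \<le> M" by (rule M[OF _ _ _ v]) (use n kn in auto)
    then have "real n * v \<le> real n * M" by (intro mult_left_mono) auto
    moreover have "real n * v = real n * spin_entropy B ?t + edge_energy \<beta> (real a) (real c) + ln ?P"
      using edge_energy_scale[of "real n" \<beta> "real a / real n" "real c / real n"] n
      by (simp add: v_def distrib_left)
    ultimately have "exp (real n * spin_entropy B ?t + edge_energy \<beta> (real a) (real c) + ln ?P) \<le> exp (real n * M)"
      by simp
    then show ?thesis using P by (simp add: exp_add)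
  qed simp
qed

text \<open>
  Degrees of total at most \<open>K n\<close> produce at most \<open>(K n + 1)\<^sup>2\<close> values of the two sums, each of which
  contributes at most \<open>exp (n M)\<close> up to the error of \<open>crossing_poly_asymp\<close>. For the remaining degrees
  a factor \<open>exp (m - K n) \<ge> 1\<close> is inserted, with \<open>m\<close> their total, and \<open>K\<close> is large enough
  for the exponential moment not to matter.
\<close>

lemma plus_set_weight_le:
  assumes \<beta>: "\<beta> \<ge> 0" and r: "\<And>d. r n d < n"
    and M: "\<And>t a c v. \<lbrakk>t \<in> {0..1}; a \<ge> 0; c \<ge> 0; \<And>s s'. v \<le> dual_functional \<beta> B s s' t a c\<rbrakk> \<Longrightarrow> v \<le> M"
    and C: "adjusted_error \<beta> C"
    and E: "\<And>t. t \<in> {0..1} \<Longrightarrow> spin_entropy B t \<le> E"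
    and K: "E + cumulant D (\<beta> / 2 + 1) - M \<le> real K"
    and n: "n > 0" and S: "S \<subseteq> {..<n}"
  shows "exp (real n * spin_entropy B (real (card S) / real n)) * plus_set_weight r \<beta> n S
    \<le> exp (real n * M) * ((real (K * n) + 1)\<^sup>2 * exp (C * sqrt (real (K * n) + 1)) + exp (\<beta> / 2))"
proof -
  define N where "N = K * n"
  let ?A = "\<lambda>d::nat \<Rightarrow> nat. \<Sum>i\<in>S. d i" and ?C = "\<lambda>d::nat \<Rightarrow> nat. \<Sum>i\<in>{..<n} - S. d i"
  let ?x = "exp (C * sqrt (real N + 1))"
  let ?h = "exp (real n * spin_entropy B (real (card S) / real n))"
  let ?s = "\<beta> / 2 + 1"
  define W where "W a c = {d. ?A d = a \<and> ?C d = c}" for a c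
  let ?pw = "\<lambda>d. adjusted_weight \<beta> r n S d"
  let ?bulk = "\<lambda>d. \<Sum>a\<le>N. \<Sum>c\<le>N. indicator (W a c) d * (exp (edge_energy \<beta> (real a) (real c)) * ?x)"
  let ?tail = "\<lambda>d. exp (\<beta> / 2 - real N) * exp (?s * real (?A d) + ?s * real (?C d))"
  have split: "?A d + ?C d = (\<Sum>i<n. d i)" for d
    using sum.subset_diff[OF S, of d] by simp
  have bulk_nonneg: "?bulk d \<ge> 0" for d by (intro sum_nonneg) auto
  have pw: "?pw d \<le> ?bulk d + ?tail d" for d
  proof (cases "?A d + ?C d \<le> N")
    case True
    obtain \<Delta> where \<Delta>: "?pw d = exp (edge_energy \<beta> (real (?A d)) (real (?C d)) + \<Delta>)"
      "\<bar>\<Delta>\<bar> \<le> C * sqrt (real (\<Sum>i<n. d i) + 1)" using C r S unfolding adjusted_error_def by blast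
    have "C * sqrt (real (\<Sum>i<n. d i) + 1) \<le> C * sqrt (real N + 1)"
      using True C unfolding split adjusted_error_def
      by (intro mult_left_mono real_sqrt_le_mono) (auto simp del: of_nat_sum)
    then have "?pw d \<le> exp (edge_energy \<beta> (real (?A d)) (real (?C d))) * ?x"
      unfolding \<Delta>(1) mult_exp_exp using \<Delta>(2) by simp
    also have "\<dots> = indicator (W (?A d) (?C d)) d * (exp (edge_energy \<beta> (real (?A d)) (real (?C d))) * ?x)"
      by (simp add: W_def)
    also have "\<dots> \<le> (\<Sum>c\<le>N. indicator (W (?A d) c) d * (exp (edge_energy \<beta> (real (?A d)) (real c)) * ?x))"
      by (rule member_le_sum[where f = "\<lambda>c. indicator (W (?A d) c) d * (exp (edge_energy \<beta> (real (?A d)) (real c)) * ?x)"])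
        (use True in auto)
    also have "\<dots> \<le> ?bulk d"
      by (rule member_le_sum[where f = "\<lambda>a. \<Sum>c\<le>N. indicator (W a c) d * (exp (edge_energy \<beta> (real a) (real c)) * ?x)"])
        (use True in \<open>auto intro!: sum_nonneg\<close>)
    finally show ?thesis by (rule order_trans) simp
  next
    case False
    then have "real N \<le> real (?A d) + real (?C d)" by linarith
    then have "\<beta> / 2 + (\<beta> / 2 * real (?A d) + \<beta> / 2 * real (?C d)) \<le> \<beta> / 2 - real N + (?s * real (?A d) + ?s * real (?C d))"
      by (simp add: distrib_right del: of_nat_sum)
    then have "exp (\<beta> / 2) * exp (\<beta> / 2 * real (?A d) + \<beta> / 2 * real (?C d)) \<le> ?tail d"
      unfolding mult_exp_exp exp_le_cancel_iff .
    then show ?thesis using adjusted_weight_le[OF \<beta> S, of r d] bulk_nonneg[of d] by linarith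
  qed
  have int_bulk: "integrable (measure_pmf (iid n)) (\<lambda>d. indicator (W a c) d * (exp (edge_energy \<beta> (real a) (real c)) * ?x))" for a c
    by (rule measure_pmf.integrable_const_bound[where B = "exp (edge_energy \<beta> (real a) (real c)) * ?x"])
      (auto simp: indicator_def)
  have "plus_set_weight r \<beta> n S \<le> measure_pmf.expectation (iid n) (\<lambda>d. ?bulk d + ?tail d)"
    unfolding plus_set_weight_def
    by (rule integral_mono[OF integrable_adjusted_weight[OF \<beta> S] _ pw])
      (intro Bochner_Integration.integrable_add Bochner_Integration.integrable_sum int_bulk
         integrable_mult_right mgf_two_sums(1)[OF S])
  also have "\<dots> = measure_pmf.expectation (iid n) ?bulk + measure_pmf.expectation (iid n) ?tail"
    by (rule Bochner_Integration.integral_add)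
      (intro Bochner_Integration.integrable_sum int_bulk
         integrable_mult_right mgf_two_sums(1)[OF S])+
  also have "measure_pmf.expectation (iid n) ?bulk
     = (\<Sum>a\<le>N. measure_pmf.expectation (iid n)
         (\<lambda>d. \<Sum>c\<le>N. indicator (W a c) d * (exp (edge_energy \<beta> (real a) (real c)) * ?x)))"
    by (rule Bochner_Integration.integral_sum) (intro Bochner_Integration.integrable_sum int_bulk)
  also have "\<dots> = (\<Sum>a\<le>N. \<Sum>c\<le>N. measure_pmf.expectation (iid n)
         (\<lambda>d. indicator (W a c) d * (exp (edge_energy \<beta> (real a) (real c)) * ?x)))"
    by (intro sum.cong refl Bochner_Integration.integral_sum int_bulk)
  also have "\<dots> = (\<Sum>a\<le>N. \<Sum>c\<le>N. measure_pmf.prob (iid n) (W a c) * (exp (edge_energy \<beta> (real a) (real c)) * ?x))"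
    by (intro sum.cong refl) simp
  also have "measure_pmf.expectation (iid n) ?tail
     = exp (\<beta> / 2 - real N) * exp (real (card S) * cumulant D ?s + real (n - card S) * cumulant D ?s)"
    unfolding mgf_two_sums(2)[OF S, symmetric] by simp
  finally have "?h * plus_set_weight r \<beta> n S
     \<le> ?h * ((\<Sum>a\<le>N. \<Sum>c\<le>N. measure_pmf.prob (iid n) (W a c) * (exp (edge_energy \<beta> (real a) (real c)) * ?x))
        + exp (\<beta> / 2 - real N) * exp (real (card S) * cumulant D ?s + real (n - card S) * cumulant D ?s))"
    by (intro mult_left_mono) auto
  also have "\<dots> = (\<Sum>a\<le>N. \<Sum>c\<le>N. ?x * (?h * exp (edge_energy \<beta> (real a) (real c)) * measure_pmf.prob (iid n) (W a c)))
        + ?h * (exp (\<beta> / 2 - real N) * exp (real (card S) * cumulant D ?s + real (n - card S) * cumulant D ?s))"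
    unfolding distrib_left sum_distrib_left by (simp only: mult_ac)
  also have "\<dots> \<le> (\<Sum>a\<le>N. \<Sum>c\<le>N. ?x * exp (real n * M)) + exp (\<beta> / 2) * exp (real n * M)"
  proof (intro add_mono sum_mono)
    fix a c
    show "?x * (?h * exp (edge_energy \<beta> (real a) (real c)) * measure_pmf.prob (iid n) (W a c)) \<le> ?x * exp (real n * M)"
      using prob_two_sums_exp_le[where \<beta> = \<beta> and B = B and a = a and c = c, OF M n S] unfolding W_def exp_add by (intro mult_left_mono) auto
  next
    have kn: "card S \<le> n" using card_mono[OF _ S] by simp
    have e1: "spin_entropy B (real (card S) / real n) \<le> E" by (rule E) (use kn n in auto)
    have "real n * (spin_entropy B (real (card S) / real n) + cumulant D ?s - real K) \<le> real n * M"
      using e1 K by (intro mult_left_mono) auto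
    moreover have "real (card S) * cumulant D ?s + real (n - card S) * cumulant D ?s = real n * cumulant D ?s"
      using kn by (simp add: of_nat_diff algebra_simps)
    ultimately show "?h * (exp (\<beta> / 2 - real N) * exp (real (card S) * cumulant D ?s + real (n - card S) * cumulant D ?s))
       \<le> exp (\<beta> / 2) * exp (real n * M)"
      unfolding mult_exp_exp exp_le_cancel_iff by (simp add: N_def algebra_simps)
  qed
  also have "\<dots> = exp (real n * M) * ((real N + 1)\<^sup>2 * ?x + exp (\<beta> / 2))"
    by (simp add: power2_eq_square algebra_simps)
  finally show ?thesis unfolding N_def .
qed

text \<open>
  The entropy in the assumption pays for the number of sets of each size, which leaves one term for
  each of the \<open>n + 1\<close> sizes.
\<close>

lemma expected_partition_function_le:
  assumes \<beta>: "\<beta> \<ge> 0" and r: "\<And>d. r n d < n" and n: "n > 0"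
    and bound: "\<And>S. S \<subseteq> {..<n} \<Longrightarrow>
      exp (real n * spin_entropy B (real (card S) / real n)) * plus_set_weight r \<beta> n S \<le> X"
  shows "measure_pmf.expectation (configuration_model r D n) (partition_function \<beta> B n)
     \<le> exp (- B * real n) * (real n + 1) * X"
proof -
  have one: "exp (B * (2 * real (card S) - real n)) * plus_set_weight r \<beta> n S
     \<le> exp (- B * real n) * X / real (n choose card S)" if S: "S \<subseteq> {..<n}" for S
  proof -
    let ?k = "card S"
    have kn: "?k \<le> n" using card_mono[OF _ S] by simp
    have pos: "real (n choose ?k) > 0" using kn by simp
    have w: "plus_set_weight r \<beta> n S \<ge> 0"
      unfolding plus_set_weight_def by (intro Bochner_Integration.integral_nonneg pairing_weight_nonneg)
    have "real (n choose ?k) * (exp (2 * B * real ?k) * plus_set_weight r \<beta> n S)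
      \<le> exp (real n * spin_entropy 0 (real ?k / real n)) * (exp (2 * B * real ?k) * plus_set_weight r \<beta> n S)"
      using w by (intro mult_right_mono binomial_le_exp_entropy[OF n kn]) auto
    also have "\<dots> = exp (real n * spin_entropy B (real ?k / real n)) * plus_set_weight r \<beta> n S"
      unfolding spin_entropy_split[of B] mult.assoc[symmetric] mult_exp_exp using n by (simp add: algebra_simps)
    also have "\<dots> \<le> X" by (rule bound[OF S])
    finally have "exp (2 * B * real ?k) * plus_set_weight r \<beta> n S \<le> X / real (n choose ?k)"
      using pos by (simp add: pos_le_divide_eq mult.commute)
    then have "exp (- B * real n) * (exp (2 * B * real ?k) * plus_set_weight r \<beta> n S)
       \<le> exp (- B * real n) * (X / real (n choose ?k))" by (intro mult_left_mono) auto
    then show ?thesis unfolding mult.assoc[symmetric] mult_exp_exp by (simp add: algebra_simps)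
  qed
  have "measure_pmf.expectation (configuration_model r D n) (partition_function \<beta> B n)
     \<le> (\<Sum>S\<in>Pow {..<n}. exp (- B * real n) * X / real (n choose card S))"
    unfolding expected_partition_function[where r = r and n = n, OF \<beta> r] by (intro sum_mono one) auto
  also have "\<dots> = (\<Sum>k\<le>n. real (n choose k) * (exp (- B * real n) * X / real (n choose k)))"
    using sum_Pow_card[of "{..<n}" "\<lambda>k. exp (- B * real n) * X / real (n choose k)"] by simp
  also have "\<dots> = (\<Sum>k\<le>n. exp (- B * real n) * X)"
    by (intro sum.cong refl) auto
  also have "\<dots> = exp (- B * real n) * (real n + 1) * X" by (simp add: algebra_simps)
  finally show ?thesis .
qed

text \<open>
  The two suprema run over independent parameters, so a bound on their sum splits into a bound for
  each, and each bound yields a tilt.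
\<close>

lemma optimal_tilts_exist:
  assumes t: "t \<in> {0..1}" and v: "\<And>s s'. M \<le> dual_functional \<beta> B s s' t a c"
  obtains \<nu> s l y \<nu>' s' l' y' where "a = t * y" "c = (1 - t) * y'" "tilts_to y \<nu> s l" "tilts_to y' \<nu>' s' l'"
    "s * a - t * l + (s' * c - (1 - t) * l') \<le> spin_entropy B t + edge_energy \<beta> a c - M"
proof -
  define w where "w = spin_entropy B t + edge_energy \<beta> a c - M"
  have le: "s * a - t * cumulant D s \<le> w - (s' * c - (1 - t) * cumulant D s')" for s s'
    using v[of s s'] by (simp add: dual_functional_def w_def)
  define R where "R = (SUP s. s * a - t * cumulant D s)"
  have bdd: "bdd_above (range (\<lambda>s. s * a - t * cumulant D s))"
    using le[of _ 0] by (intro bdd_aboveI2)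
  have R1: "s * a - t * cumulant D s \<le> R" for s
    unfolding R_def by (rule cSUP_upper[OF _ bdd]) simp
  have "R \<le> w - (s' * c - (1 - t) * cumulant D s')" for s'
    unfolding R_def by (rule cSUP_least) (use le in auto)
  then have R2: "s' * c - (1 - t) * cumulant D s' \<le> w - R" for s' by (metis diff_le_eq le_diff_eq add.commute)
  obtain \<nu> s l y where 1: "a = t * y" "tilts_to y \<nu> s l" "s * a - t * l \<le> R"
    using rate_tilt_exists[OF _ R1] t by (metis atLeastAtMost_iff)
  obtain \<nu>' s' l' y' where 2: "c = (1 - t) * y'" "tilts_to y' \<nu>' s' l'" "s' * c - (1 - t) * l' \<le> w - R"
    using rate_tilt_exists[OF _ R2] t by (metis atLeastAtMost_iff diff_ge_0_iff_ge)
  show ?thesis by (rule that[OF 1(1) 2(1) 1(2) 2(2)]) (use 1(3) 2(3) in \<open>simp add: w_def\<close>)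
qed

lemma plus_set_weight_ge:
  assumes \<beta>: "\<beta> \<ge> 0" and r: "\<And>d. r n d < n"
    and L: "L \<ge> 0" "\<And>a c a' c'. \<lbrakk>0 \<le> a; 0 \<le> c; 0 \<le> a'; 0 \<le> c'\<rbrakk> \<Longrightarrow>
      \<bar>edge_energy \<beta> a c - edge_energy \<beta> a' c'\<bar> \<le> L * (\<bar>a - a'\<bar> + \<bar>c - c'\<bar>)"
    and C: "adjusted_error \<beta> C"
    and n: "n > 0" and S: "S \<subseteq> {..<n}" and ac: "a \<ge> 0" "c \<ge> 0" and \<delta>: "\<delta> \<ge> 0"
  shows "exp (real n * (edge_energy \<beta> a c - 2 * L * \<delta>) - C * sqrt (real n * (a + c + 2 * \<delta>) + 1)) *
     measure_pmf.prob (iid n)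
       (degree_window n S (\<delta> * real n) (real n * a) (real n * c))
     \<le> plus_set_weight r \<beta> n S"
proof -
  let ?A = "\<lambda>d::nat \<Rightarrow> nat. real (\<Sum>i\<in>S. d i)" and ?C = "\<lambda>d::nat \<Rightarrow> nat. real (\<Sum>i\<in>{..<n} - S. d i)"
  let ?W = "degree_window n S (\<delta> * real n) (real n * a) (real n * c)"
  let ?e = "exp (real n * (edge_energy \<beta> a c - 2 * L * \<delta>) - C * sqrt (real n * (a + c + 2 * \<delta>) + 1))"
  let ?pw = "\<lambda>d. adjusted_weight \<beta> r n S d"
  have split: "?A d + ?C d = real (\<Sum>i<n. d i)" for d
    using sum.subset_diff[OF S, of d] by simp
  have pw: "?e \<le> ?pw d" if d: "d \<in> ?W" for d
  proof -
    obtain \<Delta> where \<Delta>: "?pw d = exp (edge_energy \<beta> (?A d) (?C d) + \<Delta>)"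
      "\<bar>\<Delta>\<bar> \<le> C * sqrt (real (\<Sum>i<n. d i) + 1)" using C r S unfolding adjusted_error_def by blast
    have "real (\<Sum>i<n. d i) + 1 \<le> real n * (a + c + 2 * \<delta>) + 1"
      using d unfolding split[symmetric] degree_window_def
      by (simp add: abs_le_iff algebra_simps del: of_nat_sum)
    then have "C * sqrt (real (\<Sum>i<n. d i) + 1) \<le> C * sqrt (real n * (a + c + 2 * \<delta>) + 1)"
      using C unfolding adjusted_error_def by (intro mult_left_mono real_sqrt_le_mono) auto
    with \<Delta>(2) have d1: "- \<Delta> \<le> C * sqrt (real n * (a + c + 2 * \<delta>) + 1)" by linarith
    have "\<bar>edge_energy \<beta> (?A d) (?C d) - edge_energy \<beta> (real n * a) (real n * c)\<bar>
      \<le> L * (\<bar>?A d - real n * a\<bar> + \<bar>?C d - real n * c\<bar>)"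
      using ac by (intro L(2) of_nat_0_le_iff mult_nonneg_nonneg)
    also have "\<dots> \<le> L * (2 * \<delta> * real n)" using d L(1) by (intro mult_left_mono) (auto simp: degree_window_def)
    also have "edge_energy \<beta> (real n * a) (real n * c) = real n * edge_energy \<beta> a c"
      using n by (intro edge_energy_scale) auto
    finally have "real n * edge_energy \<beta> a c - L * (2 * \<delta> * real n) \<le> edge_energy \<beta> (?A d) (?C d)" by linarith
    then show ?thesis using d1 unfolding \<Delta>(1) exp_le_cancel_iff by (simp add: algebra_simps del: of_nat_sum)
  qed
  have "measure_pmf.expectation (iid n) (\<lambda>d. indicator ?W d * ?e) \<le> plus_set_weight r \<beta> n S"
    unfolding plus_set_weight_def
  proof (rule integral_mono[OF _ integrable_adjusted_weight[OF \<beta> S]])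
    show "integrable (measure_pmf (iid n)) (\<lambda>d. indicator ?W d * ?e)"
      by (rule measure_pmf.integrable_const_bound[where B = ?e]) (auto simp: indicator_def)
    fix d show "indicator ?W d * ?e \<le> ?pw d"
      using pw[of d] pairing_weight_nonneg by (cases "d \<in> ?W") auto
  qed
  then show ?thesis by (simp add: mult.commute)
qed

text \<open>
  It is enough to keep the sets of size \<open>\<lfloor>t n\<rfloor>\<close> and the degrees in a window of width \<open>\<delta> n\<close> around the
  optimum. In the limit the window costs \<open>\<delta> q\<close>, where \<open>q\<close> does not depend on \<open>\<delta>\<close>.
\<close>

lemma annealed_pressure_eventually_gt:
  assumes \<beta>: "\<beta> \<ge> 0" and r: "\<And>n d. n \<ge> 1 \<Longrightarrow> r n d < n"
    and opt: "t \<in> {0..1}" "a \<ge> 0" "c \<ge> 0" "\<And>s s'. M \<le> dual_functional \<beta> B s s' t a c"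
    and e: "e > 0"
  shows "\<forall>\<^sub>F n in sequentially.
     0 < measure_pmf.expectation (configuration_model r D n) (partition_function \<beta> B n) \<and>
     M - B - e < annealed_pressure r D \<beta> B n"
proof -
  let ?EZ = "\<lambda>n. measure_pmf.expectation (configuration_model r D n) (partition_function \<beta> B n)"
  obtain L where L: "L \<ge> 0" "\<And>a c a' c'. \<lbrakk>0 \<le> a; 0 \<le> c; 0 \<le> a'; 0 \<le> c'\<rbrakk> \<Longrightarrow>
      \<bar>edge_energy \<beta> a c - edge_energy \<beta> a' c'\<bar> \<le> L * (\<bar>a - a'\<bar> + \<bar>c - c'\<bar>)"
    using edge_energy_Lipschitz[OF \<beta>] by blast
  obtain C where C: "adjusted_error \<beta> C"
    using adjusted_weight_asymp[OF \<beta>] by blast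
  obtain \<nu> s l y \<nu>' s' l' y' where tilts: "a = t * y" "c = (1 - t) * y'" "tilts_to y \<nu> s l" "tilts_to y' \<nu>' s' l'"
    and sl: "s * a - t * l + (s' * c - (1 - t) * l') \<le> spin_entropy B t + edge_energy \<beta> a c - M"
    by (rule optimal_tilts_exist[OF opt(1,4)]) (rule that, assumption+)
  define q where "q = 2 * L + \<bar>s\<bar> + \<bar>s'\<bar>"
  have q: "q \<ge> 0" using L(1) by (simp add: q_def)
  define \<delta> where "\<delta> = e / (2 * (q + 1))"
  have \<delta>: "\<delta> > 0" "\<delta> * q < e"
    using e q by (auto simp: \<delta>_def field_simps intro: add_nonneg_pos)
  define G where "G = - (s * a - t * l + (s' * c - (1 - t) * l')) + edge_energy \<beta> a c - \<delta> * q"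
  define k where "k n = nat \<lfloor>t * real n\<rfloor>" for n
  have k: "real (k n) \<le> t * real n" "t * real n \<le> real (k n) + 1" "k n \<le> n" for n
  proof -
    have "0 \<le> t * real n" using opt(1) by simp
    then show 1: "real (k n) \<le> t * real n" "t * real n \<le> real (k n) + 1"
      unfolding k_def by linarith+
    have "t * real n \<le> 1 * real n" using opt(1) by (intro mult_right_mono) auto
    then show "k n \<le> n" using 1 by linarith
  qed
  define x where "x n = real (k n) / real n" for n
  have x01: "x n \<in> {0..1}" for n using k(3)[of n] by (auto simp: x_def divide_le_eq_1)
  have x_lim: "x \<longlonglongrightarrow> t"
  proof (rule tendsto_sandwich[of "\<lambda>n. t - 1 / real n" x sequentially "\<lambda>_. t"])
    show "\<forall>\<^sub>F n in sequentially. t - 1 / real n \<le> x n"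
    proof (rule eventually_mono[OF eventually_gt_at_top[of 0]])
      fix n :: nat assume n: "n > 0"
      have "(t * real n - 1) / real n \<le> x n"
        unfolding x_def using k(2)[of n] by (intro divide_right_mono) auto
      then show "t - 1 / real n \<le> x n" using n by (simp add: diff_divide_distrib)
    qed
    show "\<forall>\<^sub>F n in sequentially. x n \<le> t"
    proof (rule eventually_mono[OF eventually_gt_at_top[of 0]])
      fix n :: nat assume n: "n > 0"
      then show "x n \<le> t" using k(1)[of n] by (simp add: x_def pos_divide_le_eq)
    qed
    show "(\<lambda>n. t - 1 / real n) \<longlonglongrightarrow> t" by real_asymp
  qed simp
  have spin_lim: "(\<lambda>n. spin_entropy B (x n)) \<longlonglongrightarrow> spin_entropy B t"
    by (rule continuous_on_tendsto_compose[OF continuous_on_spin_entropy x_lim opt(1)]) (use x01 in auto)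
  define R where "R = a + c + 2 * \<delta>"
  have R: "R > 0" using opt(2,3) \<delta>(1) by (simp add: R_def)
  define u where "u n = spin_entropy B (x n) - B + G
     - (C * sqrt (real n * R + 1) + \<bar>l\<bar> + \<bar>l'\<bar> + ln 2 + ln (real (n + 1))) / real n" for n
  have "(\<lambda>n. C * (sqrt (real n * R + 1) / real n) + (\<bar>l\<bar> + \<bar>l'\<bar> + ln 2) * (1 / real n) + ln (real (n + 1)) / real n)
      \<longlonglongrightarrow> C * 0 + (\<bar>l\<bar> + \<bar>l'\<bar> + ln 2) * 0 + 0"
    using R by (intro tendsto_add tendsto_mult_left) real_asymp+
  then have "(\<lambda>n. (C * sqrt (real n * R + 1) + \<bar>l\<bar> + \<bar>l'\<bar> + ln 2 + ln (real (n + 1))) / real n) \<longlonglongrightarrow> 0"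
    by (simp add: add_divide_distrib algebra_simps)
  then have "u \<longlonglongrightarrow> spin_entropy B t - B + G - 0"
    unfolding u_def by (intro tendsto_intros spin_lim)
  moreover have "M - B - e < spin_entropy B t - B + G - 0" using sl \<delta>(2) by (simp add: G_def)
  ultimately have u: "\<forall>\<^sub>F n in sequentially. M - B - e < u n" by (rule order_tendstoD(1))
  have win: "\<forall>\<^sub>F n in sequentially. \<forall>S. S \<subseteq> {..<n} \<longrightarrow> card S = k n \<longrightarrow>
    exp (- real n * (s * a - t * l + (s' * c - (1 - t) * l') + \<delta> * (\<bar>s\<bar> + \<bar>s'\<bar>)) - \<bar>l\<bar> - \<bar>l'\<bar>) / 2
    \<le> measure_pmf.prob (iid n)
       (degree_window n S (\<delta> * real n) (real n * a) (real n * c))"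
    using prob_window_ge[OF tilts(3,4) _ _ \<delta>(1), of t] opt(1) unfolding tilts(1,2) k_def by simp
  have "\<forall>\<^sub>F n in sequentially. ?EZ n > 0 \<and> u n \<le> annealed_pressure r D \<beta> B n"
    using win eventually_gt_at_top[of 0]
  proof eventually_elim
    case (elim n)
    then have n: "n > 0" by simp
    have rn: "r n d < n" for d using r n by simp
    have w: "plus_set_weight r \<beta> n S \<ge> 0" for S
      unfolding plus_set_weight_def by (intro Bochner_Integration.integral_nonneg pairing_weight_nonneg)
    define err where "err = C * sqrt (real n * R + 1) + \<bar>l\<bar> + \<bar>l'\<bar> + ln 2"
    have scw: "exp (real n * G - err) \<le> plus_set_weight r \<beta> n S"
      if S: "S \<subseteq> {..<n}" and cS: "card S = k n" for S
    proof -
      let ?W = "(degree_window n S (\<delta> * real n) (real n * a) (real n * c))"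
      have "exp (real n * G - err)
          = exp (real n * (edge_energy \<beta> a c - 2 * L * \<delta>) - C * sqrt (real n * R + 1)) *
            (exp (- real n * (s * a - t * l + (s' * c - (1 - t) * l') + \<delta> * (\<bar>s\<bar> + \<bar>s'\<bar>)) - \<bar>l\<bar> - \<bar>l'\<bar>) / 2)"
      proof -
        have "real n * G - err = (real n * (edge_energy \<beta> a c - 2 * L * \<delta>) - C * sqrt (real n * R + 1))
           + (- real n * (s * a - t * l + (s' * c - (1 - t) * l') + \<delta> * (\<bar>s\<bar> + \<bar>s'\<bar>)) - \<bar>l\<bar> - \<bar>l'\<bar>) - ln 2"
          by (simp add: G_def err_def q_def algebra_simps)
        then show ?thesis by (simp only: exp_diff[of _ "ln 2"] exp_add) simp
      qed
      also have "\<dots> \<le> exp (real n * (edge_energy \<beta> a c - 2 * L * \<delta>) - C * sqrt (real n * R + 1)) *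
          measure_pmf.prob (iid n) ?W"
        using elim(1) S cS by (intro mult_left_mono) auto
      also have "\<dots> \<le> plus_set_weight r \<beta> n S"
        unfolding R_def by (rule plus_set_weight_ge[where r = r and n = n, OF \<beta> rn L C n S opt(2,3)]) (use \<delta>(1) in auto)
      finally show ?thesis .
    qed
    define g where "g = exp (B * (2 * real (k n) - real n)) * exp (real n * G - err)"
    have "exp (real n * u n) \<le> real (n choose k n) * g"
    proof -
      have "real n * u n = real n * spin_entropy 0 (x n) + B * (2 * real (k n) - real n) + (real n * G - err) - ln (real (n + 1))"
        using n by (simp add: u_def err_def spin_entropy_split[of B] x_def field_simps)
      then have "exp (real n * u n) = exp (real n * spin_entropy 0 (x n)) / real (n + 1) * g"
        by (simp only: exp_diff[of _ "ln (real (n + 1))"] exp_add g_def) simp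
      also have "\<dots> \<le> real (n choose k n) * g"
        unfolding x_def by (intro mult_right_mono binomial_ge_exp_entropy n k) (simp add: g_def)
      finally show ?thesis .
    qed
    also have "real (n choose k n) * g = (\<Sum>S | S \<subseteq> {..<n} \<and> card S = k n. g)"
      using n_subsets[of "{..<n}" "k n"] by simp
    also have "\<dots> \<le> (\<Sum>S | S \<subseteq> {..<n} \<and> card S = k n. exp (B * (2 * real (card S) - real n)) * plus_set_weight r \<beta> n S)"
      unfolding g_def by (intro sum_mono) (use scw in auto)
    also have "\<dots> \<le> (\<Sum>S\<in>Pow {..<n}. exp (B * (2 * real (card S) - real n)) * plus_set_weight r \<beta> n S)"
      by (rule sum_mono2) (use w in auto)
    also have "\<dots> = ?EZ n" by (rule expected_partition_function[where r = r and n = n, OF \<beta> rn, symmetric])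
    finally have EZ: "exp (real n * u n) \<le> ?EZ n" .
    then have pos: "?EZ n > 0" using exp_gt_zero[of "real n * u n"] by linarith
    then have "real n * u n \<le> ln (?EZ n)" using EZ by (simp add: ln_ge_iff)
    then have "u n \<le> annealed_pressure r D \<beta> B n"
      using n by (simp add: annealed_pressure_def field_simps)
    then show ?case using pos by simp
  qed
  with u show ?thesis by eventually_elim auto
qed

text \<open>
  The polynomial and square-root factors disappear after division by \<open>n\<close>. The expectation has to be
  known to be positive, since \<open>ln 0 = 0\<close> would not be monotone.
\<close>

lemma annealed_pressure_eventually_lt:
  assumes \<beta>: "\<beta> \<ge> 0" and r: "\<And>n d. n \<ge> 1 \<Longrightarrow> r n d < n"
    and M: "\<And>t a c v. \<lbrakk>t \<in> {0..1}; a \<ge> 0; c \<ge> 0; \<And>s s'. v \<le> dual_functional \<beta> B s s' t a c\<rbrakk> \<Longrightarrow> v \<le> M"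
    and pos: "\<forall>\<^sub>F n in sequentially.
      0 < measure_pmf.expectation (configuration_model r D n) (partition_function \<beta> B n)"
    and e: "e > 0"
  shows "\<forall>\<^sub>F n in sequentially. annealed_pressure r D \<beta> B n < M - B + e"
proof -
  let ?EZ = "\<lambda>n. measure_pmf.expectation (configuration_model r D n) (partition_function \<beta> B n)"
  obtain C where C: "adjusted_error \<beta> C"
    using adjusted_weight_asymp[OF \<beta>] by blast
  have "\<exists>x\<in>{0..1}. \<forall>t\<in>{0..1}. spin_entropy B t \<le> spin_entropy B x"
    by (rule continuous_attains_sup[OF _ _ continuous_on_spin_entropy]) auto
  then obtain E where E: "\<And>t. t \<in> {0..1} \<Longrightarrow> spin_entropy B t \<le> E" by blast
  obtain K0 :: nat where K0: "E + cumulant D (\<beta> / 2 + 1) - M \<le> real K0" using real_arch_simple by blast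
  \<comment> \<open>The successor makes \<open>K\<close> positive, which the limit of \<open>ln (K n + 1) / n\<close> relies on.\<close>
  define K where "K = Suc K0"
  have K: "E + cumulant D (\<beta> / 2 + 1) - M \<le> real K" "real K > 0" using K0 by (simp_all add: K_def)
  define U where "U n = M - B + (ln (real n + 1) + (2 * ln (real K * real n + 1) + C * sqrt (real K * real n + 1)
      + ln (1 + exp (\<beta> / 2)))) / real n" for n
  have "(\<lambda>n. M - B + (ln (real n + 1) / real n + 2 * (ln (real K * real n + 1) / real n)
      + C * (sqrt (real K * real n + 1) / real n) + ln (1 + exp (\<beta> / 2)) * (1 / real n)))
      \<longlonglongrightarrow> M - B + (0 + 2 * 0 + C * 0 + ln (1 + exp (\<beta> / 2)) * 0)"
    using K(2) by (intro tendsto_add tendsto_mult_left tendsto_const) real_asymp+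
  then have "U \<longlonglongrightarrow> M - B" unfolding U_def[abs_def] by (simp add: add_divide_distrib algebra_simps)
  then have "\<forall>\<^sub>F n in sequentially. U n < M - B + e"
    by (rule order_tendstoD(2)) (use e in simp)
  then show ?thesis using pos eventually_gt_at_top[of 0]
  proof eventually_elim
    case (elim n)
    then have n: "n > 0" and pos: "?EZ n > 0" by simp_all
    have rn: "r n d < n" for d using r n by simp
    define X where "X = (real (K * n) + 1)\<^sup>2 * exp (C * sqrt (real (K * n) + 1)) + exp (\<beta> / 2)"
    have X: "X > 0" unfolding X_def by (intro add_nonneg_pos) auto
    have lnX: "ln X \<le> 2 * ln (real K * real n + 1) + C * sqrt (real K * real n + 1) + ln (1 + exp (\<beta> / 2))"
    proof -
      let ?y = "(real (K * n) + 1)\<^sup>2 * exp (C * sqrt (real (K * n) + 1))"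
      have "1 * 1 \<le> ?y" using C unfolding adjusted_error_def by (intro mult_mono one_le_power) auto
      then have "1 * exp (\<beta> / 2) \<le> ?y * exp (\<beta> / 2)" by (intro mult_right_mono) auto
      then have "X \<le> ?y * (1 + exp (\<beta> / 2))" by (simp add: X_def distrib_left)
      then have "ln X \<le> ln (?y * (1 + exp (\<beta> / 2)))" using X by simp
      also have "\<dots> = 2 * ln (real K * real n + 1) + C * sqrt (real K * real n + 1) + ln (1 + exp (\<beta> / 2))"
      proof -
        have "real K * real n + 1 \<noteq> 0" "1 + exp (\<beta> / 2) \<noteq> 0"
          using exp_gt_zero[of "\<beta> / 2"] K(2) by (auto simp: add_nonneg_eq_0_iff simp del: exp_gt_zero)
        then show ?thesis by (simp add: ln_mult ln_realpow)
      qed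
      finally show ?thesis .
    qed
    have "?EZ n \<le> exp (- B * real n) * (real n + 1) * (exp (real n * M) * X)"
      unfolding X_def by (rule expected_partition_function_le[where r = r and n = n, OF \<beta> rn n
        plus_set_weight_le[where r = r and n = n, OF \<beta> rn M C E K(1) n]])
    then have "ln (?EZ n) \<le> ln (exp (- B * real n) * (real n + 1) * (exp (real n * M) * X))"
      using pos X by (subst ln_le_cancel_iff) auto
    also have "\<dots> = real n * (M - B) + (ln (real n + 1) + ln X)"
    proof -
      have eq: "exp (- B * real n) * (real n + 1) * (exp (real n * M) * X) = exp (real n * (M - B)) * ((real n + 1) * X)"
        by (simp add: right_diff_distrib exp_diff exp_minus field_simps)
      show ?thesis unfolding eq using X by (simp add: ln_mult)
    qed
    finally have "ln (?EZ n) / real n \<le> (real n * (M - B) + (ln (real n + 1) + ln X)) / real n"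
      by (rule divide_right_mono) simp
    also have "\<dots> = M - B + (ln (real n + 1) + ln X) / real n" using n by (simp add: add_divide_distrib)
    also have "\<dots> \<le> U n" unfolding U_def
      using lnX by (intro add_left_mono divide_right_mono) auto
    finally show ?case using elim(1) by (simp add: annealed_pressure_def)
  qed
qed

lemma pressure_functional_le:
  assumes t: "t \<in> {0..1}"
    and M: "\<And>a c v. \<lbrakk>a \<ge> 0; c \<ge> 0; \<And>s s'. v \<le> dual_functional \<beta> B s s' t a c\<rbrakk> \<Longrightarrow> v \<le> M"
  shows "pressure_functional D \<beta> B t \<le> ereal M"
proof -
  have "G_edge D \<beta> t \<le> ereal (M - spin_entropy B t)"
    unfolding G_edge_def
  proof (rule SUP_least, clarify)
    fix a b :: real assume ab: "0 \<le> a" "a \<le> b"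
    define c where "c = b - a"
    have c: "c \<ge> 0" "a + c = b" using ab by (auto simp: c_def)
    have t': "t \<ge> 0" "1 - t \<ge> 0" using t by auto
    have g: "ereal (s * a - t * cumulant D s) \<le> rate D t a" "ereal (s * c - (1 - t) * cumulant D s) \<le> rate D (1 - t) c" for s
      using rate_ge t' by blast+
    show "ereal (b * (\<beta> / 2 + F_edge \<beta> (a / b))) - rate D t a - rate D (1 - t) (b - a) \<le> ereal (M - spin_entropy B t)"
    proof (cases "rate D t a = \<infinity> \<or> rate D (1 - t) c = \<infinity>")
      case True
      then show ?thesis using g(1)[of 0] g(2)[of 0] unfolding c_def[symmetric]
        by (cases "rate D t a"; cases "rate D (1 - t) c") auto
    next
      case False
      then obtain R R' where R: "rate D t a = ereal R" "rate D (1 - t) c = ereal R'"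
        using g(1)[of 0] g(2)[of 0] by (cases "rate D t a"; cases "rate D (1 - t) c") auto
      have "spin_entropy B t + edge_energy \<beta> a c - R - R' \<le> dual_functional \<beta> B s s' t a c" for s s'
        using g(1)[of s] g(2)[of s'] unfolding R by (simp add: dual_functional_def)
      then have "spin_entropy B t + edge_energy \<beta> a c - R - R' \<le> M" by (rule M[OF ab(1) c(1)])
      then show ?thesis unfolding c_def[symmetric] R by (simp add: edge_energy_def c(2))
    qed
  qed
  then have "ereal (spin_entropy B t) + G_edge D \<beta> t \<le> ereal (spin_entropy B t) + ereal (M - spin_entropy B t)"
    by (rule add_left_mono)
  then show ?thesis by (simp add: pressure_functional_def spin_entropy_def)
qed

lemma pressure_functional_ge:
  assumes t: "t \<in> {0..1}" and ac: "a \<ge> 0" "c \<ge> 0"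
    and M: "\<And>s s'. M \<le> dual_functional \<beta> B s s' t a c"
  shows "ereal M \<le> pressure_functional D \<beta> B t"
proof -
  have t': "t \<ge> 0" "1 - t \<ge> 0" using t by auto
  have "rate D t a + rate D (1 - t) c \<le> ereal (spin_entropy B t + edge_energy \<beta> a c - M)"
    by (rule rate_add_le[OF t']) (use M in \<open>auto simp: dual_functional_def algebra_simps\<close>)
  then have "ereal (M - spin_entropy B t) \<le> ereal (edge_energy \<beta> a c) - rate D t a - rate D (1 - t) c"
    using rate_ge[OF t'(1), of 0 a] rate_ge[OF t'(2), of 0 c]
    by (cases "rate D t a"; cases "rate D (1 - t) c") auto
  also have "\<dots> \<le> G_edge D \<beta> t"
    unfolding G_edge_def by (rule SUP_upper2[of "(a, a + c)"]) (use ac in \<open>auto simp: edge_energy_def\<close>)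
  finally have "ereal (spin_entropy B t) + ereal (M - spin_entropy B t) \<le> ereal (spin_entropy B t) + G_edge D \<beta> t"
    by (rule add_left_mono)
  then show ?thesis by (simp add: pressure_functional_def spin_entropy_def)
qed

end

theorem proposition7p3:
  fixes D :: "nat pmf" and \<beta> B :: real and r :: "nat \<Rightarrow> (nat \<Rightarrow> nat) \<Rightarrow> nat"
  assumes "\<And>s::real. integrable (measure_pmf D) (\<lambda>k. exp (s * real k))"
    and "\<And>n d. n \<ge> 1 \<Longrightarrow> r n d < n"
    and "\<beta> \<ge> 0"
  shows "\<exists>\<psi>::real. \<exists>t\<^sub>0\<in>{0..1}.
      (\<forall>t\<in>{0..1}. pressure_functional D \<beta> B t \<le> pressure_functional D \<beta> B t\<^sub>0) \<and>
      ereal \<psi> = ereal (- B) + pressure_functional D \<beta> B t\<^sub>0 \<and>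
      (\<lambda>n. annealed_pressure r D \<beta> B n) \<longlonglongrightarrow> \<psi>"
proof -
  interpret exp_moments D by unfold_locales (rule assms(1))
  obtain M t a c where opt: "t \<in> {0..1}" "a \<ge> 0" "c \<ge> 0" "\<And>s s'. M \<le> dual_functional \<beta> B s s' t a c"
    and M: "\<And>t a c v. \<lbrakk>t \<in> {0..1}; a \<ge> 0; c \<ge> 0; \<And>s s'. v \<le> dual_functional \<beta> B s s' t a c\<rbrakk> \<Longrightarrow> v \<le> M"
    using variational_maximiser[OF assms(3)] by metis
  have le: "pressure_functional D \<beta> B u \<le> ereal M" if "u \<in> {0..1}" for u
    by (rule pressure_functional_le[OF that M[OF that]])
  have eq: "pressure_functional D \<beta> B t = ereal M"
    by (rule antisym[OF le[OF opt(1)] pressure_functional_ge[OF opt]])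
  have "(\<lambda>n. annealed_pressure r D \<beta> B n) \<longlonglongrightarrow> M - B"
  proof (rule order_tendstoI)
    note lower = annealed_pressure_eventually_gt[where r = r, OF assms(3,2) opt]
    have pos: "\<forall>\<^sub>F n in sequentially.
        0 < measure_pmf.expectation (configuration_model r D n) (partition_function \<beta> B n)"
      using lower[of 1] by (auto elim: eventually_mono)
    fix x
    show "\<forall>\<^sub>F n in sequentially. x < annealed_pressure r D \<beta> B n" if "x < M - B"
      using lower[of "M - B - x"] that by (auto elim: eventually_mono)
    show "\<forall>\<^sub>F n in sequentially. annealed_pressure r D \<beta> B n < x" if "M - B < x"
      using annealed_pressure_eventually_lt[where r = r and B = B and M = M and e = "x - (M - B)",
        OF assms(3,2) M pos] that
      by simp
  qed
  then show ?thesis using le opt(1) by (intro exI[of _ "M - B"] bexI[of _ t]) (auto simp: eq)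
qed

end
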